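(* Let $b>0$, $\sigma>0$, $x_0>0$ with $2b\ge\sigma^2$, and let $C>b\vee 1$. Let $X^C=(X^C_t)_{t\ge 0}$ be the unique strong solution of $$dX^C_t=(b-X^C_t\wedge C)\,dt+\sigma\sqrt{(X^C_t\vee 0)\wedge C}\,dW_t,\qquad X^C_0=x_0,\quad t\ge 0.$$ Then the trajectories of $X^C$ are positive with probability $1$, i.e. $\mathsf{P}\big(X^C_t>0 \text{ for all } t\ge 0\big)=1$.
   Context: Here $x\wedge y=\min(x,y)$, $x\vee y=\max(x,y)$, and $W=(W_t)_{t\ge0}$ is a one-dimensional Wiener process adapted to the filtration of a complete filtered probability space $(\Omega,\mathcal{F},(\mathcal{F}_t)_{t\ge0},\mathsf{P})$. *)

theory Defs
  imports "HOL-Probability.Probability"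
begin

text \<open>
  Time is modelled by type \<^typ>\<open>real\<close>; filtrations and processes are only ever inspected at times
  \<open>t \<ge> 0\<close>, and their values at negative times are irrelevant. A process is a function
  \<open>X :: real \<Rightarrow> 'a \<Rightarrow> real\<close>, with \<open>X t \<omega>\<close> for \<open>X\<^sub>t(\<omega>)\<close>.
\<close>

locale complete_filtered_prob_space = prob_space M + complete_measure M
  for M :: "'a measure" +
  fixes F :: "real \<Rightarrow> 'a measure"
  assumes subalgebra_F: "\<And>t. 0 \<le> t \<Longrightarrow> subalgebra M (F t)"
    and mono_F: "\<And>s t. 0 \<le> s \<Longrightarrow> s \<le> t \<Longrightarrow> sets (F s) \<subseteq> sets (F t)"
    and null_sets_F: "null_sets M \<subseteq> sets (F 0)"

definition adapted :: "(real \<Rightarrow> 'a measure) \<Rightarrow> (real \<Rightarrow> 'a \<Rightarrow> real) \<Rightarrow> bool" where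
  "adapted F X \<longleftrightarrow> (\<forall>t\<ge>0. X t \<in> borel_measurable (F t))"

definition continuous_paths :: "'a measure \<Rightarrow> (real \<Rightarrow> 'a \<Rightarrow> real) \<Rightarrow> bool" where
  "continuous_paths M X \<longleftrightarrow> (AE \<omega> in M. continuous_on {0..} (\<lambda>t. X t \<omega>))"

text \<open>
  A Wiener process relative to the filtration \<open>F\<close>: increments after time \<open>s\<close> are independent of
  \<open>F s\<close>. The second argument of \<^const>\<open>normal_density\<close> is the standard deviation, so
  \<open>sqrt (t - s)\<close> gives variance \<open>t - s\<close>.
\<close>

definition wiener_process ::
    "'a measure \<Rightarrow> (real \<Rightarrow> 'a measure) \<Rightarrow> (real \<Rightarrow> 'a \<Rightarrow> real) \<Rightarrow> bool" where
  "wiener_process M F W \<longleftrightarrow>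
     adapted F W \<and> continuous_paths M W \<and> (AE \<omega> in M. W 0 \<omega> = 0) \<and>
     (\<forall>s t. 0 \<le> s \<and> s < t \<longrightarrow>
        distributed M lborel (\<lambda>\<omega>. W t \<omega> - W s \<omega>)
          (\<lambda>x. ennreal (normal_density 0 (sqrt (t - s)) x)) \<and>
        prob_space.indep_set M (sets (F s))
          (sets (vimage_algebra (space M) (\<lambda>\<omega>. W t \<omega> - W s \<omega>) borel)))"

text \<open>
  The triple \<open>(n, \<tau>, \<xi>)\<close> represents the simple integrand that equals \<open>\<xi> i\<close> on the time interval
  \<open>(\<tau> i, \<tau> (i + 1)]\<close> for \<open>i < n\<close> and vanishes elsewhere.
\<close>

definition simple_integrand ::
    "'a measure \<Rightarrow> (real \<Rightarrow> 'a measure) \<Rightarrow> nat \<Rightarrow> (nat \<Rightarrow> real) \<Rightarrow> (nat \<Rightarrow> 'a \<Rightarrow> real) \<Rightarrow> bool" where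
  "simple_integrand M F n \<tau> \<xi> \<longleftrightarrow>
     0 \<le> \<tau> 0 \<and>
     (\<forall>i<n. \<tau> i \<le> \<tau> (Suc i) \<and> \<xi> i \<in> borel_measurable (F (\<tau> i)) \<and>
            (\<exists>K. \<forall>\<omega>\<in>space M. \<bar>\<xi> i \<omega>\<bar> \<le> K))"

definition simple_process ::
    "nat \<Rightarrow> (nat \<Rightarrow> real) \<Rightarrow> (nat \<Rightarrow> 'a \<Rightarrow> real) \<Rightarrow> real \<Rightarrow> 'a \<Rightarrow> real" where
  "simple_process n \<tau> \<xi> t \<omega> = (\<Sum>i<n. \<xi> i \<omega> * indicator {\<tau> i<..\<tau> (Suc i)} t)"

definition simple_ito_integral ::
    "(real \<Rightarrow> 'a \<Rightarrow> real) \<Rightarrow> nat \<Rightarrow> (nat \<Rightarrow> real) \<Rightarrow> (nat \<Rightarrow> 'a \<Rightarrow> real) \<Rightarrow> real \<Rightarrow> 'a \<Rightarrow> real" where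
  "simple_ito_integral W n \<tau> \<xi> t \<omega> =
     (\<Sum>i<n. \<xi> i \<omega> * (W (min (\<tau> (Suc i)) t) \<omega> - W (min (\<tau> i) t) \<omega>))"

text \<open>
  Convergence to \<open>0\<close> in probability. Measurability is part of the definition because
  \<^const>\<open>measure\<close> is \<open>0\<close> on non-measurable sets.
\<close>

definition null_in_prob :: "'a measure \<Rightarrow> (nat \<Rightarrow> 'a \<Rightarrow> ennreal) \<Rightarrow> bool" where
  "null_in_prob M D \<longleftrightarrow>
     (\<forall>k. D k \<in> borel_measurable M) \<and>
     (\<forall>\<epsilon>>0. (\<lambda>k. measure M {\<omega> \<in> space M. ennreal \<epsilon> < D k \<omega>}) \<longlonglongrightarrow> 0)"

text \<open>
  \<open>ito_integral M F W H I\<close>: the process \<open>I\<close> is (a version with almost surely continuous paths of)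
  the stochastic integral \<open>I t = \<integral>\<^sub>0\<^sup>t H s dW s\<close>, obtained as usual as limit in probability of the
  integrals of simple integrands \<open>H\<^sub>k\<close> with \<open>\<integral>\<^sub>0\<^sup>t (H\<^sub>k s - H s)\<^sup>2 ds \<rightarrow> 0\<close> in probability for
  every \<open>t\<close>. The limit does not depend on the choice of \<open>H\<^sub>k\<close>, and such \<open>H\<^sub>k\<close> exist for every
  progressively measurable \<open>H\<close> with \<open>\<integral>\<^sub>0\<^sup>t (H s)\<^sup>2 ds < \<infinity>\<close> almost surely.
\<close>

definition ito_integral ::
    "'a measure \<Rightarrow> (real \<Rightarrow> 'a measure) \<Rightarrow> (real \<Rightarrow> 'a \<Rightarrow> real) \<Rightarrow>
     (real \<Rightarrow> 'a \<Rightarrow> real) \<Rightarrow> (real \<Rightarrow> 'a \<Rightarrow> real) \<Rightarrow> bool" where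
  "ito_integral M F W H I \<longleftrightarrow>
     adapted F I \<and> continuous_paths M I \<and>
     (\<exists>n \<tau> \<xi>. (\<forall>k. simple_integrand M F (n k) (\<tau> k) (\<xi> k)) \<and>
       (\<forall>t\<ge>0.
         null_in_prob M (\<lambda>k \<omega>. \<integral>\<^sup>+s\<in>{0..t}.
             ennreal ((simple_process (n k) (\<tau> k) (\<xi> k) s \<omega> - H s \<omega>)\<^sup>2) \<partial>lborel) \<and>
         null_in_prob M (\<lambda>k \<omega>.
             ennreal \<bar>simple_ito_integral W (n k) (\<tau> k) (\<xi> k) t \<omega> - I t \<omega>\<bar>)))"

definition augmented_natural_filtration ::
    "'a measure \<Rightarrow> (real \<Rightarrow> 'a \<Rightarrow> real) \<Rightarrow> real \<Rightarrow> 'a measure" where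
  "augmented_natural_filtration M W t =
     sigma (space M)
       ({W s -` B \<inter> space M | s B. 0 \<le> s \<and> s \<le> t \<and> B \<in> sets borel} \<union> null_sets M)"

text \<open>
  Strong solution of \<open>dX\<^sub>t = \<mu>(X\<^sub>t) dt + \<gamma>(X\<^sub>t) dW\<^sub>t\<close>, \<open>X\<^sub>0 = x0\<close>, on the given space and for the given
  \<open>W\<close>. "Strong" refers to adaptedness to the filtration generated by \<open>W\<close> and the null sets
  (which is contained in \<open>F\<close> whenever \<open>W\<close> is \<open>F\<close>-adapted and \<open>F\<close> is complete).
\<close>

definition strong_solution ::
    "'a measure \<Rightarrow> (real \<Rightarrow> 'a measure) \<Rightarrow> (real \<Rightarrow> 'a \<Rightarrow> real) \<Rightarrow>
     (real \<Rightarrow> real) \<Rightarrow> (real \<Rightarrow> real) \<Rightarrow> real \<Rightarrow> (real \<Rightarrow> 'a \<Rightarrow> real) \<Rightarrow> bool" where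
  "strong_solution M F W \<mu> \<gamma> x0 X \<longleftrightarrow>
     adapted (augmented_natural_filtration M W) X \<and> continuous_paths M X \<and>
     (AE \<omega> in M. X 0 \<omega> = x0) \<and>
     (AE \<omega> in M. \<forall>t\<ge>0. set_integrable lborel {0..t} (\<lambda>s. \<mu> (X s \<omega>))) \<and>
     (\<exists>I. ito_integral M F W (\<lambda>s \<omega>. \<gamma> (X s \<omega>)) I \<and>
       (AE \<omega> in M. \<forall>t\<ge>0.
          X t \<omega> = x0 + set_lebesgue_integral lborel {0..t} (\<lambda>s. \<mu> (X s \<omega>)) + I t \<omega>))"

end

theory Submission
  imports Defs
begin

text \<open>
  For \<open>f\<^sub>e x = ln (1 + 1 / (x + e))\<close> the Feller condition \<open>\<sigma>\<^sup>2 \<le> 2 b\<close> bounds the generator of the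
  diffusion, applied to \<open>f\<^sub>e\<close>, by \<open>1 + b\<close>, uniformly in \<open>e > 0\<close>. Stopping \<open>f\<^sub>e (X)\<close> when \<open>X\<close> first drops
  to \<open>e\<close> therefore shows that \<open>X\<close> reaches level \<open>e\<close> before time \<open>T\<close> with probability at most about
  \<open>(f\<^sub>e x0 + T (1 + b)) / f\<^sub>e e\<close>, which vanishes as \<open>e\<close> tends to \<open>0\<close>.

  Ito's formula is not needed: the stopping argument is carried out on the time grid \<open>j T / N\<close>, where
  the Taylor expansion of \<open>f\<^sub>e\<close> only involves second and fourth moments of the increments of the
  stochastic integral, and then \<open>N\<close> tends to infinity. Since \<open>f\<^sub>e\<close> is decreasing, lower bounds on the
  increments of \<open>X\<close> suffice, so that the unbounded drift at negative values of \<open>X\<close> does no harm.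
\<close>

text \<open>The definition of \<open>ito_integral\<close> provides only limits in probability of
  integrals of simple integrands, with no bound common to all of them, so not even integrability of
  the increments is immediate. The truncation at \<open>C\<close> rescues the moments: the diffusion
  coefficient takes values in \<open>[0, \<sigma> * sqrt C]\<close>, the simple integrands may be
  clipped to that interval, and a Lenglart estimate shows that the clipped integrals keep the same
  limit.

  Freezing the coefficients on a grid cell costs the oscillation of the path there. Uniform
  continuity gives no rate for it, only convergence in probability; this suffices because each of
  the \<open>N\<close> cells contributes the error times \<open>T / N\<close>. The Taylor remainder
  is of order \<open>T / N\<close> to the power 3/2.

  To leading order at 0, \<open>- ln x\<close> is up to sign the scale function of the critical case
  \<open>\<sigma>\<^sup>2 = 2 * b\<close>. The form \<open>ln (1 + 1 / x)\<close> is in addition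
  nonnegative and bounded at infinity, so that paths need not be stopped at high levels.\<close>

context complete_filtered_prob_space
begin

lemma space_F: "0 \<le> t \<Longrightarrow> space (F t) = space M"
  using subalgebra_F[of t] by (simp add: subalgebra_def)

lemma measurable_F_mono:
  assumes "0 \<le> s" "s \<le> t" "f \<in> borel_measurable (F s)"
  shows "f \<in> borel_measurable (F t)"
proof -
  have "subalgebra (F t) (F s)"
    using assms(1,2) space_F[of s] space_F[of t] mono_F[of s t] by (auto simp: subalgebra_def)
  then show ?thesis
    using assms(3) by (rule measurable_from_subalg)
qed

lemma measurable_F_M: "0 \<le> t \<Longrightarrow> f \<in> borel_measurable (F t) \<Longrightarrow> f \<in> borel_measurable M"
  using subalgebra_F measurable_from_subalg by blast

end

section \<open>Gaussian increments independent of the past\<close>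

locale wiener_filtration = complete_filtered_prob_space +
  fixes W :: "real \<Rightarrow> 'a \<Rightarrow> real"
  assumes wiener: "wiener_process M F W"
begin

lemma measurable_W: "0 \<le> s \<Longrightarrow> s \<le> t \<Longrightarrow> W s \<in> borel_measurable (F t)"
  using wiener measurable_F_mono unfolding wiener_process_def adapted_def by blast

lemma measurable_W_M [measurable]: "0 \<le> t \<Longrightarrow> W t \<in> borel_measurable M"
  using measurable_F_M measurable_W by blast

text \<open>Moments of the centred normal law. The case \<open>s = t\<close> is treated separately
  because clamping a partition produces empty cells, about which \<open>wiener_process\<close> says
  nothing.\<close>

lemma increment_moments:
  assumes "0 \<le> s" "s \<le> t"
  shows "integrable M (\<lambda>\<omega>. (W t \<omega> - W s \<omega>) ^ k)"
    and "expectation (\<lambda>\<omega>. W t \<omega> - W s \<omega>) = 0"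
    and "expectation (\<lambda>\<omega>. (W t \<omega> - W s \<omega>)\<^sup>2) = t - s"
    and "expectation (\<lambda>\<omega>. (W t \<omega> - W s \<omega>) ^ 3) = 0"
    and "expectation (\<lambda>\<omega>. (W t \<omega> - W s \<omega>) ^ 4) = 3 * (t - s)\<^sup>2"
proof -
  let ?D = "\<lambda>\<omega>. W t \<omega> - W s \<omega>" and ?n = "normal_density 0 (sqrt (t - s))"
  have D: "distributed M lborel ?D (\<lambda>x. ennreal (?n x))" if "s < t"
    using wiener assms that unfolding wiener_process_def by blast
  have moment: "expectation (\<lambda>\<omega>. ?D \<omega> ^ k) = (\<integral>x. ?n x * x ^ k \<partial>lborel)" if "s < t" for k
    using distributed_integral[OF D[OF that], of "\<lambda>x. x ^ k"] by simp
  have odd: "(\<integral>x. ?n x * x ^ (2 * k + 1) \<partial>lborel) = 0" if "s < t" for k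
    using integral_normal_moment_odd[of "sqrt (t - s)" 0 k] that by simp
  have even: "(\<integral>x. ?n x * x ^ (2 * k) \<partial>lborel) = fact (2 * k) / ((2 / (t - s)) ^ k * fact k)"
    if "s < t" for k
    using integral_normal_moment_even[of "sqrt (t - s)" 0 k] that by simp
  show "integrable M (\<lambda>\<omega>. ?D \<omega> ^ k)"
    using distributed_integrable[OF D, of "\<lambda>x. x ^ k"]
      integrable_normal_moment[of "sqrt (t - s)" 0 k] assms
    by (cases "s = t") (auto simp: power_0_left)
  show "expectation ?D = 0" "expectation (\<lambda>\<omega>. ?D \<omega> ^ 3) = 0"
    using moment[of 1] odd[of 0] moment[of 3] odd[of 1] assms by (cases "s = t"; simp)+
  show "expectation (\<lambda>\<omega>. (?D \<omega>)\<^sup>2) = t - s"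
    using moment[of 2] even[of 1] assms by (cases "s = t") auto
  show "expectation (\<lambda>\<omega>. ?D \<omega> ^ 4) = 3 * (t - s)\<^sup>2"
    using moment[of 4] even[of 2] assms
    by (cases "s = t") (auto simp: fact_numeral power2_eq_square field_simps)
qed

text \<open>The source of all martingale properties: a factor known at time \<open>s\<close> splits
  off from powers of the later increment. Independence of \<open>F s\<close> passes to the smaller
  sigma algebra generated by \<open>Z\<close>, and then to powers of the increment.\<close>

lemma increment_indep:
  assumes "0 \<le> s" "s \<le> t" "Z \<in> borel_measurable (F s)" "integrable M Z"
  shows "integrable M (\<lambda>\<omega>. Z \<omega> * (W t \<omega> - W s \<omega>) ^ k)"
    and "expectation (\<lambda>\<omega>. Z \<omega> * (W t \<omega> - W s \<omega>) ^ k)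
      = expectation Z * expectation (\<lambda>\<omega>. (W t \<omega> - W s \<omega>) ^ k)"
proof -
  let ?D = "\<lambda>\<omega>. W t \<omega> - W s \<omega>"
  have "integrable M (\<lambda>\<omega>. Z \<omega> * ?D \<omega> ^ k) \<and>
    expectation (\<lambda>\<omega>. Z \<omega> * ?D \<omega> ^ k) = expectation Z * expectation (\<lambda>\<omega>. ?D \<omega> ^ k)"
  proof (cases "s = t")
    case True
    then show ?thesis
      using assms(4) by (cases "k = 0") (auto simp: prob_space)
  next
    case False
    then have ind: "indep_set (sets (F s)) (sets (vimage_algebra (space M) ?D borel))"
      using wiener assms unfolding wiener_process_def by force
    have [measurable]: "Z \<in> borel_measurable M" "W t \<in> borel_measurable M" "W s \<in> borel_measurable M"
      using measurable_F_M[OF assms(1,3)] measurable_W_M assms by simp_all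
    have "indep_var borel Z borel ?D"
      unfolding indep_var_eq
    proof safe
      have "sigma_sets (space M) {Z -` A \<inter> space M |A. A \<in> sets borel} \<subseteq> sets (F s)"
        using measurable_sets[OF assms(3)] space_F[OF assms(1)]
        by (intro sets.sigma_sets_subset[of _ "F s", simplified space_F[OF assms(1)]]) auto
      moreover have "sigma_sets (space M) {?D -` A \<inter> space M |A. A \<in> sets borel}
          \<subseteq> sets (vimage_algebra (space M) ?D borel)"
        by (subst sets_vimage_algebra) simp
      ultimately show "indep_set (sigma_sets (space M) {Z -` A \<inter> space M |A. A \<in> sets borel})
          (sigma_sets (space M) {?D -` A \<inter> space M |A. A \<in> sets borel})"
        using ind unfolding indep_set_def
        by (elim indep_sets_mono_sets) (auto split: bool.split)
    qed simp_all
    then have "indep_var borel (id \<circ> Z) borel ((\<lambda>x. x ^ k) \<circ> ?D)"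
      by (rule indep_var_compose) simp_all
    then have "indep_var borel Z borel (\<lambda>\<omega>. ?D \<omega> ^ k)"
      by (simp add: comp_def)
    then show ?thesis
      using assms(4) increment_moments(1)[OF assms(1,2)]
        indep_var_integrable indep_var_lebesgue_integral by blast
  qed
  then show "integrable M (\<lambda>\<omega>. Z \<omega> * ?D \<omega> ^ k)"
    and "expectation (\<lambda>\<omega>. Z \<omega> * ?D \<omega> ^ k) = expectation Z * expectation (\<lambda>\<omega>. ?D \<omega> ^ k)"
    by auto
qed

end

section \<open>Integrals of simple processes\<close>

lemma partition_le:
  fixes \<tau> :: "nat \<Rightarrow> real"
  assumes "\<And>i. i < n \<Longrightarrow> \<tau> i \<le> \<tau> (Suc i)" "i \<le> j" "j \<le> n"
  shows "\<tau> i \<le> \<tau> j"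
  using assms(2,3)
proof (induction j)
  case (Suc j)
  then show ?case
    using assms(1)[of j] by (cases "i = Suc j") auto
qed simp

lemma integrable_bounded_mult:
  fixes f g :: "'a \<Rightarrow> real"
  assumes "integrable M f" "g \<in> borel_measurable M" "\<And>\<omega>. \<omega> \<in> space M \<Longrightarrow> \<bar>g \<omega>\<bar> \<le> B"
  shows "integrable M (\<lambda>\<omega>. g \<omega> * f \<omega>)"
proof (rule Bochner_Integration.integrable_bound)
  show "integrable M (\<lambda>\<omega>. B * f \<omega>)" using assms(1) by simp
  show "(\<lambda>\<omega>. g \<omega> * f \<omega>) \<in> borel_measurable M" using assms(1,2) by measurable
  show "AE \<omega> in M. norm (g \<omega> * f \<omega>) \<le> norm (B * f \<omega>)"
    using assms(3) by (intro AE_I2) (force simp: abs_mult intro!: mult_right_mono)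
qed

text \<open>Since \<open>\<bar>x\<bar> ^ k \<le> 1 + x ^ 4\<close>, fourth moments are the only
  integrability that has to be carried along.\<close>

lemma (in prob_space) integrable_power_4:
  fixes f :: "'a \<Rightarrow> real"
  assumes "f \<in> borel_measurable M" "integrable M (\<lambda>\<omega>. f \<omega> ^ 4)" "k \<le> 4"
  shows "integrable M (\<lambda>\<omega>. f \<omega> ^ k)"
proof (rule Bochner_Integration.integrable_bound)
  show "integrable M (\<lambda>\<omega>. 1 + f \<omega> ^ 4)" using assms(2) by simp
  show "(\<lambda>\<omega>. f \<omega> ^ k) \<in> borel_measurable M" using assms(1) by measurable
  have "\<bar>x\<bar> ^ k \<le> 1 + x ^ 4" for x :: real
  proof (cases "\<bar>x\<bar> \<le> 1")
    case True
    then have "\<bar>x\<bar> ^ k \<le> 1" by (simp add: power_le_one)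
    then show ?thesis by (simp add: add_increasing2)
  next
    case False
    then have "\<bar>x\<bar> ^ k \<le> \<bar>x\<bar> ^ 4" using assms(3) by (intro power_increasing) auto
    then show ?thesis by (simp add: power_even_abs)
  qed
  then show "AE \<omega> in M. norm (f \<omega> ^ k) \<le> norm (1 + f \<omega> ^ 4)"
    by (intro AE_I2) (simp add: power_abs abs_of_nonneg)
qed

section \<open>Moments of partial sums over a partition\<close>

context wiener_filtration
begin

context
  fixes \<rho> :: "nat \<Rightarrow> real" and \<xi> :: "nat \<Rightarrow> 'a \<Rightarrow> real" and n :: nat and s G :: real
    and S :: "nat \<Rightarrow> 'a \<Rightarrow> real"
  assumes s: "0 \<le> s" "s \<le> \<rho> 0"
    and \<rho>_step: "\<And>i. i < n \<Longrightarrow> \<rho> i \<le> \<rho> (Suc i)"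
    and \<xi>_meas: "\<And>i. i < n \<Longrightarrow> \<xi> i \<in> borel_measurable (F (\<rho> i))"
    and \<xi>_bound: "\<And>i \<omega>. i < n \<Longrightarrow> \<omega> \<in> space M \<Longrightarrow> \<bar>\<xi> i \<omega>\<bar> \<le> G"
  defines "S \<equiv> \<lambda>m \<omega>. \<Sum>i<m. \<xi> i \<omega> * (W (\<rho> (Suc i)) \<omega> - W (\<rho> i) \<omega>)"
begin

lemmas partition_mono = partition_le[of n \<rho>, OF \<rho>_step]

lemma partition_ge: "j \<le> n \<Longrightarrow> s \<le> \<rho> j" "j \<le> n \<Longrightarrow> 0 \<le> \<rho> j"
  using partition_mono[of 0 j] s by auto

lemma simple_sum_measurable:
  assumes "m \<le> n"
  shows "S m \<in> borel_measurable (F (\<rho> m))"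
proof -
  have "\<xi> i \<in> borel_measurable (F (\<rho> m))" "W (\<rho> (Suc i)) \<in> borel_measurable (F (\<rho> m))"
    "W (\<rho> i) \<in> borel_measurable (F (\<rho> m))" if "i < m" for i
    using that assms partition_mono[of i m] partition_mono[of "Suc i" m] partition_ge
      measurable_F_mono[OF _ _ \<xi>_meas] measurable_W
    by auto
  then show ?thesis
    unfolding S_def by (intro borel_measurable_sum borel_measurable_times borel_measurable_diff) auto
qed

lemma simple_sum_measurable_M: "m \<le> n \<Longrightarrow> S m \<in> borel_measurable M"
  using simple_sum_measurable measurable_F_M partition_ge by blast

text \<open>The crude bound \<open>(x + y) ^ 4 \<le> 8 * (x ^ 4 + y ^ 4)\<close> settles
  integrability by induction, so that the sharp estimates can later expand expectations term by
  term.\<close>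

lemma integrable_simple_sum_4: "m \<le> n \<Longrightarrow> integrable M (\<lambda>\<omega>. S m \<omega> ^ 4)"
proof (induction m)
  case 0
  then show ?case by (simp add: S_def)
next
  case (Suc m)
  let ?D = "\<lambda>\<omega>. W (\<rho> (Suc m)) \<omega> - W (\<rho> m) \<omega>"
  have m: "m < n" "m \<le> n" using Suc by auto
  have "integrable M (\<lambda>\<omega>. (\<xi> m \<omega> * ?D \<omega>) ^ 4)"
    using integrable_bounded_mult[OF increment_moments(1)[OF partition_ge(2) \<rho>_step, of m 4],
        of "\<lambda>\<omega>. \<xi> m \<omega> ^ 4" "G ^ 4"]
      m measurable_F_M[OF partition_ge(2) \<xi>_meas] power_mono[OF \<xi>_bound[of m], of _ 4]
    by (simp add: power_mult_distrib power_abs)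
  then have int: "integrable M (\<lambda>\<omega>. 8 * (S m \<omega> ^ 4 + (\<xi> m \<omega> * ?D \<omega>) ^ 4))"
    using Suc by simp
  show ?case
  proof (rule Bochner_Integration.integrable_bound[OF int])
    show "(\<lambda>\<omega>. S (Suc m) \<omega> ^ 4) \<in> borel_measurable M"
      using simple_sum_measurable_M[OF Suc.prems] by measurable
    have "(x + y) ^ 4 \<le> 8 * (x ^ 4 + y ^ 4)" for x y :: real
    proof -
      have "(x + y)\<^sup>2 \<le> 2 * (x\<^sup>2 + y\<^sup>2)" using sum_squares_bound[of x y] by (simp add: power2_sum)
      then have "((x + y)\<^sup>2)\<^sup>2 \<le> (2 * (x\<^sup>2 + y\<^sup>2))\<^sup>2" by (rule power_mono) simp
      also have "\<dots> \<le> 8 * ((x\<^sup>2)\<^sup>2 + (y\<^sup>2)\<^sup>2)"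
        using sum_squares_bound[of "x\<^sup>2" "y\<^sup>2"] by (simp add: power2_sum power_mult_distrib)
      finally show ?thesis by simp
    qed
    then show "AE \<omega> in M. norm (S (Suc m) \<omega> ^ 4) \<le> norm (8 * (S m \<omega> ^ 4 + (\<xi> m \<omega> * ?D \<omega>) ^ 4))"
      by (intro AE_I2) (simp add: S_def)
  qed
qed

lemma integrable_simple_sum_power: "m \<le> n \<Longrightarrow> k \<le> 4 \<Longrightarrow> integrable M (\<lambda>\<omega>. S m \<omega> ^ k)"
  by (rule integrable_power_4[OF simple_sum_measurable_M integrable_simple_sum_4])

text \<open>Expanding a power of \<open>S (Suc m)\<close> in its last increment yields terms of this
  shape. Everything but the increment is known at time \<open>\<rho> m\<close>, so the moment of the
  increment factors out. The weight \<open>Y\<close>, known at time \<open>s\<close>, makes the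
  resulting identities conditional on \<open>F s\<close>.\<close>

lemma simple_sum_cross_term:
  assumes "m < n" "Y \<in> borel_measurable (F s)" "\<And>\<omega>. \<omega> \<in> space M \<Longrightarrow> \<bar>Y \<omega>\<bar> \<le> B" "j \<le> 4"
  shows "integrable M (\<lambda>\<omega>. Y \<omega> * S m \<omega> ^ j * \<xi> m \<omega> ^ k)" (is "integrable M ?Z")
    and "integrable M (\<lambda>\<omega>. Y \<omega> * S m \<omega> ^ j * \<xi> m \<omega> ^ k * (W (\<rho> (Suc m)) \<omega> - W (\<rho> m) \<omega>) ^ l)"
    and "expectation (\<lambda>\<omega>. Y \<omega> * S m \<omega> ^ j * \<xi> m \<omega> ^ k * (W (\<rho> (Suc m)) \<omega> - W (\<rho> m) \<omega>) ^ l)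
       = expectation (\<lambda>\<omega>. Y \<omega> * S m \<omega> ^ j * \<xi> m \<omega> ^ k)
         * expectation (\<lambda>\<omega>. (W (\<rho> (Suc m)) \<omega> - W (\<rho> m) \<omega>) ^ l)"
proof -
  have m: "0 \<le> \<rho> m" "s \<le> \<rho> m" "\<rho> m \<le> \<rho> (Suc m)" "m \<le> n"
    using assms(1) partition_ge \<rho>_step by auto
  have [measurable]: "Y \<in> borel_measurable (F (\<rho> m))" "S m \<in> borel_measurable (F (\<rho> m))"
    "\<xi> m \<in> borel_measurable (F (\<rho> m))"
    using measurable_F_mono[OF s(1) m(2) assms(2)] simple_sum_measurable m \<xi>_meas assms(1) by auto
  have Z: "?Z \<in> borel_measurable (F (\<rho> m))" by measurable
  have [measurable]: "Y \<in> borel_measurable M" "\<xi> m \<in> borel_measurable M"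
    using measurable_F_M[OF m(1)] \<open>Y \<in> borel_measurable (F (\<rho> m))\<close> \<open>\<xi> m \<in> borel_measurable (F (\<rho> m))\<close>
    by blast+
  have "integrable M (\<lambda>\<omega>. (Y \<omega> * \<xi> m \<omega> ^ k) * S m \<omega> ^ j)"
  proof (rule integrable_bounded_mult[OF integrable_simple_sum_power])
    show "\<bar>Y \<omega> * \<xi> m \<omega> ^ k\<bar> \<le> B * G ^ k" if "\<omega> \<in> space M" for \<omega>
      using assms(3)[OF that] \<xi>_bound[OF assms(1) that]
      unfolding abs_mult power_abs by (intro mult_mono power_mono) auto
  qed (use m assms in auto)
  then show int: "integrable M ?Z" by (simp add: ac_simps)
  show "integrable M (\<lambda>\<omega>. ?Z \<omega> * (W (\<rho> (Suc m)) \<omega> - W (\<rho> m) \<omega>) ^ l)"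
    "expectation (\<lambda>\<omega>. ?Z \<omega> * (W (\<rho> (Suc m)) \<omega> - W (\<rho> m) \<omega>) ^ l)
     = expectation ?Z * expectation (\<lambda>\<omega>. (W (\<rho> (Suc m)) \<omega> - W (\<rho> m) \<omega>) ^ l)"
    using increment_indep[OF m(1,3) Z int] by auto
qed

lemma expectation_simple_sum:
  assumes Y: "Y \<in> borel_measurable (F s)" "\<And>\<omega>. \<omega> \<in> space M \<Longrightarrow> \<bar>Y \<omega>\<bar> \<le> B"
  shows "m \<le> n \<Longrightarrow> expectation (\<lambda>\<omega>. Y \<omega> * S m \<omega>) = 0"
proof (induction m)
  case (Suc m)
  then have m: "m < n" "m \<le> n" by auto
  note cross = simple_sum_cross_term[OF m(1) Y]
  have [simp]: "integrable M (\<lambda>\<omega>. Y \<omega> * S m \<omega>)"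
    using cross(1)[of 1 0] by simp
  have "expectation (\<lambda>\<omega>. Y \<omega> * S (Suc m) \<omega>)
    = expectation (\<lambda>\<omega>. Y \<omega> * S m \<omega> + Y \<omega> * \<xi> m \<omega> * (W (\<rho> (Suc m)) \<omega> - W (\<rho> m) \<omega>))"
    by (simp add: S_def algebra_simps)
  also have "\<dots> = 0"
    using Suc cross(2,3)[of 0 1 1] increment_moments(2)[OF partition_ge(2) \<rho>_step, of m] m by simp
  finally show ?case .
qed (simp add: S_def)

text \<open>The Ito isometry, conditional on \<open>F s\<close> through the weight \<open>Y\<close>:
  the mixed term of the square has mean zero, and the squared increment contributes the length of
  its cell.\<close>

lemma expectation_simple_sum_square:
  assumes Y: "Y \<in> borel_measurable (F s)" "\<And>\<omega>. \<omega> \<in> space M \<Longrightarrow> \<bar>Y \<omega>\<bar> \<le> B"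
  shows "m \<le> n \<Longrightarrow> expectation (\<lambda>\<omega>. Y \<omega> * (S m \<omega>)\<^sup>2)
    = expectation (\<lambda>\<omega>. Y \<omega> * (\<Sum>i<m. (\<xi> i \<omega>)\<^sup>2 * (\<rho> (Suc i) - \<rho> i)))"
proof (induction m)
  case (Suc m)
  then have m: "m < n" "m \<le> n" by auto
  let ?D = "\<lambda>\<omega>. W (\<rho> (Suc m)) \<omega> - W (\<rho> m) \<omega>"
  note D = increment_moments[OF partition_ge(2) \<rho>_step, of m]
  note cross = simple_sum_cross_term[OF m(1) Y]
  have int: "integrable M (\<lambda>\<omega>. Y \<omega> * (\<Sum>i<m. (\<xi> i \<omega>)\<^sup>2 * (\<rho> (Suc i) - \<rho> i)))"
    unfolding sum_distrib_left
  proof (intro Bochner_Integration.integrable_sum)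
    fix i assume "i \<in> {..<m}"
    then show "integrable M (\<lambda>\<omega>. Y \<omega> * ((\<xi> i \<omega>)\<^sup>2 * (\<rho> (Suc i) - \<rho> i)))"
      using simple_sum_cross_term(1)[OF _ Y, of i 0 2] m
      by (auto simp: mult.assoc[symmetric])
  qed
  have "expectation (\<lambda>\<omega>. Y \<omega> * (S (Suc m) \<omega>)\<^sup>2)
    = expectation (\<lambda>\<omega>. Y \<omega> * (S m \<omega>)\<^sup>2 + 2 * (Y \<omega> * S m \<omega> * \<xi> m \<omega> * ?D \<omega>)
        + Y \<omega> * (\<xi> m \<omega>)\<^sup>2 * (?D \<omega>)\<^sup>2)"
    by (rule arg_cong[where f = expectation]) (simp add: S_def power2_eq_square algebra_simps)
  also have "\<dots> = expectation (\<lambda>\<omega>. Y \<omega> * (S m \<omega>)\<^sup>2) + expectation (\<lambda>\<omega>. Y \<omega> * (\<xi> m \<omega>)\<^sup>2) * (\<rho> (Suc m) - \<rho> m)"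
    using cross(1)[of 2 0] cross(2,3)[of 1 1 1] cross(2,3)[of 0 2 2] D m by simp
  also have "\<dots> = expectation (\<lambda>\<omega>. Y \<omega> * (\<Sum>i<m. (\<xi> i \<omega>)\<^sup>2 * (\<rho> (Suc i) - \<rho> i))
      + Y \<omega> * (\<xi> m \<omega>)\<^sup>2 * (\<rho> (Suc m) - \<rho> m))"
    using Suc m int cross(1)[of 0 2] by simp
  finally show ?case
    by (simp add: algebra_simps)
qed (simp add: S_def)

lemma expectation_simple_sum_square_le:
  assumes "m \<le> n"
  shows "expectation (\<lambda>\<omega>. (S m \<omega>)\<^sup>2) \<le> G\<^sup>2 * (\<rho> m - \<rho> 0)"
proof -
  have "expectation (\<lambda>\<omega>. (S m \<omega>)\<^sup>2) = expectation (\<lambda>\<omega>. \<Sum>i<m. (\<xi> i \<omega>)\<^sup>2 * (\<rho> (Suc i) - \<rho> i))"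
    using expectation_simple_sum_square[of "\<lambda>_. 1" 1 m] assms by simp
  also have "\<dots> = (\<Sum>i<m. expectation (\<lambda>\<omega>. (\<xi> i \<omega>)\<^sup>2) * (\<rho> (Suc i) - \<rho> i))"
    using simple_sum_cross_term(1)[of _ "\<lambda>_. 1" 1 0 2] assms
    by (subst Bochner_Integration.integral_sum) (auto intro!: Bochner_Integration.integrable_mult_left)
  also have "\<dots> \<le> (\<Sum>i<m. G\<^sup>2 * (\<rho> (Suc i) - \<rho> i))"
  proof (intro sum_mono mult_right_mono)
    fix i assume i: "i \<in> {..<m}"
    have "expectation (\<lambda>\<omega>. (\<xi> i \<omega>)\<^sup>2) \<le> expectation (\<lambda>\<omega>. G\<^sup>2)"
      using simple_sum_cross_term(1)[of _ "\<lambda>_. 1" 1 0 2] assms i power_mono[OF \<xi>_bound[of i], of _ 2]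
      by (intro integral_mono) auto
    then show "expectation (\<lambda>\<omega>. (\<xi> i \<omega>)\<^sup>2) \<le> G\<^sup>2" by (simp add: prob_space)
  qed (use \<rho>_step assms in auto)
  also have "\<dots> = G\<^sup>2 * (\<rho> m - \<rho> 0)"
    by (simp add: sum_distrib_left[symmetric] sum_lessThan_telescope)
  finally show ?thesis .
qed

text \<open>The bound is the fourth moment of a centred Gaussian of variance
  \<open>G\<^sup>2 * (\<rho> m - \<rho> 0)\<close>. It reproduces itself exactly under induction:
  odd powers of the new increment vanish, and the other terms are dominated by the three summands of
  the square of (old length + new length).\<close>

lemma expectation_simple_sum_4_le: "m \<le> n \<Longrightarrow> expectation (\<lambda>\<omega>. S m \<omega> ^ 4) \<le> 3 * G ^ 4 * (\<rho> m - \<rho> 0)\<^sup>2"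
proof (induction m)
  case (Suc m)
  then have m: "m < n" "m \<le> n" by auto
  let ?D = "\<lambda>\<omega>. W (\<rho> (Suc m)) \<omega> - W (\<rho> m) \<omega>"
  let ?d = "\<rho> (Suc m) - \<rho> m"
  note D = increment_moments[OF partition_ge(2) \<rho>_step, of m]
  note cross = simple_sum_cross_term[OF m(1), of "\<lambda>_. 1" 1]
  have d: "0 \<le> ?d" using \<rho>_step m by simp
  have "expectation (\<lambda>\<omega>. S (Suc m) \<omega> ^ 4)
    = expectation (\<lambda>\<omega>. S m \<omega> ^ 4 + 4 * (S m \<omega> ^ 3 * \<xi> m \<omega> ^ 1 * ?D \<omega> ^ 1)
        + 6 * (S m \<omega> ^ 2 * \<xi> m \<omega> ^ 2 * ?D \<omega> ^ 2)
        + 4 * (S m \<omega> ^ 1 * \<xi> m \<omega> ^ 3 * ?D \<omega> ^ 3)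
        + \<xi> m \<omega> ^ 4 * ?D \<omega> ^ 4)"
    by (rule arg_cong[where f = expectation]) (simp add: S_def eval_nat_numeral algebra_simps)
  also have "\<dots> = expectation (\<lambda>\<omega>. S m \<omega> ^ 4) + 6 * expectation (\<lambda>\<omega>. S m \<omega> ^ 2 * \<xi> m \<omega> ^ 2) * ?d
      + 3 * expectation (\<lambda>\<omega>. \<xi> m \<omega> ^ 4) * ?d\<^sup>2"
    using cross(1)[of 4 0] cross(2,3)[of 3 1 1] cross(2,3)[of 2 2 2] cross(2,3)[of 1 3 3]
      cross(2,3)[of 0 4 4] D m by simp
  also have "\<dots> \<le> 3 * G ^ 4 * (\<rho> m - \<rho> 0)\<^sup>2 + 6 * (G\<^sup>2 * (G\<^sup>2 * (\<rho> m - \<rho> 0))) * ?d + 3 * G ^ 4 * ?d\<^sup>2"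
  proof (intro add_mono mult_right_mono mult_left_mono)
    show "expectation (\<lambda>\<omega>. S m \<omega> ^ 4) \<le> 3 * G ^ 4 * (\<rho> m - \<rho> 0)\<^sup>2"
      using Suc by simp
    have "expectation (\<lambda>\<omega>. S m \<omega> ^ 2 * \<xi> m \<omega> ^ 2) \<le> expectation (\<lambda>\<omega>. S m \<omega> ^ 2 * G\<^sup>2)"
      using cross(1)[of 2 2] integrable_simple_sum_power[OF m(2), of 2]
        power_mono[OF \<xi>_bound[OF m(1)], of _ 2]
      by (intro integral_mono) (auto intro!: mult_left_mono)
    also have "\<dots> \<le> G\<^sup>2 * (G\<^sup>2 * (\<rho> m - \<rho> 0))"
      using mult_left_mono[OF expectation_simple_sum_square_le[OF m(2)], of "G\<^sup>2"]
      by (simp add: mult.commute[of _ "G\<^sup>2"])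
    finally show "expectation (\<lambda>\<omega>. S m \<omega> ^ 2 * \<xi> m \<omega> ^ 2) \<le> G\<^sup>2 * (G\<^sup>2 * (\<rho> m - \<rho> 0))" .
    have "expectation (\<lambda>\<omega>. \<xi> m \<omega> ^ 4) \<le> expectation (\<lambda>\<omega>. G ^ 4)"
      using cross(1)[of 0 4] power_mono[OF \<xi>_bound[OF m(1)], of _ 4]
      by (intro integral_mono) (auto simp: power_abs)
    then show "expectation (\<lambda>\<omega>. \<xi> m \<omega> ^ 4) \<le> G ^ 4" by (simp add: prob_space)
  qed (use d in auto)
  also have "\<dots> = 3 * G ^ 4 * (\<rho> (Suc m) - \<rho> 0)\<^sup>2"
    by (simp add: eval_nat_numeral algebra_simps)
  finally show ?case .
qed (simp add: S_def)

end

end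

section \<open>Simple processes as functions of time\<close>

lemma simple_process_Suc:
  "simple_process (Suc n) \<tau> \<xi> u \<omega> = simple_process n \<tau> \<xi> u \<omega> + \<xi> n \<omega> * indicator {\<tau> n<..\<tau> (Suc n)} u"
  by (simp add: simple_process_def)

lemma simple_process_after:
  assumes "\<And>i. i < n \<Longrightarrow> \<tau> i \<le> \<tau> (Suc i)" "\<tau> n < u"
  shows "simple_process n \<tau> \<xi> u \<omega> = 0"
proof -
  have "u \<notin> {\<tau> i<..\<tau> (Suc i)}" if "i < n" for i
    using partition_le[of n \<tau> "Suc i" n] assms that by force
  then show ?thesis by (simp add: simple_process_def)
qed

text \<open>The cells are disjoint, so at each time at most one summand is nonzero, and a function
  that fixes 0 may be applied to the coefficients instead. It serves for squaring, for clipping and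
  for the excess over a bound.\<close>

lemma simple_process_comp:
  assumes "g 0 = 0" "\<And>i. i < n \<Longrightarrow> \<tau> i \<le> \<tau> (Suc i)"
  shows "g (simple_process n \<tau> \<xi> u \<omega>) = simple_process n \<tau> (\<lambda>i \<omega>. g (\<xi> i \<omega>)) u \<omega>"
  using assms(2)
proof (induction n)
  case (Suc n)
  show ?case
  proof (cases "u \<in> {\<tau> n<..\<tau> (Suc n)}")
    case True
    then show ?thesis
      using simple_process_after[of n \<tau> u \<xi> \<omega>] simple_process_after[of n \<tau> u "\<lambda>i \<omega>. g (\<xi> i \<omega>)" \<omega>]
        Suc.prems by (simp add: simple_process_Suc)
  next
    case False
    then show ?thesis using Suc by (simp add: simple_process_Suc)
  qed
qed (simp add: simple_process_def assms(1))

text \<open>Clamping the partition points to \<open>[s, t]\<close> turns restriction of the time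
  interval into a change of partition; cells outside the interval become empty and contribute
  nothing.\<close>

lemma nn_integral_simple_process:
  assumes "\<And>i. i < n \<Longrightarrow> \<tau> i \<le> \<tau> (Suc i)" "\<And>i. i < n \<Longrightarrow> 0 \<le> \<zeta> i \<omega>" "s \<le> t"
  shows "(\<integral>\<^sup>+u\<in>{s<..t}. ennreal (simple_process n \<tau> \<zeta> u \<omega>) \<partial>lborel)
    = ennreal (\<Sum>i<n. \<zeta> i \<omega> * (max s (min (\<tau> (Suc i)) t) - max s (min (\<tau> i) t)))"
proof -
  have "(\<integral>\<^sup>+u\<in>{s<..t}. ennreal (simple_process n \<tau> \<zeta> u \<omega>) \<partial>lborel)
    = (\<integral>\<^sup>+u. (\<Sum>i<n. ennreal (\<zeta> i \<omega>) * indicator {max s (min (\<tau> i) t)<..max s (min (\<tau> (Suc i)) t)} u) \<partial>lborel)"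
  proof (intro nn_integral_cong)
    fix u
    have "ennreal (simple_process n \<tau> \<zeta> u \<omega>) * indicator {s<..t} u
      = (\<Sum>i<n. ennreal (\<zeta> i \<omega>) * (indicator {\<tau> i<..\<tau> (Suc i)} u * indicator {s<..t} u))"
    proof -
      have "ennreal (simple_process n \<tau> \<zeta> u \<omega>) = (\<Sum>i<n. ennreal (\<zeta> i \<omega> * indicator {\<tau> i<..\<tau> (Suc i)} u))"
        unfolding simple_process_def using assms(2) by (intro sum_ennreal[symmetric]) auto
      then show ?thesis
        by (simp only: sum_distrib_right) (intro sum.cong refl, simp split: split_indicator)
    qed
    also have "\<dots> = (\<Sum>i<n. ennreal (\<zeta> i \<omega>) * indicator {max s (min (\<tau> i) t)<..max s (min (\<tau> (Suc i)) t)} u)"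
      by (intro sum.cong refl arg_cong2[where f = "(*)"]) (auto simp: indicator_def)
    finally show "ennreal (simple_process n \<tau> \<zeta> u \<omega>) * indicator {s<..t} u = \<dots>" .
  qed
  also have "\<dots> = (\<Sum>i<n. ennreal (\<zeta> i \<omega>) * ennreal (max s (min (\<tau> (Suc i)) t) - max s (min (\<tau> i) t)))"
  proof (subst nn_integral_sum, simp, intro sum.cong refl)
    fix i assume "i \<in> {..<n}"
    then have "max s (min (\<tau> i) t) \<le> max s (min (\<tau> (Suc i)) t)"
      using assms(1)[of i] by auto
    then show "(\<integral>\<^sup>+u. ennreal (\<zeta> i \<omega>) * indicator {max s (min (\<tau> i) t)<..max s (min (\<tau> (Suc i)) t)} u \<partial>lborel)
      = ennreal (\<zeta> i \<omega>) * ennreal (max s (min (\<tau> (Suc i)) t) - max s (min (\<tau> i) t))"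
      by (subst nn_integral_cmult_indicator) simp_all
  qed
  also have "\<dots> = ennreal (\<Sum>i<n. \<zeta> i \<omega> * (max s (min (\<tau> (Suc i)) t) - max s (min (\<tau> i) t)))"
  proof -
    have "max s (min (\<tau> i) t) \<le> max s (min (\<tau> (Suc i)) t)" if "i < n" for i
      using assms(1)[OF that] by auto
    then show ?thesis
      using assms(2)
      by (subst sum_ennreal[symmetric]) (auto simp: ennreal_mult' intro!: mult_nonneg_nonneg sum.cong)
  qed
  finally show ?thesis .
qed

lemma simple_ito_integral_diff:
  "simple_ito_integral W n \<tau> \<xi> t \<omega> - simple_ito_integral W n \<tau> \<zeta> t \<omega>
    = simple_ito_integral W n \<tau> (\<lambda>i \<omega>. \<xi> i \<omega> - \<zeta> i \<omega>) t \<omega>"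
  by (simp add: simple_ito_integral_def sum_subtractf[symmetric] left_diff_distrib)

section \<open>Increments of simple integrals between two fixed times\<close>

context wiener_filtration
begin

context
  fixes n :: nat and \<tau> :: "nat \<Rightarrow> real" and \<xi> :: "nat \<Rightarrow> 'a \<Rightarrow> real" and s t G :: real
    and J V :: "'a \<Rightarrow> real"
  assumes simple: "simple_integrand M F n \<tau> \<xi>"
    and bound: "\<And>i \<omega>. i < n \<Longrightarrow> \<omega> \<in> space M \<Longrightarrow> \<bar>\<xi> i \<omega>\<bar> \<le> G"
    and st: "0 \<le> s" "s \<le> t"
  defines "J \<equiv> \<lambda>\<omega>. simple_ito_integral W n \<tau> \<xi> t \<omega> - simple_ito_integral W n \<tau> \<xi> s \<omega>"
    and "V \<equiv> \<lambda>\<omega>. \<Sum>i<n. (\<xi> i \<omega>)\<^sup>2 * (max s (min (\<tau> (Suc i)) t) - max s (min (\<tau> i) t))"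
begin

lemma simple_step: "i < n \<Longrightarrow> \<tau> i \<le> \<tau> (Suc i)"
  using simple by (auto simp: simple_integrand_def)

lemma simple_nonneg: "i \<le> n \<Longrightarrow> 0 \<le> \<tau> i"
proof (induction i)
  case 0 then show ?case using simple by (simp add: simple_integrand_def)
next
  case (Suc i) then show ?case using simple_step[of i] by simp
qed

lemma clamp_step: "i < n \<Longrightarrow> max s (min (\<tau> i) t) \<le> max s (min (\<tau> (Suc i)) t)"
  using simple_step[of i] by auto

text \<open>
  On a degenerate interval the value of the integrand is irrelevant; setting it to \<open>0\<close> there keeps
  it measurable at the left end point after clamping the partition to \<open>[s, t]\<close>.
\<close>

lemma restricted_integrand:
  defines "\<rho> \<equiv> \<lambda>i. max s (min (\<tau> i) t)"
  defines "\<zeta> \<equiv> \<lambda>i \<omega>. if \<rho> i < \<rho> (Suc i) then \<xi> i \<omega> else 0"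
  shows "\<And>i. i < n \<Longrightarrow> \<zeta> i \<in> borel_measurable (F (\<rho> i))"
    and "\<And>i \<omega>. i < n \<Longrightarrow> \<omega> \<in> space M \<Longrightarrow> \<bar>\<zeta> i \<omega>\<bar> \<le> G"
    and "J = (\<lambda>\<omega>. \<Sum>i<n. \<zeta> i \<omega> * (W (\<rho> (Suc i)) \<omega> - W (\<rho> i) \<omega>))"
    and "V = (\<lambda>\<omega>. \<Sum>i<n. (\<zeta> i \<omega>)\<^sup>2 * (\<rho> (Suc i) - \<rho> i))"
proof -
  fix i assume i: "i < n"
  show "\<zeta> i \<in> borel_measurable (F (\<rho> i))"
  proof (cases "\<rho> i < \<rho> (Suc i)")
    case True
    then have "\<tau> i \<le> \<rho> i" using st by (auto simp: \<rho>_def)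
    then have "\<xi> i \<in> borel_measurable (F (\<rho> i))"
      using simple i simple_nonneg[of i] measurable_F_mono[of "\<tau> i" "\<rho> i"]
      by (auto simp: simple_integrand_def)
    then show ?thesis using True by (simp add: \<zeta>_def[abs_def])
  qed (simp add: \<zeta>_def[abs_def])
  fix \<omega> assume "\<omega> \<in> space M"
  then show "\<bar>\<zeta> i \<omega>\<bar> \<le> G"
    using bound[OF i, of \<omega>] by (auto simp: \<zeta>_def)
next
  have \<rho>_step: "\<rho> i \<le> \<rho> (Suc i)" if "i < n" for i
    using clamp_step[OF that] by (simp add: \<rho>_def)
  \<comment> \<open>The term \<open>W s\<close> does not depend on \<open>i\<close>, so it cancels
    when consecutive values are subtracted; this leaves exactly the increment over the clamped
    cell.\<close>
  have W: "W (min (\<tau> i) t) \<omega> - W (min (\<tau> i) s) \<omega> = W (\<rho> i) \<omega> - W s \<omega>" for i \<omega>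
    using st by (cases "\<tau> i \<le> s") (auto simp: min_def max_def \<rho>_def)
  show "J = (\<lambda>\<omega>. \<Sum>i<n. \<zeta> i \<omega> * (W (\<rho> (Suc i)) \<omega> - W (\<rho> i) \<omega>))"
  proof
    fix \<omega>
    have "J \<omega> = (\<Sum>i<n. \<xi> i \<omega> * ((W (min (\<tau> (Suc i)) t) \<omega> - W (min (\<tau> (Suc i)) s) \<omega>)
        - (W (min (\<tau> i) t) \<omega> - W (min (\<tau> i) s) \<omega>)))"
      unfolding J_def simple_ito_integral_def sum_subtractf[symmetric]
      by (intro sum.cong) (auto simp: algebra_simps)
    also have "\<dots> = (\<Sum>i<n. \<zeta> i \<omega> * (W (\<rho> (Suc i)) \<omega> - W (\<rho> i) \<omega>))"
    proof (intro sum.cong refl)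
      fix i assume "i \<in> {..<n}"
      then show "\<xi> i \<omega> * (W (min (\<tau> (Suc i)) t) \<omega> - W (min (\<tau> (Suc i)) s) \<omega>
          - (W (min (\<tau> i) t) \<omega> - W (min (\<tau> i) s) \<omega>)) = \<zeta> i \<omega> * (W (\<rho> (Suc i)) \<omega> - W (\<rho> i) \<omega>)"
        unfolding W
        using \<rho>_step[of i] by (cases "\<rho> i = \<rho> (Suc i)") (auto simp: \<zeta>_def)
    qed
    finally show "J \<omega> = (\<Sum>i<n. \<zeta> i \<omega> * (W (\<rho> (Suc i)) \<omega> - W (\<rho> i) \<omega>))" .
  qed
  have V_\<rho>: "V = (\<lambda>\<omega>. \<Sum>i<n. (\<xi> i \<omega>)\<^sup>2 * (\<rho> (Suc i) - \<rho> i))"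
    by (simp add: V_def \<rho>_def)
  show "V = (\<lambda>\<omega>. \<Sum>i<n. (\<zeta> i \<omega>)\<^sup>2 * (\<rho> (Suc i) - \<rho> i))"
    unfolding V_\<rho>
  proof (intro ext sum.cong refl)
    fix i \<omega> assume "i \<in> {..<n}"
    then show "(\<xi> i \<omega>)\<^sup>2 * (\<rho> (Suc i) - \<rho> i) = (\<zeta> i \<omega>)\<^sup>2 * (\<rho> (Suc i) - \<rho> i)"
      using \<rho>_step[of i] by (cases "\<rho> i = \<rho> (Suc i)") (auto simp: \<zeta>_def)
  qed
qed

lemma clamp_length: "max s (min (\<tau> n) t) - max s (min (\<tau> 0) t) \<le> t - s"
  using st by auto

lemma clamp_length_nonneg: "0 \<le> max s (min (\<tau> n) t) - max s (min (\<tau> 0) t)"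
  using partition_le[of n "\<lambda>i. max s (min (\<tau> i) t)" 0 n] clamp_step by auto

text \<open>\<open>J\<close> is the full partial sum over the clamped partition, which starts at or
  after \<open>s\<close> and has total length at most \<open>t - s\<close>; the moment estimates for
  partial sums therefore apply.\<close>

lemma simple_increment:
  shows "J \<in> borel_measurable M"
    and "integrable M (\<lambda>\<omega>. J \<omega> ^ 4)"
    and "expectation (\<lambda>\<omega>. J \<omega> ^ 4) \<le> 3 * G ^ 4 * (t - s)\<^sup>2"
    and "Y \<in> borel_measurable (F s) \<Longrightarrow> (\<And>\<omega>. \<omega> \<in> space M \<Longrightarrow> \<bar>Y \<omega>\<bar> \<le> B) \<Longrightarrow> expectation (\<lambda>\<omega>. Y \<omega> * J \<omega>) = 0"
    and "Y \<in> borel_measurable (F s) \<Longrightarrow> (\<And>\<omega>. \<omega> \<in> space M \<Longrightarrow> \<bar>Y \<omega>\<bar> \<le> B) \<Longrightarrow>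
      expectation (\<lambda>\<omega>. Y \<omega> * (J \<omega>)\<^sup>2) = expectation (\<lambda>\<omega>. Y \<omega> * V \<omega>)"
proof -
  define \<rho> where "\<rho> i = max s (min (\<tau> i) t)" for i
  define \<zeta> where "\<zeta> i \<omega> = (if \<rho> i < \<rho> (Suc i) then \<xi> i \<omega> else 0)" for i \<omega>
  note R = restricted_integrand[folded \<rho>_def, folded \<zeta>_def]
  have prems: "0 \<le> s" "s \<le> \<rho> 0" "\<And>i. i < n \<Longrightarrow> \<rho> i \<le> \<rho> (Suc i)"
    using st clamp_step by (auto simp: \<rho>_def)
  note prems = prems R(1,2)
  show "J \<in> borel_measurable M"
    unfolding R(3) by (rule simple_sum_measurable_M[where n = n and \<rho> = \<rho> and \<xi> = \<zeta>, OF prems]) auto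
  show "integrable M (\<lambda>\<omega>. J \<omega> ^ 4)"
    unfolding R(3) by (rule integrable_simple_sum_4[where n = n and \<rho> = \<rho> and \<xi> = \<zeta>, OF prems]) auto
  have "expectation (\<lambda>\<omega>. J \<omega> ^ 4) \<le> 3 * G ^ 4 * (\<rho> n - \<rho> 0)\<^sup>2"
    unfolding R(3) by (rule expectation_simple_sum_4_le[where n = n and \<rho> = \<rho> and \<xi> = \<zeta>, OF prems]) auto
  also have "\<dots> \<le> 3 * G ^ 4 * (t - s)\<^sup>2"
    using clamp_length clamp_length_nonneg
    by (intro mult_left_mono power_mono) (auto simp: \<rho>_def)
  finally show "expectation (\<lambda>\<omega>. J \<omega> ^ 4) \<le> 3 * G ^ 4 * (t - s)\<^sup>2" .
  assume Y: "Y \<in> borel_measurable (F s)" "\<And>\<omega>. \<omega> \<in> space M \<Longrightarrow> \<bar>Y \<omega>\<bar> \<le> B"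
  show "expectation (\<lambda>\<omega>. Y \<omega> * J \<omega>) = 0"
    unfolding R(3)
    by (rule expectation_simple_sum[where n = n and \<rho> = \<rho> and \<xi> = \<zeta>, OF prems Y]) auto
  show "expectation (\<lambda>\<omega>. Y \<omega> * (J \<omega>)\<^sup>2) = expectation (\<lambda>\<omega>. Y \<omega> * V \<omega>)"
    unfolding R(3,4)
    by (rule expectation_simple_sum_square[where n = n and \<rho> = \<rho> and \<xi> = \<zeta>, OF prems Y]) auto
qed

text \<open>The last identity links the isometry, which speaks of the sum \<open>V\<close>, to the
  time integrals by which \<open>ito_integral\<close> measures the quality of an
  approximation.\<close>

lemma simple_quadratic_variation:
  shows "V \<in> borel_measurable M"
    and "0 \<le> V \<omega>"
    and "\<omega> \<in> space M \<Longrightarrow> V \<omega> \<le> G\<^sup>2 * (t - s)"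
    and "ennreal (V \<omega>) = (\<integral>\<^sup>+u\<in>{s<..t}. ennreal ((simple_process n \<tau> \<xi> u \<omega>)\<^sup>2) \<partial>lborel)"
proof -
  have "\<xi> i \<in> borel_measurable M" if "i < n" for i
    using simple that measurable_F_M simple_nonneg[of i] by (auto simp: simple_integrand_def)
  then show "V \<in> borel_measurable M"
    unfolding V_def by (intro borel_measurable_sum borel_measurable_times borel_measurable_power) auto
  show "0 \<le> V \<omega>"
    unfolding V_def using clamp_step by (intro sum_nonneg mult_nonneg_nonneg) auto
  show "V \<omega> \<le> G\<^sup>2 * (t - s)" if "\<omega> \<in> space M"
  proof -
    have "V \<omega> \<le> (\<Sum>i<n. G\<^sup>2 * (max s (min (\<tau> (Suc i)) t) - max s (min (\<tau> i) t)))"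
      unfolding V_def
    proof (intro sum_mono mult_right_mono)
      fix i assume "i \<in> {..<n}"
      then show "(\<xi> i \<omega>)\<^sup>2 \<le> G\<^sup>2"
        using power_mono[OF bound[OF _ that], of i 2] by simp
    qed (use clamp_step in simp)
    also have "\<dots> = G\<^sup>2 * (max s (min (\<tau> n) t) - max s (min (\<tau> 0) t))"
      using sum_lessThan_telescope[of "\<lambda>i. max s (min (\<tau> i) t)" n] by (simp add: sum_distrib_left[symmetric])
    also have "\<dots> \<le> G\<^sup>2 * (t - s)"
      using clamp_length by (intro mult_left_mono) auto
    finally show ?thesis .
  qed
  show "ennreal (V \<omega>) = (\<integral>\<^sup>+u\<in>{s<..t}. ennreal ((simple_process n \<tau> \<xi> u \<omega>)\<^sup>2) \<partial>lborel)"
    using nn_integral_simple_process[of n \<tau> "\<lambda>i \<omega>. (\<xi> i \<omega>)\<^sup>2" \<omega> s t] simple_step st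
      simple_process_comp[of "\<lambda>x. x\<^sup>2" n \<tau> \<xi>]
    by (simp add: V_def)
qed

end

lemma simple_integrand_uniform_bound:
  assumes "simple_integrand M F n \<tau> \<xi>"
  obtains G where "\<And>i \<omega>. i < n \<Longrightarrow> \<omega> \<in> space M \<Longrightarrow> \<bar>\<xi> i \<omega>\<bar> \<le> G"
proof -
  obtain K where K: "\<And>i \<omega>. i < n \<Longrightarrow> \<omega> \<in> space M \<Longrightarrow> \<bar>\<xi> i \<omega>\<bar> \<le> K i"
    using assms unfolding simple_integrand_def by metis
  have "\<bar>\<xi> i \<omega>\<bar> \<le> (\<Sum>j<n. \<bar>K j\<bar>)" if "i < n" "\<omega> \<in> space M" for i \<omega>
    using K[OF that] member_le_sum[of i "{..<n}" "\<lambda>j. \<bar>K j\<bar>"] that by auto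
  then show ?thesis using that by blast
qed

text \<open>
  Lenglart's inequality: killing the integrand as soon as its quadratic variation would exceed
  \<open>\<eta>\<close> changes nothing where the total quadratic variation stays below \<open>\<eta>\<close>.
\<close>

lemma simple_ito_integral_tail:
  assumes simple: "simple_integrand M F n \<tau> \<xi>" and t: "0 \<le> t" and pos: "0 < \<eta>" "0 < \<delta>"
  defines "V \<equiv> \<lambda>\<omega>. \<Sum>i<n. (\<xi> i \<omega>)\<^sup>2 * (max 0 (min (\<tau> (Suc i)) t) - max 0 (min (\<tau> i) t))"
  shows "prob {\<omega> \<in> space M. \<delta> < \<bar>simple_ito_integral W n \<tau> \<xi> t \<omega>\<bar>}
    \<le> \<eta> / \<delta>\<^sup>2 + prob {\<omega> \<in> space M. \<eta> < V \<omega>}"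
proof -
  obtain G where G: "\<And>i \<omega>. i < n \<Longrightarrow> \<omega> \<in> space M \<Longrightarrow> \<bar>\<xi> i \<omega>\<bar> \<le> G"
    using simple_integrand_uniform_bound[OF simple] by blast
  define d where "d i = max 0 (min (\<tau> (Suc i)) t) - max 0 (min (\<tau> i) t)" for i
  define P where "P m \<omega> = (\<Sum>i<m. (\<xi> i \<omega>)\<^sup>2 * d i)" for m \<omega>
  \<comment> \<open>The test uses \<open>P (Suc i)\<close>, which already includes the contribution
    of cell \<open>i\<close>. It is nevertheless known at the left end point
    \<open>\<tau> i\<close>, and it prevents any overshoot of \<open>\<eta>\<close>.\<close>
  define \<zeta> where "\<zeta> i \<omega> = (if P (Suc i) \<omega> \<le> \<eta> then \<xi> i \<omega> else 0)" for i \<omega>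
  note simple_nonneg = simple_nonneg[OF simple G order.refl t]
    and simple_step = simple_step[OF simple G order.refl t]
  have d: "0 \<le> d i" if "i < n" for i
    using simple_step[OF _ _ that] by (auto simp: d_def)
  have \<xi>_meas: "\<xi> j \<in> borel_measurable (F (\<tau> i))" if "j \<le> i" "i < n" for i j
  proof -
    have "\<tau> j \<le> \<tau> i"
      using partition_le[of n \<tau> j i] simple_step that by auto
    moreover have "\<xi> j \<in> borel_measurable (F (\<tau> j))" "j < n"
      using simple that by (auto simp: simple_integrand_def)
    ultimately show ?thesis
      using simple_nonneg[of j] measurable_F_mono by simp
  qed
  have \<zeta>_simple: "simple_integrand M F n \<tau> \<zeta>"
    unfolding simple_integrand_def
  proof (intro conjI allI impI)
    fix i assume i: "i < n"
    have "P (Suc i) \<in> borel_measurable (F (\<tau> i))"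
      unfolding P_def[abs_def] using \<xi>_meas i
      by (intro borel_measurable_sum borel_measurable_times borel_measurable_power) auto
    then show "\<zeta> i \<in> borel_measurable (F (\<tau> i))"
      unfolding \<zeta>_def[abs_def] using \<xi>_meas[OF order.refl i] by measurable
    show "\<exists>K. \<forall>\<omega>\<in>space M. \<bar>\<zeta> i \<omega>\<bar> \<le> K"
      using G[OF i] by (intro exI[of _ "\<bar>G\<bar>"]) (force simp: \<zeta>_def)
  qed (use simple in \<open>auto simp: simple_integrand_def\<close>)
  have \<zeta>_bound: "\<bar>\<zeta> i \<omega>\<bar> \<le> \<bar>G\<bar>" if "i < n" "\<omega> \<in> space M" for i \<omega>
    using G[OF that] by (auto simp: \<zeta>_def)
  let ?J = "\<lambda>\<omega>. simple_ito_integral W n \<tau> \<zeta> t \<omega>"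
  have at_0: "simple_ito_integral W n \<tau> \<zeta> 0 \<omega> = 0" for \<omega>
    using simple_nonneg by (simp add: simple_ito_integral_def min_absorb2)
  have J_meas: "?J \<in> borel_measurable M"
    and J_4: "integrable M (\<lambda>\<omega>. ?J \<omega> ^ 4)"
    and J_2: "expectation (\<lambda>\<omega>. (?J \<omega>)\<^sup>2) = expectation (\<lambda>\<omega>. \<Sum>i<n. (\<zeta> i \<omega>)\<^sup>2 * d i)"
    using simple_increment(1,2)[OF \<zeta>_simple \<zeta>_bound order.refl t]
      simple_increment(5)[OF \<zeta>_simple \<zeta>_bound order.refl t, of "\<lambda>_. 1" 1]
    by (simp_all add: at_0 d_def)
  \<comment> \<open>The second conjunct carries the induction: if cell \<open>m\<close> is kept, the
    new sum is at most \<open>P (Suc m) \<omega>\<close>, which is then at most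
    \<open>\<eta>\<close>; otherwise the sum does not change.\<close>
  have le: "(\<Sum>i<m. (\<zeta> i \<omega>)\<^sup>2 * d i) \<le> \<eta> \<and> (\<Sum>i<m. (\<zeta> i \<omega>)\<^sup>2 * d i) \<le> P m \<omega>" if "m \<le> n" for m \<omega>
    using that
  proof (induction m)
    case 0
    then show ?case using pos by (simp add: P_def)
  next
    case (Suc m)
    then show ?case
      using d[of m] by (auto simp: \<zeta>_def P_def)
  qed
  have V: "V = P n" by (auto simp: V_def P_def d_def)
  have J_eq: "simple_ito_integral W n \<tau> \<xi> t \<omega> = ?J \<omega>" if "V \<omega> \<le> \<eta>" for \<omega>
  proof -
    have "P (Suc i) \<omega> \<le> \<eta>" if "i < n" for i
    proof -
      have "P (Suc i) \<omega> \<le> P n \<omega>"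
        unfolding P_def using that d by (intro sum_mono2) auto
      then show ?thesis using \<open>V \<omega> \<le> \<eta>\<close> V by simp
    qed
    then show ?thesis by (simp add: simple_ito_integral_def \<zeta>_def)
  qed
  have meas: "simple_ito_integral W n \<tau> \<xi> t \<in> borel_measurable M"
  proof -
    have "\<xi> i \<in> borel_measurable M" if "i < n" for i
      using \<xi>_meas[OF order.refl that] measurable_F_M simple_nonneg[of i] that by auto
    then show ?thesis
      unfolding simple_ito_integral_def[abs_def]
      using simple_nonneg t
      by (intro borel_measurable_sum borel_measurable_times borel_measurable_diff measurable_W_M) auto
  qed
  have V_meas: "V \<in> borel_measurable M"
    unfolding V_def by (rule simple_quadratic_variation(1)[OF simple G order.refl t])
  have int2: "integrable M (\<lambda>\<omega>. (?J \<omega>)\<^sup>2)"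
    using integrable_power_4[OF J_meas J_4, of 2] by simp
  have \<zeta>_V: "(\<lambda>\<omega>. \<Sum>i<n. (\<zeta> i \<omega>)\<^sup>2 * d i) \<in> borel_measurable M"
    using simple_quadratic_variation(1)[OF \<zeta>_simple \<zeta>_bound order.refl t] by (simp add: d_def)
  have "expectation (\<lambda>\<omega>. (?J \<omega>)\<^sup>2) \<le> \<eta>"
    unfolding J_2
  proof (rule integral_le_const)
    show "integrable M (\<lambda>\<omega>. \<Sum>i<n. (\<zeta> i \<omega>)\<^sup>2 * d i)"
    proof (rule integrable_const_bound[OF _ \<zeta>_V])
      have "0 \<le> (\<Sum>i<n. (\<zeta> i \<omega>)\<^sup>2 * d i)" for \<omega>
        using d by (intro sum_nonneg mult_nonneg_nonneg) auto
      then show "AE \<omega> in M. norm (\<Sum>i<n. (\<zeta> i \<omega>)\<^sup>2 * d i) \<le> \<eta>"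
        using le by (intro AE_I2) (auto simp: abs_of_nonneg)
    qed
  qed (use le in auto)
  then have "expectation (\<lambda>\<omega>. (?J \<omega>)\<^sup>2) / \<delta>\<^sup>2 \<le> \<eta> / \<delta>\<^sup>2"
    by (intro divide_right_mono) auto
  moreover have "prob {\<omega> \<in> space M. \<delta>\<^sup>2 \<le> (?J \<omega>)\<^sup>2} \<le> expectation (\<lambda>\<omega>. (?J \<omega>)\<^sup>2) / \<delta>\<^sup>2"
    using integral_Markov_inequality_measure[OF int2, of "space M" "\<delta>\<^sup>2"] pos by simp
  moreover have "prob {\<omega> \<in> space M. \<delta> < \<bar>simple_ito_integral W n \<tau> \<xi> t \<omega>\<bar>}
    \<le> prob ({\<omega> \<in> space M. \<delta>\<^sup>2 \<le> (?J \<omega>)\<^sup>2} \<union> {\<omega> \<in> space M. \<eta> < V \<omega>})"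
  proof (intro finite_measure_mono subsetI)
    fix \<omega> assume "\<omega> \<in> {\<omega> \<in> space M. \<delta> < \<bar>simple_ito_integral W n \<tau> \<xi> t \<omega>\<bar>}"
    then show "\<omega> \<in> {\<omega> \<in> space M. \<delta>\<^sup>2 \<le> (?J \<omega>)\<^sup>2} \<union> {\<omega> \<in> space M. \<eta> < V \<omega>}"
      using J_eq[of \<omega>] pos power_mono[of \<delta> "\<bar>?J \<omega>\<bar>" 2] by (cases "V \<omega> \<le> \<eta>") auto
  qed (use J_meas V_meas in measurable)
  moreover have "\<dots> \<le> prob {\<omega> \<in> space M. \<delta>\<^sup>2 \<le> (?J \<omega>)\<^sup>2} + prob {\<omega> \<in> space M. \<eta> < V \<omega>}"
    by (rule measure_Un_le) (use J_meas in measurable, use V_meas in measurable)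
  ultimately show ?thesis by linarith
qed

end

section \<open>Increments of stochastic integrals with bounded integrands\<close>

context prob_space
begin

text \<open>The signed counterpart of \<open>null_in_prob\<close>, so that limits can be added and
  subtracted.\<close>

definition vanishes_in_prob :: "(nat \<Rightarrow> 'a \<Rightarrow> real) \<Rightarrow> bool" where
  "vanishes_in_prob Z \<longleftrightarrow> (\<forall>k. Z k \<in> borel_measurable M) \<and>
    (\<forall>\<epsilon>>0. (\<lambda>k. prob {\<omega> \<in> space M. \<epsilon> < \<bar>Z k \<omega>\<bar>}) \<longlonglongrightarrow> 0)"

lemma vanishes_in_prob_add:
  assumes "vanishes_in_prob Y" "vanishes_in_prob Z"
  shows "vanishes_in_prob (\<lambda>k \<omega>. Y k \<omega> + Z k \<omega>)"
  unfolding vanishes_in_prob_def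
proof (intro conjI allI impI)
  fix k show "(\<lambda>\<omega>. Y k \<omega> + Z k \<omega>) \<in> borel_measurable M"
    using assms unfolding vanishes_in_prob_def by (intro borel_measurable_add) auto
next
  fix \<epsilon> :: real assume "0 < \<epsilon>"
  then have lim: "(\<lambda>k. prob {\<omega> \<in> space M. \<epsilon> / 2 < \<bar>Y k \<omega>\<bar>} + prob {\<omega> \<in> space M. \<epsilon> / 2 < \<bar>Z k \<omega>\<bar>}) \<longlonglongrightarrow> 0 + 0"
    using assms half_gt_zero unfolding vanishes_in_prob_def by (intro tendsto_add) blast+
  have le: "prob {\<omega> \<in> space M. \<epsilon> < \<bar>Y k \<omega> + Z k \<omega>\<bar>}
    \<le> prob {\<omega> \<in> space M. \<epsilon> / 2 < \<bar>Y k \<omega>\<bar>} + prob {\<omega> \<in> space M. \<epsilon> / 2 < \<bar>Z k \<omega>\<bar>}" for k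
  proof -
    have Y: "Y k \<in> borel_measurable M" and Z: "Z k \<in> borel_measurable M"
      using assms by (auto simp: vanishes_in_prob_def)
    have events: "{\<omega> \<in> space M. \<epsilon> / 2 < \<bar>Y k \<omega>\<bar>} \<in> events" "{\<omega> \<in> space M. \<epsilon> / 2 < \<bar>Z k \<omega>\<bar>} \<in> events"
      using Y by measurable (use Z in measurable)
    have "prob {\<omega> \<in> space M. \<epsilon> < \<bar>Y k \<omega> + Z k \<omega>\<bar>}
      \<le> prob ({\<omega> \<in> space M. \<epsilon> / 2 < \<bar>Y k \<omega>\<bar>} \<union> {\<omega> \<in> space M. \<epsilon> / 2 < \<bar>Z k \<omega>\<bar>})"
      using events by (intro finite_measure_mono) auto
    also have "\<dots> \<le> prob {\<omega> \<in> space M. \<epsilon> / 2 < \<bar>Y k \<omega>\<bar>} + prob {\<omega> \<in> space M. \<epsilon> / 2 < \<bar>Z k \<omega>\<bar>}"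
      using events by (rule measure_Un_le)
    finally show ?thesis .
  qed
  show "(\<lambda>k. prob {\<omega> \<in> space M. \<epsilon> < \<bar>Y k \<omega> + Z k \<omega>\<bar>}) \<longlonglongrightarrow> 0"
    by (rule tendsto_sandwich[of "\<lambda>_. 0"]) (use le lim in auto)
qed

lemma vanishes_in_prob_minus: "vanishes_in_prob Z \<Longrightarrow> vanishes_in_prob (\<lambda>k \<omega>. - Z k \<omega>)"
  unfolding vanishes_in_prob_def by auto

text \<open>Borel-Cantelli along a subsequence on which the exceptional probabilities are dominated
  by a geometric series.\<close>

lemma vanishes_in_prob_AE_subseq:
  assumes "vanishes_in_prob Z"
  obtains r :: "nat \<Rightarrow> nat" where "strict_mono r" "AE \<omega> in M. (\<lambda>k. Z (r k) \<omega>) \<longlonglongrightarrow> 0"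
proof -
  have "\<exists>N. \<forall>k\<ge>N. prob {\<omega> \<in> space M. (1/2) ^ n < \<bar>Z k \<omega>\<bar>} < (1/2) ^ n" for n
  proof -
    have "(\<lambda>k. prob {\<omega> \<in> space M. (1/2) ^ n < \<bar>Z k \<omega>\<bar>}) \<longlonglongrightarrow> 0"
      using assms by (simp add: vanishes_in_prob_def)
    from order_tendstoD(2)[OF this, of "(1/2) ^ n"] show ?thesis
      by (simp add: eventually_sequentially)
  qed
  then obtain N where N: "\<And>n k. N n \<le> k \<Longrightarrow> prob {\<omega> \<in> space M. (1/2) ^ n < \<bar>Z k \<omega>\<bar>} < (1/2) ^ n"
    by metis
  \<comment> \<open>Summing all earlier thresholds makes \<open>r\<close> strictly increasing and at
    least \<open>N n\<close> without a recursive choice.\<close>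
  define r where "r n = n + (\<Sum>i\<le>n. N i)" for n
  have r: "strict_mono r" unfolding strict_mono_Suc_iff r_def by simp
  have "N n \<le> r n" for n
    using member_le_sum[of n "{..n}" N] by (simp add: r_def)
  then have r_le: "prob {\<omega> \<in> space M. (1/2) ^ n < \<bar>Z (r n) \<omega>\<bar>} \<le> (1/2) ^ n" for n
    using N less_imp_le by blast
  have Z: "Z k \<in> borel_measurable M" for k
    using assms by (simp add: vanishes_in_prob_def)
  have "AE \<omega> in M. eventually (\<lambda>n. \<omega> \<in> space M - {\<omega> \<in> space M. (1/2) ^ n < \<bar>Z (r n) \<omega>\<bar>}) sequentially"
  proof (rule borel_cantelli_AE1)
    show "{\<omega> \<in> space M. (1/2) ^ n < \<bar>Z (r n) \<omega>\<bar>} \<in> events" for n using Z by measurable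
    show "summable (\<lambda>n. prob {\<omega> \<in> space M. (1/2) ^ n < \<bar>Z (r n) \<omega>\<bar>})"
      by (rule summable_comparison_test'[where g = "\<lambda>n. (1/2) ^ n" and N = 0])
        (use r_le in \<open>auto intro!: summable_geometric\<close>)
  qed (simp add: emeasure_eq_measure)
  then have "AE \<omega> in M. (\<lambda>k. Z (r k) \<omega>) \<longlonglongrightarrow> 0"
  proof eventually_elim
    case (elim \<omega>)
    then have "eventually (\<lambda>n. norm (Z (r n) \<omega>) \<le> (1/2) ^ n) sequentially"
      by eventually_elim auto
    then show ?case by (rule Lim_null_comparison) (simp add: LIMSEQ_realpow_zero)
  qed
  then show ?thesis using r that by blast
qed

lemma integral_fatou:
  fixes f :: "nat \<Rightarrow> 'a \<Rightarrow> real"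
  assumes f: "\<And>k. integrable M (f k)" "\<And>k \<omega>. 0 \<le> f k \<omega>" and g: "g \<in> borel_measurable M"
    and lim: "AE \<omega> in M. (\<lambda>k. f k \<omega>) \<longlonglongrightarrow> g \<omega>"
    and le: "\<And>k. expectation (f k) \<le> c k" and c: "c \<longlonglongrightarrow> c0"
  shows "integrable M g" "expectation g \<le> c0"
proof -
  have c0: "0 \<le> c0"
    using le Bochner_Integration.integral_nonneg[of M "f _"] f(2)
    by (intro LIMSEQ_le_const[OF c]) (meson order_trans)
  have g0: "AE \<omega> in M. 0 \<le> g \<omega>"
    using lim by eventually_elim (use f(2) in \<open>auto intro!: LIMSEQ_le_const\<close>)
  have "(\<integral>\<^sup>+\<omega>. ennreal (g \<omega>) \<partial>M) = (\<integral>\<^sup>+\<omega>. liminf (\<lambda>k. ennreal (f k \<omega>)) \<partial>M)"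
    using lim by (intro nn_integral_cong_AE) (auto elim!: eventually_mono intro!: lim_imp_Liminf[symmetric] tendsto_ennrealI)
  also have "\<dots> \<le> liminf (\<lambda>k. \<integral>\<^sup>+\<omega>. ennreal (f k \<omega>) \<partial>M)"
    using f(1) by (intro nn_integral_liminf) auto
  also have "\<dots> \<le> liminf (\<lambda>k. ennreal (c k))"
    using f le by (intro Liminf_mono always_eventually allI) (simp add: nn_integral_eq_integral ennreal_leI)
  also have "\<dots> = ennreal c0"
    using c by (intro lim_imp_Liminf tendsto_ennrealI) auto
  finally have *: "(\<integral>\<^sup>+\<omega>. ennreal (g \<omega>) \<partial>M) \<le> ennreal c0" .
  then show int: "integrable M g"
    using g g0 by (intro integrableI_nonneg) (auto simp: le_less_trans)
  show "expectation g \<le> c0"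
    using * c0 by (simp add: nn_integral_eq_integral[OF int g0])
qed

text \<open>Bounded second moments give uniform integrability, which upgrades convergence in
  probability to convergence in mean.\<close>

lemma vanishes_in_prob_expectation:
  assumes Z: "vanishes_in_prob Z" and int: "\<And>k. integrable M (\<lambda>\<omega>. (Z k \<omega>)\<^sup>2)"
    and le: "\<And>k. expectation (\<lambda>\<omega>. (Z k \<omega>)\<^sup>2) \<le> c"
  shows "(\<lambda>k. expectation (\<lambda>\<omega>. \<bar>Z k \<omega>\<bar>)) \<longlonglongrightarrow> 0"
proof (rule order_tendstoI)
  fix e :: real assume e: "e < 0"
  then show "eventually (\<lambda>k. e < expectation (\<lambda>\<omega>. \<bar>Z k \<omega>\<bar>)) sequentially"
    by (intro always_eventually allI less_le_trans[OF e] Bochner_Integration.integral_nonneg) auto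
next
  fix e :: real assume e: "0 < e"
  define q where "q = e / 4"
  \<comment> \<open>Values of \<open>\<bar>Z k\<bar>\<close> up to \<open>q\<close>, between
    \<open>q\<close> and \<open>R\<close>, and from \<open>R\<close> on contribute at most
    \<open>q\<close> each: the last by \<open>\<bar>z\<bar> \<le> z\<^sup>2 / R\<close> and the
    choice of \<open>R\<close>, the middle one because its event has probability below
    \<open>q / R\<close>. The fourth \<open>q\<close> makes the final inequality strict.\<close>
  have q: "0 < q" "e = 4 * q" using e by (auto simp: q_def)
  define R where "R = (\<bar>c\<bar> + 1) / q"
  have "c * q \<le> (\<bar>c\<bar> + 1) * q" using q by (intro mult_right_mono) auto
  then have R: "0 < R" "c / R \<le> q" using q by (auto simp: R_def field_simps)
  have meas: "Z k \<in> borel_measurable M" for k using Z by (simp add: vanishes_in_prob_def)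
  have "(\<lambda>k. prob {\<omega> \<in> space M. q < \<bar>Z k \<omega>\<bar>}) \<longlonglongrightarrow> 0"
    using Z q by (simp add: vanishes_in_prob_def)
  from order_tendstoD(2)[OF this, of "q / R"]
  have "eventually (\<lambda>k. prob {\<omega> \<in> space M. q < \<bar>Z k \<omega>\<bar>} < q / R) sequentially"
    using q R by simp
  then show "eventually (\<lambda>k. expectation (\<lambda>\<omega>. \<bar>Z k \<omega>\<bar>) < e) sequentially"
  proof eventually_elim
    case (elim k)
    let ?E = "{\<omega> \<in> space M. q < \<bar>Z k \<omega>\<bar>}"
    have E: "?E \<in> events" using meas by measurable
    then have ind: "integrable M (indicator ?E :: 'a \<Rightarrow> real)"
      by (intro integrable_real_indicator) (auto simp: emeasure_eq_measure)
    have "expectation (\<lambda>\<omega>. \<bar>Z k \<omega>\<bar>) \<le> expectation (\<lambda>\<omega>. q + (Z k \<omega>)\<^sup>2 / R + R * indicator ?E \<omega>)"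
    proof (rule integral_mono')
      show "integrable M (\<lambda>\<omega>. q + (Z k \<omega>)\<^sup>2 / R + R * indicator ?E \<omega>)"
        using int ind by (intro Bochner_Integration.integrable_add integrable_const integrable_divide integrable_mult_right)
      fix \<omega> assume \<omega>: "\<omega> \<in> space M"
      show "\<bar>Z k \<omega>\<bar> \<le> q + (Z k \<omega>)\<^sup>2 / R + R * indicator ?E \<omega>"
      proof (cases "R \<le> \<bar>Z k \<omega>\<bar>")
        case True
        then have "\<bar>Z k \<omega>\<bar> * R \<le> (Z k \<omega>)\<^sup>2"
          using mult_left_mono[OF True, of "\<bar>Z k \<omega>\<bar>"] by (simp add: power2_eq_square)
        then have "\<bar>Z k \<omega>\<bar> \<le> (Z k \<omega>)\<^sup>2 / R" using R by (simp add: pos_le_divide_eq)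
        then show ?thesis using q R by (simp add: indicator_def)
      next
        case False
        moreover have "0 \<le> (Z k \<omega>)\<^sup>2 / R" using R by simp
        moreover have "R \<le> R * indicator ?E \<omega>" if "q < \<bar>Z k \<omega>\<bar>"
          using that \<omega> by simp
        moreover have "0 \<le> R * indicator ?E \<omega>" using R by simp
        ultimately show ?thesis
          using q R by linarith
      qed
      then show "0 \<le> q + (Z k \<omega>)\<^sup>2 / R + R * indicator ?E \<omega>" by linarith
    qed
    also have "\<dots> = q + expectation (\<lambda>\<omega>. (Z k \<omega>)\<^sup>2) / R + R * prob ?E"
      using int ind E by (simp add: prob_space)
    also have "\<dots> < q + q + q"
    proof -
      have "expectation (\<lambda>\<omega>. (Z k \<omega>)\<^sup>2) / R \<le> c / R" using le R by (simp add: divide_right_mono)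
      moreover have "R * prob ?E < q" using elim R by (simp add: field_simps)
      ultimately show ?thesis using R by linarith
    qed
    finally show ?case using q by linarith
  qed
qed

end

text \<open>Factor the difference of squares and apply the inequality of arithmetic and geometric
  means with weight \<open>\<eta>\<close>. Once the mean square distance is at most
  \<open>\<eta>\<^sup>2\<close>, both error terms are of order \<open>\<eta>\<close>.\<close>

lemma square_le_perturbed:
  fixes x y :: real
  assumes "\<bar>x\<bar> \<le> G" "\<bar>y\<bar> \<le> G" "0 < \<eta>"
  shows "x\<^sup>2 \<le> y\<^sup>2 + G * \<eta> + G / \<eta> * (x - y)\<^sup>2"
proof -
  have "x\<^sup>2 - y\<^sup>2 = (x - y) * (x + y)" by (simp add: power2_eq_square algebra_simps)
  also have "\<dots> \<le> \<bar>x - y\<bar> * \<bar>x + y\<bar>"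
    using abs_ge_self[of "(x - y) * (x + y)"] by (simp only: abs_mult)
  also have "\<dots> \<le> \<bar>x - y\<bar> * (2 * G)"
    using assms(1,2) by (intro mult_left_mono) linarith+
  also have "\<dots> \<le> G * (\<eta> + (x - y)\<^sup>2 / \<eta>)"
  proof -
    have "2 * \<bar>x - y\<bar> * \<eta> \<le> \<eta>\<^sup>2 + (x - y)\<^sup>2"
      using sum_squares_bound[of "\<bar>x - y\<bar>" \<eta>] by simp
    then have "2 * \<bar>x - y\<bar> \<le> \<eta> + (x - y)\<^sup>2 / \<eta>"
      using assms(3) by (simp add: field_simps power2_eq_square)
    then have "G * (2 * \<bar>x - y\<bar>) \<le> G * (\<eta> + (x - y)\<^sup>2 / \<eta>)"
      using assms(1) by (intro mult_left_mono) auto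
    then show ?thesis by (simp add: mult.commute mult.left_commute)
  qed
  finally show ?thesis by (simp add: field_simps)
qed

section \<open>Approximation by uniformly bounded simple integrands\<close>

context wiener_filtration
begin

text \<open>Projection onto \<open>[0, G]\<close>, where \<open>H\<close> takes its values, does not
  increase the distance to \<open>H\<close>, and what it removes is no larger than that distance. By
  Lenglart's inequality the integrals of the removed parts vanish in probability, so the clipped
  integrals still converge to \<open>I\<close>. The majorant \<open>D\<close> is the distance before
  clipping, because its measurability is supplied by \<open>null_in_prob\<close>.\<close>

lemma ito_integral_bounded_approximation:
  assumes ito: "ito_integral M F W H I" and H: "\<And>s \<omega>. 0 \<le> H s \<omega>" "\<And>s \<omega>. H s \<omega> \<le> G"
  obtains n \<tau> \<xi> D where
    "\<And>k. simple_integrand M F (n k) (\<tau> k) (\<xi> k)"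
    "\<And>k i \<omega>. \<bar>\<xi> k i \<omega>\<bar> \<le> G"
    "\<And>t k. 0 \<le> t \<Longrightarrow> D t k \<in> borel_measurable M"
    "\<And>t k \<omega>. 0 \<le> t \<Longrightarrow>
      (\<integral>\<^sup>+u\<in>{0..t}. ennreal ((simple_process (n k) (\<tau> k) (\<xi> k) u \<omega> - H u \<omega>)\<^sup>2) \<partial>lborel) \<le> D t k \<omega>"
    "\<And>t \<epsilon>. 0 \<le> t \<Longrightarrow> 0 < \<epsilon> \<Longrightarrow> (\<lambda>k. prob {\<omega> \<in> space M. ennreal \<epsilon> < D t k \<omega>}) \<longlonglongrightarrow> 0"
    "\<And>t. 0 \<le> t \<Longrightarrow> vanishes_in_prob (\<lambda>k \<omega>. simple_ito_integral W (n k) (\<tau> k) (\<xi> k) t \<omega> - I t \<omega>)"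
proof -
  obtain n \<tau> \<xi> where simple: "\<And>k. simple_integrand M F (n k) (\<tau> k) (\<xi> k)"
    and D_null: "\<And>t. 0 \<le> t \<Longrightarrow> null_in_prob M (\<lambda>k \<omega>. \<integral>\<^sup>+u\<in>{0..t}.
             ennreal ((simple_process (n k) (\<tau> k) (\<xi> k) u \<omega> - H u \<omega>)\<^sup>2) \<partial>lborel)"
    and I_null: "\<And>t. 0 \<le> t \<Longrightarrow> null_in_prob M (\<lambda>k \<omega>.
             ennreal \<bar>simple_ito_integral W (n k) (\<tau> k) (\<xi> k) t \<omega> - I t \<omega>\<bar>)"
    using ito unfolding ito_integral_def by blast
  define D where "D t k \<omega> = (\<integral>\<^sup>+u\<in>{0..t}.
     ennreal ((simple_process (n k) (\<tau> k) (\<xi> k) u \<omega> - H u \<omega>)\<^sup>2) \<partial>lborel)" for t k \<omega>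
  define g where "g x = max 0 (min x G)" for x :: real
  have G: "0 \<le> G" using H[of undefined undefined] by linarith
  have g: "\<bar>g x\<bar> \<le> G" "g 0 = 0" for x using G by (auto simp: g_def)
  have g_dist: "(g x - H u \<omega>)\<^sup>2 \<le> (x - H u \<omega>)\<^sup>2" "(x - g x)\<^sup>2 \<le> (x - H u \<omega>)\<^sup>2" for x u \<omega>
    using H[of u \<omega>] by (auto simp: abs_le_square_iff[symmetric] g_def)
  have step: "\<And>i. i < n k \<Longrightarrow> \<tau> k i \<le> \<tau> k (Suc i)" for k
    using simple[of k] by (simp add: simple_integrand_def)
  have comp: "q (simple_process (n k) (\<tau> k) (\<xi> k) u \<omega>) = simple_process (n k) (\<tau> k) (\<lambda>i \<omega>. q (\<xi> k i \<omega>)) u \<omega>"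
    if "q 0 = 0" for q :: "real \<Rightarrow> real" and k u \<omega>
    using that step by (rule simple_process_comp)
  let ?\<zeta> = "\<lambda>k i \<omega>. g (\<xi> k i \<omega>)" and ?\<kappa> = "\<lambda>k i \<omega>. \<xi> k i \<omega> - g (\<xi> k i \<omega>)"
  have \<zeta>_simple: "simple_integrand M F (n k) (\<tau> k) (?\<zeta> k)" for k
    using simple[of k] g(1) unfolding simple_integrand_def g_def by (auto intro!: exI[of _ G])
  have \<kappa>_simple: "simple_integrand M F (n k) (\<tau> k) (?\<kappa> k)" for k
    unfolding simple_integrand_def
  proof (intro conjI allI impI)
    fix i assume i: "i < n k"
    then obtain K where "\<forall>\<omega>\<in>space M. \<bar>\<xi> k i \<omega>\<bar> \<le> K"
      using simple[of k] by (auto simp: simple_integrand_def)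
    then have "\<forall>\<omega>\<in>space M. \<bar>?\<kappa> k i \<omega>\<bar> \<le> K + G"
      using g(1) by (auto intro!: order_trans[OF abs_triangle_ineq4] add_mono)
    then show "\<exists>K. \<forall>\<omega>\<in>space M. \<bar>?\<kappa> k i \<omega>\<bar> \<le> K" by blast
    show "?\<kappa> k i \<in> borel_measurable (F (\<tau> k i))"
    proof -
      have "\<xi> k i \<in> borel_measurable (F (\<tau> k i))"
        using simple[of k] i by (simp add: simple_integrand_def)
      then show ?thesis unfolding g_def by measurable
    qed
  qed (use simple[of k] in \<open>auto simp: simple_integrand_def\<close>)
  have \<zeta>_D: "(\<integral>\<^sup>+u\<in>{0..t}. ennreal ((simple_process (n k) (\<tau> k) (?\<zeta> k) u \<omega> - H u \<omega>)\<^sup>2) \<partial>lborel) \<le> D t k \<omega>"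
    for t k \<omega>
    unfolding D_def comp[of g, OF g(2), symmetric]
    using g_dist by (intro nn_integral_mono mult_right_mono ennreal_leI) auto
  have D_meas: "D t k \<in> borel_measurable M"
    and D_lim: "0 < \<epsilon> \<Longrightarrow> (\<lambda>k. prob {\<omega> \<in> space M. ennreal \<epsilon> < D t k \<omega>}) \<longlonglongrightarrow> 0" if "0 \<le> t" for t k \<epsilon>
    using D_null[OF that] unfolding null_in_prob_def D_def[abs_def] by blast+
  let ?V = "\<lambda>t k \<omega>. \<Sum>i<n k. (?\<kappa> k i \<omega>)\<^sup>2 * (max 0 (min (\<tau> k (Suc i)) t) - max 0 (min (\<tau> k i) t))"
  have V_D: "ennreal (?V t k \<omega>) \<le> D t k \<omega>" if t: "0 \<le> t" for t k \<omega>
  proof -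
    obtain K where K: "\<And>i \<omega>. i < n k \<Longrightarrow> \<omega> \<in> space M \<Longrightarrow> \<bar>?\<kappa> k i \<omega>\<bar> \<le> K"
      using simple_integrand_uniform_bound[OF \<kappa>_simple[of k]] by blast
    have "ennreal (?V t k \<omega>) = (\<integral>\<^sup>+u\<in>{0<..t}. ennreal ((simple_process (n k) (\<tau> k) (?\<kappa> k) u \<omega>)\<^sup>2) \<partial>lborel)"
      by (rule simple_quadratic_variation(4)[OF \<kappa>_simple K order.refl t])
    also have "\<dots> \<le> D t k \<omega>"
      unfolding D_def
    proof (intro nn_integral_mono mult_mono ennreal_leI)
      fix u
      have "simple_process (n k) (\<tau> k) (?\<kappa> k) u \<omega>
        = simple_process (n k) (\<tau> k) (\<xi> k) u \<omega> - g (simple_process (n k) (\<tau> k) (\<xi> k) u \<omega>)"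
        using comp[of "\<lambda>x. x - g x" k u \<omega>] g(2) by simp
      then show "(simple_process (n k) (\<tau> k) (?\<kappa> k) u \<omega>)\<^sup>2 \<le> (simple_process (n k) (\<tau> k) (\<xi> k) u \<omega> - H u \<omega>)\<^sup>2"
        using g_dist(2) by simp
    qed (auto split: split_indicator)
    finally show ?thesis .
  qed
  have \<kappa>_null: "vanishes_in_prob (\<lambda>k \<omega>. simple_ito_integral W (n k) (\<tau> k) (?\<kappa> k) t \<omega>)" if t: "0 \<le> t" for t
    unfolding vanishes_in_prob_def
  proof (intro conjI allI impI)
    fix k
    obtain K where K: "\<And>i \<omega>. i < n k \<Longrightarrow> \<omega> \<in> space M \<Longrightarrow> \<bar>?\<kappa> k i \<omega>\<bar> \<le> K"
      using simple_integrand_uniform_bound[OF \<kappa>_simple[of k]] by blast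
    have "\<And>i. i \<le> n k \<Longrightarrow> 0 \<le> \<tau> k i"
      using simple_nonneg[OF simple[of k], of "\<bar>_\<bar>" 0 0] partition_le[of "n k" "\<tau> k" 0] step[of _ k] simple[of k]
      by (auto simp: simple_integrand_def intro: order_trans)
    then have "simple_ito_integral W (n k) (\<tau> k) (?\<kappa> k) 0 \<omega> = 0" for \<omega>
      by (simp add: simple_ito_integral_def min_absorb2)
    then show "simple_ito_integral W (n k) (\<tau> k) (?\<kappa> k) t \<in> borel_measurable M"
      using simple_increment(1)[OF \<kappa>_simple K order.refl t] by simp
  next
    fix \<delta> :: real assume \<delta>: "0 < \<delta>"
    show "(\<lambda>k. prob {\<omega> \<in> space M. \<delta> < \<bar>simple_ito_integral W (n k) (\<tau> k) (?\<kappa> k) t \<omega>\<bar>}) \<longlonglongrightarrow> 0"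
    proof (rule order_tendstoI)
      fix e :: real assume e: "0 < e"
      \<comment> \<open>Lenglart's bound then splits evenly:
        \<open>\<eta> / \<delta>\<^sup>2\<close> is \<open>e / 2\<close>, and the probability that
        the quadratic variation exceeds \<open>\<eta>\<close> is eventually below
        \<open>e / 2\<close>.\<close>
      define \<eta> where "\<eta> = \<delta>\<^sup>2 * (e / 2)"
      have \<eta>: "0 < \<eta>" "\<eta> / \<delta>\<^sup>2 = e / 2" using e \<delta> by (auto simp: \<eta>_def)
      from order_tendstoD(2)[OF D_lim[OF t \<eta>(1)], of "e / 2"]
      have "eventually (\<lambda>k. prob {\<omega> \<in> space M. ennreal \<eta> < D t k \<omega>} < e / 2) sequentially"
        using e by simp
      then show "eventually (\<lambda>k. prob {\<omega> \<in> space M. \<delta> < \<bar>simple_ito_integral W (n k) (\<tau> k) (?\<kappa> k) t \<omega>\<bar>} < e) sequentially"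
      proof eventually_elim
        case (elim k)
        have "prob {\<omega> \<in> space M. \<delta> < \<bar>simple_ito_integral W (n k) (\<tau> k) (?\<kappa> k) t \<omega>\<bar>}
          \<le> \<eta> / \<delta>\<^sup>2 + prob {\<omega> \<in> space M. \<eta> < ?V t k \<omega>}"
          by (rule simple_ito_integral_tail[OF \<kappa>_simple t \<eta>(1) \<delta>])
        also have "prob {\<omega> \<in> space M. \<eta> < ?V t k \<omega>} \<le> prob {\<omega> \<in> space M. ennreal \<eta> < D t k \<omega>}"
        proof (intro finite_measure_mono Collect_mono impI conjI)
          fix \<omega> assume *: "\<omega> \<in> space M \<and> \<eta> < ?V t k \<omega>"
          then have "ennreal \<eta> < ennreal (?V t k \<omega>)"
            using \<eta> by (intro ennreal_lessI) auto
          then show "ennreal \<eta> < D t k \<omega>" using V_D[OF t] less_le_trans by blast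
        qed (use D_meas[OF t] in auto)
        finally show ?case using elim \<eta> by simp
      qed
    qed (auto intro!: always_eventually less_le_trans[OF _ measure_nonneg])
  qed
  have \<xi>_null: "vanishes_in_prob (\<lambda>k \<omega>. simple_ito_integral W (n k) (\<tau> k) (\<xi> k) t \<omega> - I t \<omega>)" if t: "0 \<le> t" for t
    unfolding vanishes_in_prob_def
  proof (intro conjI allI impI)
    fix k
    have I_meas: "I t \<in> borel_measurable M"
      using ito t measurable_F_M[OF t] by (auto simp: ito_integral_def adapted_def)
    have "simple_ito_integral W (n k) (\<tau> k) (\<xi> k) t \<in> borel_measurable M"
    proof -
      have \<tau>: "0 \<le> \<tau> k i" if "i \<le> n k" for i
        using partition_le[of "n k" "\<tau> k" 0 i] step[of _ k] simple[of k] that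
        by (auto simp: simple_integrand_def intro: order_trans)
      have "\<xi> k i \<in> borel_measurable M" if "i < n k" for i
        using simple[of k] that \<tau>[of i] measurable_F_M by (auto simp: simple_integrand_def)
      then show ?thesis
        unfolding simple_ito_integral_def[abs_def]
        using \<tau> t by (intro borel_measurable_sum borel_measurable_times borel_measurable_diff measurable_W_M) auto
    qed
    then show "(\<lambda>\<omega>. simple_ito_integral W (n k) (\<tau> k) (\<xi> k) t \<omega> - I t \<omega>) \<in> borel_measurable M"
      using I_meas by (rule borel_measurable_diff)
  next
    fix \<epsilon> :: real assume "0 < \<epsilon>"
    then show "(\<lambda>k. prob {\<omega> \<in> space M. \<epsilon> < \<bar>simple_ito_integral W (n k) (\<tau> k) (\<xi> k) t \<omega> - I t \<omega>\<bar>}) \<longlonglongrightarrow> 0"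
      using I_null[OF t] unfolding null_in_prob_def by (auto simp: ennreal_less_iff)
  qed
  have "vanishes_in_prob (\<lambda>k \<omega>. simple_ito_integral W (n k) (\<tau> k) (?\<zeta> k) t \<omega> - I t \<omega>)" if t: "0 \<le> t" for t
    using vanishes_in_prob_add[OF \<xi>_null[OF t] vanishes_in_prob_minus[OF \<kappa>_null[OF t]]]
    by (simp add: simple_ito_integral_diff[symmetric])
  then show ?thesis
    using \<zeta>_simple g(1) D_meas \<zeta>_D D_lim by (intro that[of n \<tau> ?\<zeta> D]) auto
qed

end

section \<open>Moments of increments of the stochastic integral\<close>

context wiener_filtration
begin

context
  fixes H I :: "real \<Rightarrow> 'a \<Rightarrow> real" and G s t :: real
  assumes ito: "ito_integral M F W H I"
    and H: "\<And>s \<omega>. 0 \<le> H s \<omega>" "\<And>s \<omega>. H s \<omega> \<le> G"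
    and st: "0 \<le> s" "s \<le> t"
begin

lemma ito_increment_measurable: "(\<lambda>\<omega>. I t \<omega> - I s \<omega>) \<in> borel_measurable M"
  using ito st measurable_F_M[of t "I t"] measurable_F_M[of s "I s"]
  unfolding ito_integral_def adapted_def by (intro borel_measurable_diff) auto

text \<open>Upper bounds survive the limit by Fatou's lemma; the vanishing mean is an equality and
  needs convergence in mean. The last item is one half of the conditional isometry, with the
  integrated \<open>(H u)\<^sup>2\<close> replaced by a bound \<open>Z\<close> valid on all of
  \<open>[s, t]\<close>. \<open>Z\<close> may depend on the path after time \<open>s\<close>, which
  allows it to contain the oscillation of the path.\<close>

lemma ito_increment_moments:
  shows "integrable M (\<lambda>\<omega>. (I t \<omega> - I s \<omega>) ^ 4)"
    and "expectation (\<lambda>\<omega>. (I t \<omega> - I s \<omega>) ^ 4) \<le> 3 * G ^ 4 * (t - s)\<^sup>2"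
    and "Y \<in> borel_measurable (F s) \<Longrightarrow> (\<And>\<omega>. \<omega> \<in> space M \<Longrightarrow> \<bar>Y \<omega>\<bar> \<le> B) \<Longrightarrow>
      expectation (\<lambda>\<omega>. Y \<omega> * (I t \<omega> - I s \<omega>)) = 0"
    and "Y \<in> borel_measurable (F s) \<Longrightarrow> (\<And>\<omega>. \<omega> \<in> space M \<Longrightarrow> 0 \<le> Y \<omega> \<and> Y \<omega> \<le> B) \<Longrightarrow>
      Z \<in> borel_measurable M \<Longrightarrow> (\<And>\<omega>. \<omega> \<in> space M \<Longrightarrow> \<bar>Z \<omega>\<bar> \<le> K) \<Longrightarrow>
      (AE \<omega> in M. \<forall>u\<in>{s..t}. (H u \<omega>)\<^sup>2 \<le> Z \<omega>) \<Longrightarrow>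
      (AE \<omega> in M. continuous_on {0..} (\<lambda>u. H u \<omega>)) \<Longrightarrow>
      expectation (\<lambda>\<omega>. Y \<omega> * (I t \<omega> - I s \<omega>)\<^sup>2) \<le> (t - s) * expectation (\<lambda>\<omega>. Y \<omega> * Z \<omega>)"
proof -
  have G: "0 \<le> G" using H[of undefined undefined] by linarith
  have t: "0 \<le> t" using st by simp
  obtain n \<tau> \<xi> D where simple: "\<And>k. simple_integrand M F (n k) (\<tau> k) (\<xi> k)"
    and bound: "\<And>k i \<omega>. \<bar>\<xi> k i \<omega>\<bar> \<le> G"
    and D_meas: "\<And>t k. 0 \<le> t \<Longrightarrow> D t k \<in> borel_measurable M"
    and D: "\<And>t k \<omega>. 0 \<le> t \<Longrightarrow>
      (\<integral>\<^sup>+u\<in>{0..t}. ennreal ((simple_process (n k) (\<tau> k) (\<xi> k) u \<omega> - H u \<omega>)\<^sup>2) \<partial>lborel) \<le> D t k \<omega>"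
    and D_lim: "\<And>t \<epsilon>. 0 \<le> t \<Longrightarrow> 0 < \<epsilon> \<Longrightarrow> (\<lambda>k. prob {\<omega> \<in> space M. ennreal \<epsilon> < D t k \<omega>}) \<longlonglongrightarrow> 0"
    and J_lim: "\<And>t. 0 \<le> t \<Longrightarrow> vanishes_in_prob (\<lambda>k \<omega>. simple_ito_integral W (n k) (\<tau> k) (\<xi> k) t \<omega> - I t \<omega>)"
    by (rule ito_integral_bounded_approximation[OF ito H]) (rule that)
  define J where "J k \<omega> = simple_ito_integral W (n k) (\<tau> k) (\<xi> k) t \<omega> - simple_ito_integral W (n k) (\<tau> k) (\<xi> k) s \<omega>" for k \<omega>
  define V where "V k \<omega> = (\<Sum>i<n k. (\<xi> k i \<omega>)\<^sup>2 * (max s (min (\<tau> k (Suc i)) t) - max s (min (\<tau> k i) t)))" for k \<omega>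
  define \<Delta> where "\<Delta> \<omega> = I t \<omega> - I s \<omega>" for \<omega>
  have \<Delta>_meas [measurable]: "\<Delta> \<in> borel_measurable M"
    unfolding \<Delta>_def[abs_def] by (rule ito_increment_measurable)
  note J_props = simple_increment[OF simple bound st, folded J_def V_def]
  note V_props = simple_quadratic_variation[OF simple bound st, folded V_def]
  have J_null: "vanishes_in_prob (\<lambda>k \<omega>. J k \<omega> - \<Delta> \<omega>)"
    using vanishes_in_prob_add[OF J_lim[OF t] vanishes_in_prob_minus[OF J_lim[OF st(1)]]]
    by (simp add: J_def \<Delta>_def algebra_simps)
  \<comment> \<open>Fatou's lemma works with almost sure limits, hence the subsequence.\<close>
  obtain r :: "nat \<Rightarrow> nat" where r: "strict_mono r" "AE \<omega> in M. (\<lambda>k. J (r k) \<omega> - \<Delta> \<omega>) \<longlonglongrightarrow> 0"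
    using vanishes_in_prob_AE_subseq[OF J_null] by blast
  have J_AE: "AE \<omega> in M. (\<lambda>k. J (r k) \<omega>) \<longlonglongrightarrow> \<Delta> \<omega>"
    using r(2) by eventually_elim (simp add: LIM_zero_iff)
  have four: "integrable M (\<lambda>\<omega>. \<Delta> \<omega> ^ 4)" "expectation (\<lambda>\<omega>. \<Delta> \<omega> ^ 4) \<le> 3 * G ^ 4 * (t - s)\<^sup>2"
  proof -
    have "AE \<omega> in M. (\<lambda>k. J (r k) \<omega> ^ 4) \<longlonglongrightarrow> \<Delta> \<omega> ^ 4"
      using J_AE by eventually_elim (intro tendsto_power)
    then show "integrable M (\<lambda>\<omega>. \<Delta> \<omega> ^ 4)" "expectation (\<lambda>\<omega>. \<Delta> \<omega> ^ 4) \<le> 3 * G ^ 4 * (t - s)\<^sup>2"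
      using integral_fatou[of "\<lambda>k \<omega>. J (r k) \<omega> ^ 4" "\<lambda>\<omega>. \<Delta> \<omega> ^ 4" "\<lambda>_. 3 * G ^ 4 * (t - s)\<^sup>2"] J_props(2,3)
      by auto
  qed
  then show "integrable M (\<lambda>\<omega>. (I t \<omega> - I s \<omega>) ^ 4)"
    "expectation (\<lambda>\<omega>. (I t \<omega> - I s \<omega>) ^ 4) \<le> 3 * G ^ 4 * (t - s)\<^sup>2"
    by (simp_all add: \<Delta>_def)
  have \<Delta>_int: "integrable M (\<lambda>\<omega>. \<Delta> \<omega> ^ k)" if "k \<le> 4" for k
    using integrable_power_4[OF \<Delta>_meas four(1) that] .
  have J_int: "integrable M (\<lambda>\<omega>. J k \<omega> ^ j)" if "j \<le> 4" for j k
    using integrable_power_4[OF J_props(1,2) that] .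
  have J_2: "expectation (\<lambda>\<omega>. (J k \<omega>)\<^sup>2) \<le> G\<^sup>2 * (t - s)" for k
  proof -
    have "expectation (\<lambda>\<omega>. (J k \<omega>)\<^sup>2) = expectation (V k)"
      using J_props(5)[of "\<lambda>_. 1" 1 k] by simp
    also have "\<dots> \<le> G\<^sup>2 * (t - s)"
      using V_props by (intro integral_le_const integrable_const_bound[of _ "G\<^sup>2 * (t - s)"]) auto
    finally show ?thesis .
  qed
  have \<Delta>_2: "expectation (\<lambda>\<omega>. (\<Delta> \<omega>)\<^sup>2) \<le> G\<^sup>2 * (t - s)"
  proof -
    have "AE \<omega> in M. (\<lambda>k. (J (r k) \<omega>)\<^sup>2) \<longlonglongrightarrow> (\<Delta> \<omega>)\<^sup>2"
      using J_AE by eventually_elim (intro tendsto_power)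
    then show ?thesis
      using integral_fatou(2)[of "\<lambda>k \<omega>. (J (r k) \<omega>)\<^sup>2" "\<lambda>\<omega>. (\<Delta> \<omega>)\<^sup>2" "\<lambda>_. G\<^sup>2 * (t - s)"] J_2 J_int[of 2]
      by auto
  qed
  have diff_sq: "(x - y)\<^sup>2 \<le> 2 * x\<^sup>2 + 2 * y\<^sup>2" for x y :: real
    using zero_le_power2[of "x + y"] by (simp add: power2_eq_square algebra_simps)
  have diff_int: "integrable M (\<lambda>\<omega>. (J k \<omega> - \<Delta> \<omega>)\<^sup>2)" for k
  proof (rule Bochner_Integration.integrable_bound)
    show "integrable M (\<lambda>\<omega>. 2 * (J k \<omega>)\<^sup>2 + 2 * (\<Delta> \<omega>)\<^sup>2)" using J_int[of 2] \<Delta>_int[of 2] by simp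
    show "(\<lambda>\<omega>. (J k \<omega> - \<Delta> \<omega>)\<^sup>2) \<in> borel_measurable M" using J_props(1) by measurable
  qed (use diff_sq in auto)
  have "expectation (\<lambda>\<omega>. (J k \<omega> - \<Delta> \<omega>)\<^sup>2) \<le> 4 * (G\<^sup>2 * (t - s))" for k
  proof -
    have "expectation (\<lambda>\<omega>. (J k \<omega> - \<Delta> \<omega>)\<^sup>2) \<le> expectation (\<lambda>\<omega>. 2 * (J k \<omega>)\<^sup>2 + 2 * (\<Delta> \<omega>)\<^sup>2)"
      using diff_int diff_sq J_int[of 2] \<Delta>_int[of 2] by (intro integral_mono) auto
    also have "\<dots> \<le> 4 * (G\<^sup>2 * (t - s))"
      using J_int[of 2] \<Delta>_int[of 2] J_2[of k] \<Delta>_2 by simp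
    finally show ?thesis .
  qed
  from vanishes_in_prob_expectation[OF J_null diff_int this]
  have L1: "(\<lambda>k. expectation (\<lambda>\<omega>. \<bar>J k \<omega> - \<Delta> \<omega>\<bar>)) \<longlonglongrightarrow> 0" .
  show "expectation (\<lambda>\<omega>. Y \<omega> * (I t \<omega> - I s \<omega>)) = 0"
    if Y: "Y \<in> borel_measurable (F s)" "\<And>\<omega>. \<omega> \<in> space M \<Longrightarrow> \<bar>Y \<omega>\<bar> \<le> B"
  proof -
    have Y_M: "Y \<in> borel_measurable M" using measurable_F_M[OF st(1) Y(1)] .
    have Y\<Delta>: "integrable M (\<lambda>\<omega>. Y \<omega> * \<Delta> \<omega>)" "integrable M (\<lambda>\<omega>. Y \<omega> * J k \<omega>)" for k
      using \<Delta>_int[of 1] J_int[of 1 k] by (auto intro!: integrable_bounded_mult Y_M Y(2))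
    have diff1: "integrable M (\<lambda>\<omega>. J k \<omega> - \<Delta> \<omega>)" for k
      using \<Delta>_int[of 1] J_int[of 1 k] by simp
    have "\<bar>expectation (\<lambda>\<omega>. Y \<omega> * \<Delta> \<omega>)\<bar> \<le> B * expectation (\<lambda>\<omega>. \<bar>J k \<omega> - \<Delta> \<omega>\<bar>)" for k
    proof -
      have "expectation (\<lambda>\<omega>. Y \<omega> * \<Delta> \<omega>) = expectation (\<lambda>\<omega>. Y \<omega> * \<Delta> \<omega> - Y \<omega> * J k \<omega>)"
        using Y\<Delta> J_props(4)[OF Y, of k] by simp
      also have "\<bar>\<dots>\<bar> \<le> expectation (\<lambda>\<omega>. \<bar>Y \<omega> * \<Delta> \<omega> - Y \<omega> * J k \<omega>\<bar>)"
        by (rule integral_abs_bound)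
      also have "\<dots> \<le> expectation (\<lambda>\<omega>. B * \<bar>J k \<omega> - \<Delta> \<omega>\<bar>)"
      proof (rule integral_mono)
        fix \<omega> assume "\<omega> \<in> space M"
        then show "\<bar>Y \<omega> * \<Delta> \<omega> - Y \<omega> * J k \<omega>\<bar> \<le> B * \<bar>J k \<omega> - \<Delta> \<omega>\<bar>"
          using mult_right_mono[OF Y(2)[of \<omega>], of "\<bar>J k \<omega> - \<Delta> \<omega>\<bar>"]
          by (simp add: right_diff_distrib[symmetric] abs_mult abs_minus_commute)
      qed (use Y\<Delta> diff1 in auto)
      finally show ?thesis by simp
    qed
    moreover have "(\<lambda>k. B * expectation (\<lambda>\<omega>. \<bar>J k \<omega> - \<Delta> \<omega>\<bar>)) \<longlonglongrightarrow> B * 0"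
      by (intro tendsto_mult_left L1)
    ultimately have "\<bar>expectation (\<lambda>\<omega>. Y \<omega> * \<Delta> \<omega>)\<bar> \<le> B * 0"
      by (intro LIMSEQ_le_const) auto
    then show ?thesis by (simp add: \<Delta>_def)
  qed
  show "expectation (\<lambda>\<omega>. Y \<omega> * (I t \<omega> - I s \<omega>)\<^sup>2) \<le> (t - s) * expectation (\<lambda>\<omega>. Y \<omega> * Z \<omega>)"
    if Y: "Y \<in> borel_measurable (F s)" "\<And>\<omega>. \<omega> \<in> space M \<Longrightarrow> 0 \<le> Y \<omega> \<and> Y \<omega> \<le> B"
      and Z: "Z \<in> borel_measurable M" "\<And>\<omega>. \<omega> \<in> space M \<Longrightarrow> \<bar>Z \<omega>\<bar> \<le> K"
      and HZ: "AE \<omega> in M. \<forall>u\<in>{s..t}. (H u \<omega>)\<^sup>2 \<le> Z \<omega>"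
      and cont: "AE \<omega> in M. continuous_on {0..} (\<lambda>u. H u \<omega>)"
  proof -
    have Y_M: "Y \<in> borel_measurable M" using measurable_F_M[OF st(1) Y(1)] .
    have Y_abs: "\<bar>Y \<omega>\<bar> \<le> B" if "\<omega> \<in> space M" for \<omega> using Y(2)[OF that] by simp
    have B: "0 \<le> B" using Y(2) not_empty by force
    have YZ: "integrable M (\<lambda>\<omega>. Y \<omega> * Z \<omega>)"
      by (rule integrable_bounded_mult[OF integrable_const_bound Y_M Y_abs]) (use Z in auto)
    \<comment> \<open>Off this event the perturbation costs \<open>G / \<eta>\<close> times
      \<open>\<eta>\<^sup>2\<close>, that is \<open>G * \<eta>\<close>. On it only the crude bound
      \<open>G\<^sup>2 * (t - s)\<close> for \<open>V k\<close> is used, and its probability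
      vanishes as \<open>k\<close> grows.\<close>
    let ?bad = "\<lambda>\<eta> k. {\<omega> \<in> space M. ennreal (\<eta>\<^sup>2) < D t k \<omega>}"
    have V_le: "AE \<omega> in M. V k \<omega> \<le> (t - s) * (Z \<omega> + G * \<eta>) + G * \<eta> + G\<^sup>2 * (t - s) * indicator (?bad \<eta> k) \<omega>"
      if \<eta>: "0 < \<eta>" for \<eta> k
      using HZ cont AE_space
    proof eventually_elim
      case (elim \<omega>)
      have Z0: "0 \<le> Z \<omega>" using elim(1) st by (auto intro: order_trans[OF zero_le_power2])
      have nonneg: "0 \<le> (t - s) * (Z \<omega> + G * \<eta>) + G * \<eta>"
        using st Z0 G \<eta> by auto
      show ?case
      proof (cases "\<omega> \<in> ?bad \<eta> k")
        case True
        then show ?thesis using V_props(3)[OF elim(3), of k] nonneg by simp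
      next
        case False
        then have D_le: "D t k \<omega> \<le> ennreal (\<eta>\<^sup>2)" using elim(3) by auto
        let ?S = "\<lambda>u. simple_process (n k) (\<tau> k) (\<xi> k) u \<omega>"
        have S_meas: "?S \<in> borel_measurable borel"
          unfolding simple_process_def by measurable
        \<comment> \<open>Measurability in time comes from continuity of the path, which is known
          only on \<open>{0..}\<close>; the indicator extends it to the whole line.\<close>
        have H_meas: "(\<lambda>u. indicator {0..} u * H u \<omega>) \<in> borel_measurable borel"
          using borel_measurable_continuous_on_indicator[OF _ elim(2)] by simp
        have S_bound: "\<bar>?S u\<bar> \<le> G" for u
        proof -
          \<comment> \<open>The excess over \<open>G\<close> is a function fixing 0, so it can be
            evaluated on the coefficients, where it vanishes.\<close>
          have "max 0 (\<bar>?S u\<bar> - G) = simple_process (n k) (\<tau> k) (\<lambda>i \<omega>. max 0 (\<bar>\<xi> k i \<omega>\<bar> - G)) u \<omega>"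
            using simple[of k] G by (intro simple_process_comp[where g = "\<lambda>x. max 0 (\<bar>x\<bar> - G)"]) (auto simp: simple_integrand_def)
          also have "\<dots> = 0" using bound by (simp add: simple_process_def)
          finally show ?thesis by simp
        qed
        have "ennreal (V k \<omega>) = (\<integral>\<^sup>+u\<in>{s<..t}. ennreal ((?S u)\<^sup>2) \<partial>lborel)"
          by (rule V_props(4))
        also have "\<dots> \<le> (\<integral>\<^sup>+u. ennreal (Z \<omega> + G * \<eta>) * indicator {s<..t} u
            + ennreal (G / \<eta>) * (ennreal ((?S u - indicator {0..} u * H u \<omega>)\<^sup>2) * indicator {0..t} u) \<partial>lborel)"
        proof (intro nn_integral_mono)
          fix u
          show "ennreal ((?S u)\<^sup>2) * indicator {s<..t} u \<le> ennreal (Z \<omega> + G * \<eta>) * indicator {s<..t} u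
            + ennreal (G / \<eta>) * (ennreal ((?S u - indicator {0..} u * H u \<omega>)\<^sup>2) * indicator {0..t} u)"
          proof (cases "u \<in> {s<..t}")
            case True
            have "(?S u)\<^sup>2 \<le> (H u \<omega>)\<^sup>2 + G * \<eta> + G / \<eta> * (?S u - H u \<omega>)\<^sup>2"
              using S_bound H \<eta> by (intro square_le_perturbed) auto
            also have "\<dots> \<le> Z \<omega> + G * \<eta> + G / \<eta> * (?S u - H u \<omega>)\<^sup>2"
              using elim(1) True by auto
            finally have "ennreal ((?S u)\<^sup>2) \<le> ennreal (Z \<omega> + G * \<eta> + G / \<eta> * (?S u - H u \<omega>)\<^sup>2)"
              by (rule ennreal_leI)
            also have "\<dots> = ennreal (Z \<omega> + G * \<eta>) + ennreal (G / \<eta>) * ennreal ((?S u - H u \<omega>)\<^sup>2)"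
              using Z0 G \<eta> by (simp add: ennreal_plus ennreal_mult'[symmetric])
            finally show ?thesis using True st by simp
          qed simp
        qed
        also have "\<dots> = ennreal (Z \<omega> + G * \<eta>) * ennreal (t - s) + ennreal (G / \<eta>)
            * (\<integral>\<^sup>+u\<in>{0..t}. ennreal ((?S u - indicator {0..} u * H u \<omega>)\<^sup>2) \<partial>lborel)"
          using S_meas H_meas st
          by (subst nn_integral_add) (auto simp: nn_integral_cmult nn_integral_cmult_indicator)
        also have "(\<integral>\<^sup>+u\<in>{0..t}. ennreal ((?S u - indicator {0..} u * H u \<omega>)\<^sup>2) \<partial>lborel)
            = (\<integral>\<^sup>+u\<in>{0..t}. ennreal ((?S u - H u \<omega>)\<^sup>2) \<partial>lborel)"
          by (intro nn_integral_cong) (auto split: split_indicator)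
        also have "\<dots> \<le> ennreal (\<eta>\<^sup>2)"
          using D[OF t, of k \<omega>] D_le by (rule order_trans)
        finally have "ennreal (V k \<omega>) \<le> ennreal (Z \<omega> + G * \<eta>) * ennreal (t - s) + ennreal (G / \<eta>) * ennreal (\<eta>\<^sup>2)"
          by (simp add: mult_left_mono)
        also have "\<dots> = ennreal ((t - s) * (Z \<omega> + G * \<eta>) + G * \<eta>)"
          using Z0 G \<eta> st
          by (simp add: ennreal_mult'[symmetric] ennreal_plus[symmetric] power2_eq_square mult.commute del: ennreal_plus)
        finally show ?thesis using False nonneg by (simp add: ennreal_le_iff)
      qed
    qed
    have key: "expectation (\<lambda>\<omega>. Y \<omega> * (\<Delta> \<omega>)\<^sup>2) \<le> (t - s) * expectation (\<lambda>\<omega>. Y \<omega> * Z \<omega>) + B * (G * (t - s + 1)) * \<eta>"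
      if \<eta>: "0 < \<eta>" for \<eta>
    proof (rule integral_fatou(2))
      let ?c = "\<lambda>k. (t - s) * expectation (\<lambda>\<omega>. Y \<omega> * Z \<omega>) + B * (G * (t - s + 1)) * \<eta> + B * (G\<^sup>2 * (t - s)) * prob (?bad \<eta> (r k))"
      have YJ: "integrable M (\<lambda>\<omega>. Y \<omega> * (J k \<omega>)\<^sup>2)" for k
        by (intro integrable_bounded_mult[OF _ Y_M Y_abs] J_int) auto
      \<comment> \<open>Absolute values, because \<open>integral_fatou\<close> asks for
        nonnegativity everywhere while \<open>Y\<close> is known to be nonnegative only on
        \<open>space M\<close>.\<close>
      show "integrable M (\<lambda>\<omega>. \<bar>Y \<omega> * (J (r k) \<omega>)\<^sup>2\<bar>)" for k
        using YJ by simp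
      show "(\<lambda>\<omega>. Y \<omega> * (\<Delta> \<omega>)\<^sup>2) \<in> borel_measurable M" using Y_M by measurable
      show "AE \<omega> in M. (\<lambda>k. \<bar>Y \<omega> * (J (r k) \<omega>)\<^sup>2\<bar>) \<longlonglongrightarrow> Y \<omega> * (\<Delta> \<omega>)\<^sup>2"
        using J_AE AE_space
      proof eventually_elim
        case (elim \<omega>)
        then have "(\<lambda>k. \<bar>Y \<omega> * (J (r k) \<omega>)\<^sup>2\<bar>) \<longlonglongrightarrow> \<bar>Y \<omega> * (\<Delta> \<omega>)\<^sup>2\<bar>"
          by (intro tendsto_intros)
        then show ?case using Y(2)[OF elim(2)] by simp
      qed
      show "expectation (\<lambda>\<omega>. \<bar>Y \<omega> * (J (r k) \<omega>)\<^sup>2\<bar>) \<le> ?c k" for k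
      proof -
        let ?k = "r k"
        have bad: "?bad \<eta> ?k \<in> events" using D_meas[OF t] by auto
        then have bad_int: "integrable M (indicator (?bad \<eta> ?k) :: 'a \<Rightarrow> real)"
          by (intro integrable_real_indicator) (auto simp: emeasure_eq_measure)
        have "expectation (\<lambda>\<omega>. \<bar>Y \<omega> * (J ?k \<omega>)\<^sup>2\<bar>) = expectation (\<lambda>\<omega>. Y \<omega> * (J ?k \<omega>)\<^sup>2)"
          using Y(2) by (intro Bochner_Integration.integral_cong) auto
        also have "\<dots> = expectation (\<lambda>\<omega>. Y \<omega> * V ?k \<omega>)"
          by (rule J_props(5)[OF Y(1) Y_abs])
        also have "\<dots> \<le> expectation (\<lambda>\<omega>. (t - s) * (Y \<omega> * Z \<omega>) + B * (G * (t - s + 1)) * \<eta>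
            + B * (G\<^sup>2 * (t - s)) * indicator (?bad \<eta> ?k) \<omega>)"
        proof (rule integral_mono_AE)
          show "integrable M (\<lambda>\<omega>. Y \<omega> * V ?k \<omega>)"
            by (rule integrable_bounded_mult[OF integrable_const_bound[of _ "G\<^sup>2 * (t - s)"] Y_M Y_abs])
              (use V_props in auto)
          show "integrable M (\<lambda>\<omega>. (t - s) * (Y \<omega> * Z \<omega>) + B * (G * (t - s + 1)) * \<eta>
            + B * (G\<^sup>2 * (t - s)) * indicator (?bad \<eta> ?k) \<omega>)"
            using YZ bad_int by (intro Bochner_Integration.integrable_add integrable_mult_right integrable_const)
          show "AE \<omega> in M. Y \<omega> * V ?k \<omega> \<le> (t - s) * (Y \<omega> * Z \<omega>) + B * (G * (t - s + 1)) * \<eta>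
            + B * (G\<^sup>2 * (t - s)) * indicator (?bad \<eta> ?k) \<omega>"
            using V_le[OF \<eta>, of ?k] AE_space
          proof eventually_elim
            case (elim \<omega>)
            let ?e = "G * (t - s + 1) * \<eta> + G\<^sup>2 * (t - s) * indicator (?bad \<eta> ?k) \<omega>"
            have "Y \<omega> * V ?k \<omega> \<le> Y \<omega> * ((t - s) * Z \<omega> + ?e)"
              using elim Y(2)[OF elim(2)] by (intro mult_left_mono) (auto simp: algebra_simps)
            also have "\<dots> = (t - s) * (Y \<omega> * Z \<omega>) + Y \<omega> * ?e" by (simp add: algebra_simps)
            also have "Y \<omega> * ?e \<le> B * ?e"
              using Y(2)[OF elim(2)] G \<eta> st by (intro mult_right_mono) auto
            finally show ?case by (simp add: algebra_simps)
          qed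
        qed
        also have "\<dots> = ?c k" using YZ bad bad_int by (simp add: prob_space)
        finally show ?thesis .
      qed
      have "(\<lambda>k. prob (?bad \<eta> (r k))) \<longlonglongrightarrow> 0"
        using LIMSEQ_subseq_LIMSEQ[OF D_lim[OF t, of "\<eta>\<^sup>2"] r(1)] \<eta> by (simp add: comp_def)
      then have "?c \<longlonglongrightarrow> (t - s) * expectation (\<lambda>\<omega>. Y \<omega> * Z \<omega>) + B * (G * (t - s + 1)) * \<eta> + B * (G\<^sup>2 * (t - s)) * 0"
        by (intro tendsto_intros)
      then show "?c \<longlonglongrightarrow> (t - s) * expectation (\<lambda>\<omega>. Y \<omega> * Z \<omega>) + B * (G * (t - s + 1)) * \<eta>" by simp
    qed simp
    have "((\<lambda>\<eta>. (t - s) * expectation (\<lambda>\<omega>. Y \<omega> * Z \<omega>) + B * (G * (t - s + 1)) * \<eta>)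
        \<longlongrightarrow> (t - s) * expectation (\<lambda>\<omega>. Y \<omega> * Z \<omega>) + B * (G * (t - s + 1)) * 0) (at_right 0)"
      by (intro tendsto_intros)
    then have "expectation (\<lambda>\<omega>. Y \<omega> * (\<Delta> \<omega>)\<^sup>2) \<le> (t - s) * expectation (\<lambda>\<omega>. Y \<omega> * Z \<omega>) + B * (G * (t - s + 1)) * 0"
    proof (rule tendsto_lowerbound)
      show "eventually (\<lambda>\<eta>. expectation (\<lambda>\<omega>. Y \<omega> * (\<Delta> \<omega>)\<^sup>2)
          \<le> (t - s) * expectation (\<lambda>\<omega>. Y \<omega> * Z \<omega>) + B * (G * (t - s + 1)) * \<eta>) (at_right 0)"
        using eventually_at_right_less[of "0 :: real"] by eventually_elim (rule key)
    qed simp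
    then show ?thesis by (simp add: \<Delta>_def)
  qed
qed

end

end

section \<open>A Lyapunov function\<close>

text \<open>
  On \<open>[0, \<infinity>)\<close> the Lyapunov function is \<open>ln (1 + 1 / (x + e))\<close>; it is continued linearly to the
  left, which keeps it decreasing and convex with bounded derivatives.
\<close>

definition lyap :: "real \<Rightarrow> real \<Rightarrow> real" where
  "lyap e x = ln (max x 0 + e + 1) - ln (max x 0 + e) - min x 0 / (e * (e + 1))"

definition lyap' :: "real \<Rightarrow> real \<Rightarrow> real" where
  "lyap' e x = 1 / (max x 0 + e + 1) - 1 / (max x 0 + e)"

text \<open>For negative \<open>x\<close> this is the value at 0 and not the second derivative 0 of
  the linear continuation. The larger value is harmless in an upper Taylor bound, and like
  \<open>lyap'\<close> it depends only on \<open>max x 0\<close>, the argument that enters the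
  truncated coefficients.\<close>

definition lyap'' :: "real \<Rightarrow> real \<Rightarrow> real" where
  "lyap'' e x = 1 / (max x 0 + e)\<^sup>2 - 1 / (max x 0 + e + 1)\<^sup>2"

lemma lyap_measurable [measurable]:
  "lyap' e \<in> borel_measurable borel" "lyap'' e \<in> borel_measurable borel"
  unfolding lyap'_def[abs_def] lyap''_def[abs_def] by measurable

section \<open>Derivative bounds, Taylor estimate and generator bound\<close>

context
  fixes e :: real
  assumes e: "0 < e"
begin

lemma lyap'_eq: "lyap' e x = - 1 / ((max x 0 + e) * (max x 0 + e + 1))"
  using e by (simp add: lyap'_def field_simps)

lemma lyap'_bounds: "lyap' e x \<le> 0" "- (1 / e) \<le> lyap' e x"
proof -
  have "1 / (max x 0 + e + 1) \<le> 1 / (max x 0 + e)" "1 / (max x 0 + e) \<le> 1 / e"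
    using e by (auto intro!: divide_left_mono)
  moreover have "0 \<le> 1 / (max x 0 + e + 1)" using e by simp
  ultimately show "lyap' e x \<le> 0" "- (1 / e) \<le> lyap' e x" unfolding lyap'_def by linarith+
qed

lemma lyap''_bounds: "0 \<le> lyap'' e x" "lyap'' e x \<le> 1 / e\<^sup>2"
proof -
  have "1 / (max x 0 + e + 1)\<^sup>2 \<le> 1 / (max x 0 + e)\<^sup>2" "1 / (max x 0 + e)\<^sup>2 \<le> 1 / e\<^sup>2"
    using e by (auto intro!: divide_left_mono power_mono)
  moreover have "0 \<le> 1 / (max x 0 + e + 1)\<^sup>2" by simp
  ultimately show "0 \<le> lyap'' e x" "lyap'' e x \<le> 1 / e\<^sup>2" unfolding lyap''_def by linarith+
qed

lemma lyap_nonneg: "0 \<le> lyap e x"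
proof -
  have "ln (max x 0 + e) \<le> ln (max x 0 + e + 1)" using e by simp
  moreover have "min x 0 / (e * (e + 1)) \<le> 0" using e by (intro divide_nonpos_pos) auto
  ultimately show ?thesis by (simp add: lyap_def)
qed

lemma lyap_antimono:
  assumes "x \<le> y"
  shows "lyap e y \<le> lyap e x"
proof -
  have ln_diff: "ln (q + 1) - ln q \<le> ln (p + 1) - ln p" if "0 < p" "p \<le> q" for p q :: real
  proof -
    have "(q + 1) / q \<le> (p + 1) / p" using that by (simp add: field_simps)
    then have "ln ((q + 1) / q) \<le> ln ((p + 1) / p)" using that by simp
    then show ?thesis using that by (simp add: ln_div)
  qed
  have "min x 0 / (e * (e + 1)) \<le> min y 0 / (e * (e + 1))"
    using assms e by (intro divide_right_mono) auto
  moreover have "ln (max y 0 + e + 1) - ln (max y 0 + e) \<le> ln (max x 0 + e + 1) - ln (max x 0 + e)"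
    using assms e by (intro ln_diff) auto
  ultimately show ?thesis unfolding lyap_def by linarith
qed

lemma lyap_Taylor_pos:
  assumes "0 \<le> x" "0 \<le> z"
  shows "lyap e z \<le> lyap e x + lyap' e x * (z - x) + lyap'' e x / 2 * (z - x)\<^sup>2 + \<bar>z - x\<bar> ^ 3 / e ^ 3"
proof (cases "x = z")
  case False
  define d where "d m u = (if m = 0 then ln (u + e + 1) - ln (u + e) else if m = 1 then 1 / (u + e + 1) - 1 / (u + e)
    else if m = 2 then 1 / (u + e)\<^sup>2 - 1 / (u + e + 1)\<^sup>2 else 2 / (u + e + 1) ^ 3 - 2 / (u + e) ^ 3)"
    for m :: nat and u :: real
  have deriv: "\<forall>m u. m < 3 \<and> 0 \<le> u \<and> u \<le> max x z \<longrightarrow> DERIV (d m) u :> d (Suc m) u"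
  proof (intro allI impI)
    fix m :: nat and u assume *: "m < 3 \<and> 0 \<le> u \<and> u \<le> max x z"
    then have u: "0 < u + e" "0 < u + e + 1" "u + e \<noteq> 0" "u + e + 1 \<noteq> 0" using e by auto
    have inverse_square: "((\<lambda>u. 1 / (u + c)\<^sup>2) has_real_derivative - (2 / (u + c) ^ 3)) (at u)" if "u + c \<noteq> 0" for c
      using that by (auto intro!: derivative_eq_intros simp: power2_eq_square power3_eq_cube divide_simps)
    consider "m = 0" | "m = 1" | "m = 2" using * by linarith
    then show "DERIV (d m) u :> d (Suc m) u"
    proof cases
      case 1
      then show ?thesis unfolding d_def using u by (auto intro!: derivative_eq_intros simp: field_simps)
    next
      case 2
      then show ?thesis unfolding d_def using u
        by (auto intro!: derivative_eq_intros simp: power2_eq_square)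
    next
      case 3
      then show ?thesis
        using DERIV_diff[OF inverse_square[of e] inverse_square[of "e + 1"]] u by (simp add: d_def[abs_def] add.assoc)
    qed
  qed
  obtain u where u: "if z < x then z < u \<and> u < x else x < u \<and> u < z"
    and eq: "d 0 z = (\<Sum>m<3. d m x / fact m * (z - x) ^ m) + d 3 u / fact 3 * (z - x) ^ 3"
    using Taylor[OF _ refl deriv, of x z] assms False by auto
  have u0: "0 < u" using u assms by (auto split: if_splits)
  have "\<bar>d 3 u\<bar> \<le> 2 / e ^ 3"
  proof -
    have "2 / (u + e + 1) ^ 3 \<le> 2 / (u + e) ^ 3" "2 / (u + e) ^ 3 \<le> 2 / e ^ 3" "0 \<le> 2 / (u + e + 1) ^ 3"
      using e u0 by (auto intro!: divide_left_mono power_mono)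
    moreover have "d 3 u = 2 / (u + e + 1) ^ 3 - 2 / (u + e) ^ 3" by (simp add: d_def)
    ultimately show ?thesis by linarith
  qed
  have "d 3 u / fact 3 * (z - x) ^ 3 \<le> \<bar>d 3 u / fact 3 * (z - x) ^ 3\<bar>" by (rule abs_ge_self)
  also have "\<dots> = \<bar>d 3 u\<bar> / 6 * \<bar>z - x\<bar> ^ 3" by (simp add: abs_mult power_abs fact_numeral)
  \<comment> \<open>The third derivative is bounded by \<open>2 / e ^ 3\<close>; the cruder
    numerator 6 absorbs the factorial.\<close>
  also have "\<dots> \<le> (6 / e ^ 3) / 6 * \<bar>z - x\<bar> ^ 3"
  proof (intro mult_right_mono divide_right_mono)
    have "2 / e ^ 3 \<le> 6 / e ^ 3" using e by (intro divide_right_mono) auto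
    then show "\<bar>d 3 u\<bar> \<le> 6 / e ^ 3" using \<open>\<bar>d 3 u\<bar> \<le> 2 / e ^ 3\<close> by linarith
  qed auto
  finally have "d 0 z \<le> d 0 x + d 1 x * (z - x) + d 2 x / 2 * (z - x)\<^sup>2 + \<bar>z - x\<bar> ^ 3 / e ^ 3"
    unfolding eq by (simp add: eval_nat_numeral)
  then show ?thesis using assms by (simp add: d_def lyap_def lyap'_def lyap''_def max_absorb1)
qed simp

text \<open>Needed when a step crosses 0 downwards: the linear continuation has slope
  \<open>lyap' e 0\<close>, whereas the Taylor bound uses the slope at the starting point
  \<open>x\<close>.\<close>

lemma lyap'_mean_value:
  assumes "0 \<le> x"
  shows "lyap' e x - lyap' e 0 \<le> lyap'' e x * x + x\<^sup>2 / e ^ 3"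
proof (cases "x = 0")
  case False
  define p q where "p = x + e" and "q = x + e + 1"
  have pos: "0 < p" "0 < q" "e \<le> p" "x = p - e" "q = p + 1" using assms e by (auto simp: p_def q_def)
  \<comment> \<open>The exact first-order remainder of the reciprocal at \<open>s\<close>. It is
    bounded above for the pair \<open>e\<close>, \<open>x + e\<close> and only its sign is used for
    the pair shifted by 1, since that one enters with a minus sign.\<close>
  have remainder: "1 / r - 1 / s - (s - r) / s\<^sup>2 = (s - r)\<^sup>2 / (r * s\<^sup>2)" if "0 < r" "0 < s" for r s :: real
    using that by (simp add: field_simps power2_eq_square)
  have "1 / e - 1 / p - x / p\<^sup>2 = x\<^sup>2 / (e * p\<^sup>2)"
    using remainder[of e p] pos e by simp
  also have "\<dots> \<le> x\<^sup>2 / (e * e\<^sup>2)"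
    using pos e by (intro divide_left_mono mult_left_mono power_mono) auto
  also have "\<dots> = x\<^sup>2 / e ^ 3" by (simp add: power3_eq_cube power2_eq_square)
  finally have A: "1 / e - 1 / p - x / p\<^sup>2 \<le> x\<^sup>2 / e ^ 3" .
  have "1 / (e + 1) - 1 / q - x / q\<^sup>2 = x\<^sup>2 / ((e + 1) * q\<^sup>2)"
    using remainder[of "e + 1" q] pos e by simp
  also have "0 \<le> \<dots>" using e by simp
  finally have B: "0 \<le> 1 / (e + 1) - 1 / q - x / q\<^sup>2" .
  have "lyap' e x - lyap' e 0 = (1 / e - 1 / p) - (1 / (e + 1) - 1 / q)" "lyap'' e x * x = x / p\<^sup>2 - x / q\<^sup>2"
    using assms by (auto simp: lyap'_def lyap''_def p_def q_def left_diff_distrib)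
  then show ?thesis using A B by linarith
qed simp

text \<open>The second derivative jumps at 0, so crossings are split there. Downwards, Taylor is
  applied from \<open>x\<close> to 0 and the linear piece is added, the discrepancy of slopes being
  absorbed into the quadratic and cubic terms. Upwards, the linear piece comes first and distances
  from 0 are enlarged to distances from \<open>x\<close>.\<close>

lemma lyap_Taylor:
  "lyap e z \<le> lyap e x + lyap' e x * (z - x) + lyap'' e x / 2 * (z - x)\<^sup>2 + \<bar>z - x\<bar> ^ 3 / e ^ 3"
proof -
  have neg: "lyap e y = lyap e 0 + lyap' e 0 * y" if "y \<le> 0" for y
    using that e by (simp add: lyap_def lyap'_def min_absorb1 max_absorb2 field_simps)
  have deriv_neg: "lyap' e y = lyap' e 0" "lyap'' e y = lyap'' e 0" if "y \<le> 0" for y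
    using that by (simp_all add: lyap'_def lyap''_def max_absorb2)
  consider "0 \<le> x" "0 \<le> z" | "x \<le> 0" "z \<le> 0" | "0 < x" "z < 0" | "x < 0" "0 < z" by linarith
  then show ?thesis
  proof cases
    case 1
    then show ?thesis by (rule lyap_Taylor_pos)
  next
    case 2
    have "0 \<le> lyap'' e x / 2 * (z - x)\<^sup>2 + \<bar>z - x\<bar> ^ 3 / e ^ 3"
      using lyap''_bounds(1)[of x] e by simp
    moreover have "lyap e z = lyap e x + lyap' e x * (z - x)"
      using neg[of x] neg[of z] deriv_neg[of x] 2 by (simp add: algebra_simps)
    ultimately show ?thesis by linarith
  next
    case 3
    define y where "y = - z"
    have y: "0 < y" "z = - y" using 3 by (auto simp: y_def)
    have *: "lyap e 0 \<le> lyap e x - lyap' e x * x + lyap'' e x / 2 * x\<^sup>2 + x ^ 3 / e ^ 3"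
      using lyap_Taylor_pos[of x 0] 3 by simp
    have "(lyap' e x - lyap' e 0) * y \<le> (lyap'' e x * x + x\<^sup>2 / e ^ 3) * y"
      using lyap'_mean_value[of x] 3 y by (intro mult_right_mono) auto
    moreover have "lyap'' e x / 2 * x\<^sup>2 + lyap'' e x * x * y \<le> lyap'' e x / 2 * (x + y)\<^sup>2"
      using lyap''_bounds(1)[of x] by (simp add: power2_sum algebra_simps)
    moreover have "x ^ 3 / e ^ 3 + x\<^sup>2 / e ^ 3 * y \<le> (x + y) ^ 3 / e ^ 3"
    proof -
      have "(x + y) ^ 3 = x ^ 3 + x\<^sup>2 * y + (2 * x\<^sup>2 * y + 3 * x * y\<^sup>2 + y ^ 3)"
        by (simp add: power2_eq_square power3_eq_cube algebra_simps)
      then have "x ^ 3 + x\<^sup>2 * y \<le> (x + y) ^ 3" using 3 y by simp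
      then have "(x ^ 3 + x\<^sup>2 * y) / e ^ 3 \<le> (x + y) ^ 3 / e ^ 3" using e by (intro divide_right_mono) auto
      then show ?thesis by (simp add: add_divide_distrib)
    qed
    moreover have "lyap e z = lyap e 0 - lyap' e 0 * y" using neg[of z] y by simp
    moreover have "\<bar>z - x\<bar> = x + y" "(z - x)\<^sup>2 = (x + y)\<^sup>2" using 3 y by (auto simp: power2_eq_square algebra_simps)
    moreover have "lyap' e x * (z - x) = - lyap' e x * x - lyap' e x * y" using y by (simp add: algebra_simps)
    ultimately show ?thesis using * by (simp add: algebra_simps)
  next
    case 4
    have "lyap e z \<le> lyap e 0 + lyap' e 0 * z + lyap'' e 0 / 2 * z\<^sup>2 + z ^ 3 / e ^ 3"
      using lyap_Taylor_pos[of 0 z] 4 by simp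
    also have "\<dots> \<le> lyap e 0 + lyap' e 0 * z + lyap'' e 0 / 2 * (z - x)\<^sup>2 + (z - x) ^ 3 / e ^ 3"
      using 4 e lyap''_bounds(1)[of 0]
      by (intro add_mono[OF add_mono[OF order.refl]] mult_left_mono divide_right_mono power_mono) auto
    also have "\<dots> = lyap e x + lyap' e x * (z - x) + lyap'' e x / 2 * (z - x)\<^sup>2 + \<bar>z - x\<bar> ^ 3 / e ^ 3"
      using neg[of x] deriv_neg[of x] 4 by (simp add: algebra_simps)
    finally show ?thesis .
  qed
qed

text \<open>
  The Feller condition \<open>\<sigma>\<^sup>2 \<le> 2 b\<close> makes the leading singularities of order \<open>1 / x\<close> of the drift and
  diffusion terms cancel.
\<close>

lemma lyap_generator_le:
  assumes "\<sigma>\<^sup>2 \<le> 2 * b" "0 < b" "0 < C"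
  shows "lyap' e x * (b - min (max x 0) C) + lyap'' e x / 2 * (\<sigma>\<^sup>2 * min (max x 0) C) \<le> 1 + b"
proof -
  define y c where "y = max x 0 + e" and "c = min (max x 0) C"
  have y: "0 < y" "0 \<le> c" "c \<le> y" using e assms by (auto simp: y_def c_def)
  have l': "lyap' e x = - 1 / (y * (y + 1))" by (simp add: lyap'_eq y_def)
  have l'': "lyap'' e x = (2 * y + 1) / (y * (y + 1))\<^sup>2"
  proof -
    have "1 / y\<^sup>2 - 1 / (y + 1)\<^sup>2 = (2 * y + 1) / (y * (y + 1))\<^sup>2"
      using y(1) by (simp add: power_mult_distrib diff_frac_eq) (simp add: power2_eq_square algebra_simps)
    then show ?thesis by (simp add: lyap''_def y_def)
  qed
  \<comment> \<open>The Feller condition enters here.\<close>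
  have "lyap'' e x / 2 * (\<sigma>\<^sup>2 * c) \<le> lyap'' e x / 2 * (2 * b * y)"
    using y assms lyap''_bounds(1)[of x] by (intro mult_left_mono mult_mono) auto
  also have "\<dots> = b * (2 * y + 1) / (y * (y + 1)\<^sup>2)"
    unfolding l'' power_mult_distrib using y(1) by (simp add: power2_eq_square[of y])
  finally have diffusion: "lyap'' e x / 2 * (\<sigma>\<^sup>2 * c) \<le> b * (2 * y + 1) / (y * (y + 1)\<^sup>2)" .
  have "lyap' e x * (b - c) + lyap'' e x / 2 * (\<sigma>\<^sup>2 * c)
    \<le> (c - b) / (y * (y + 1)) + b * (2 * y + 1) / (y * (y + 1)\<^sup>2)"
  proof -
    have "- 1 / q * (b - c) = (c - b) / q" for q :: real by (cases "q = 0") (simp_all add: field_simps)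
    then show ?thesis using diffusion unfolding l' by (simp only: add_left_mono)
  qed
  also have "\<dots> \<le> y / (y * (y + 1)) - b / (y * (y + 1)) + b * (2 * y + 1) / (y * (y + 1)\<^sup>2)"
  proof -
    have "c / (y * (y + 1)) \<le> y / (y * (y + 1))" using y by (intro divide_right_mono) auto
    then show ?thesis by (simp add: diff_divide_distrib)
  qed
  \<comment> \<open>Over the common denominator the two terms with \<open>b\<close> have numerator
    \<open>b * (2 * y + 1) - b * (y + 1) = b * y\<close>, which removes the factor
    \<open>1 / y\<close>.\<close>
  also have "\<dots> = 1 / (y + 1) + b / (y + 1)\<^sup>2"
    using y(1) by (simp add: power2_eq_square divide_simps) (simp add: algebra_simps)
  also have "\<dots> \<le> 1 + b"
  proof (intro add_mono)
    show "1 / (y + 1) \<le> 1" using y by simp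
    have "b / (y + 1)\<^sup>2 \<le> b / 1" using y assms by (intro divide_left_mono) (auto simp: one_le_power)
    then show "b / (y + 1)\<^sup>2 \<le> b" by simp
  qed
  finally show ?thesis by (simp add: c_def)
qed

text \<open>A deterministic estimate for one grid step: \<open>D\<close> is the increment of the
  stochastic integral, \<open>m\<close> the drift frozen at the left end, \<open>o'\<close> the
  oscillation of the truncated state. Since \<open>D\<close> is typically of size \<open>w\<close>,
  each term of the last factor has order \<open>w ^ 3\<close>, hence is negligible against
  \<open>h\<close>. Its coefficient collects the derivative bounds \<open>1 / e\<^sup>2\<close> and
  \<open>1 / e ^ 3\<close> with the powers of \<open>N\<close> produced by expanding the square and
  the cube of the step.\<close>

lemma lyap_step:
  assumes w: "0 < w" "w \<le> 1" and h: "h = w\<^sup>2"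
    and z: "x + D + h * (m - o') \<le> z"
    and m: "\<bar>m\<bar> + o' \<le> N" and o': "0 \<le> o'"
  shows "lyap e z - lyap e x \<le> lyap' e x * D + lyap'' e x / 2 * D\<^sup>2 + h * (lyap' e x * m) + h * o' / e
    + (N / e\<^sup>2 + N\<^sup>2 / e\<^sup>2 + 4 / e ^ 3 + 4 * N ^ 3 / e ^ 3) * (w * D\<^sup>2 + D ^ 4 / w + h * w)"
proof -
  define d where "d = D + h * (m - o')"
  have N: "0 \<le> N" using m o' by linarith
  have h0: "0 < h" "h \<le> 1" using w by (auto simp: h power_le_one)
  have a: "\<bar>h * (m - o')\<bar> \<le> h * N"
    using m o' h0 by (simp add: abs_mult)
  define R where "R = w * D\<^sup>2 + D ^ 4 / w + h * w"
  have "0 \<le> w * D\<^sup>2" "0 \<le> D ^ 4 / w" "0 \<le> h * w" using w h0 by auto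
  then have R: "0 \<le> R" "h * w \<le> R" "h * w + w * D\<^sup>2 \<le> R" "w * D\<^sup>2 + D ^ 4 / w \<le> R"
    by (auto simp: R_def)
  \<comment> \<open>Here and for the cube,
    \<open>2 * w * \<bar>D\<bar> \<le> w\<^sup>2 + D\<^sup>2\<close> trades odd powers of
    \<open>\<bar>D\<bar>\<close> for the second and fourth powers, whose expectations are
    controlled.\<close>
  have Dh: "h * \<bar>D\<bar> \<le> R / 2"
  proof -
    have "2 * (w * \<bar>D\<bar>) \<le> w\<^sup>2 + D\<^sup>2" using sum_squares_bound[of w "\<bar>D\<bar>"] by simp
    then have "w * (2 * (w * \<bar>D\<bar>)) \<le> w * (w\<^sup>2 + D\<^sup>2)" using w by (intro mult_left_mono) auto
    then have "2 * (h * \<bar>D\<bar>) \<le> h * w + w * D\<^sup>2" by (simp add: h power2_eq_square algebra_simps)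
    then show ?thesis using R by linarith
  qed
  have D3: "\<bar>D\<bar> ^ 3 \<le> R / 2"
  proof -
    have "2 * (w * \<bar>D\<bar>) \<le> w\<^sup>2 + D\<^sup>2" using sum_squares_bound[of w "\<bar>D\<bar>"] by simp
    then have "D\<^sup>2 / w * (2 * (w * \<bar>D\<bar>)) \<le> D\<^sup>2 / w * (w\<^sup>2 + D\<^sup>2)" using w by (intro mult_left_mono) auto
    moreover have "D\<^sup>2 / w * (2 * (w * \<bar>D\<bar>)) = 2 * \<bar>D\<bar> ^ 3"
      using w by (simp add: power3_eq_cube power2_eq_square abs_mult_self_eq mult.assoc[symmetric])
    moreover have "D\<^sup>2 / w * (w\<^sup>2 + D\<^sup>2) = w * D\<^sup>2 + D ^ 4 / w"
      using w by (simp add: power2_eq_square power4_eq_xxxx field_simps)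
    ultimately show ?thesis using R by linarith
  qed
  have hw: "h\<^sup>2 \<le> h * w" "h ^ 3 \<le> h * w"
  proof -
    have "h \<le> w" using w by (simp add: h power2_eq_square mult_left_le)
    then show "h\<^sup>2 \<le> h * w" using h0 by (simp add: power2_eq_square mult_left_mono)
    moreover have "h ^ 3 \<le> h\<^sup>2" using h0 by (intro power_decreasing) auto
    ultimately show "h ^ 3 \<le> h * w" by linarith
  qed
  have d2: "d\<^sup>2 \<le> D\<^sup>2 + N * R + N\<^sup>2 * R"
  proof -
    have "d\<^sup>2 = D\<^sup>2 + 2 * (D * (h * (m - o'))) + (h * (m - o'))\<^sup>2" by (simp add: d_def power2_sum)
    moreover have "D * (h * (m - o')) \<le> \<bar>D\<bar> * (h * N)"
    proof -
      have "D * (h * (m - o')) \<le> \<bar>D\<bar> * \<bar>h * (m - o')\<bar>"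
        using abs_ge_self[of "D * (h * (m - o'))"] by (simp only: abs_mult)
      also have "\<dots> \<le> \<bar>D\<bar> * (h * N)" using a by (intro mult_left_mono) auto
      finally show ?thesis .
    qed
    moreover have "\<bar>D\<bar> * (h * N) \<le> N * (R / 2)"
      using mult_left_mono[OF Dh N] by (simp add: algebra_simps)
    moreover have "(h * (m - o'))\<^sup>2 \<le> (h * N)\<^sup>2" using power_mono[OF a, of 2] by simp
    moreover have "(h * N)\<^sup>2 \<le> N\<^sup>2 * R"
    proof -
      have "(h * N)\<^sup>2 = N\<^sup>2 * h\<^sup>2" by (simp add: power_mult_distrib)
      also have "\<dots> \<le> N\<^sup>2 * R" using hw R by (intro mult_left_mono) auto
      finally show ?thesis .
    qed
    ultimately show ?thesis by linarith
  qed
  have d3: "\<bar>d\<bar> ^ 3 \<le> 4 * R + 4 * (N ^ 3 * R)"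
  proof -
    have cube: "(p + q) ^ 3 \<le> 4 * (p ^ 3 + q ^ 3)" if "0 \<le> p" "0 \<le> q" for p q :: real
    proof -
      have "4 * (p ^ 3 + q ^ 3) - (p + q) ^ 3 = 3 * ((p + q) * (p - q)\<^sup>2)"
        by (simp add: power2_eq_square power3_eq_cube algebra_simps)
      moreover have "0 \<le> (p + q) * (p - q)\<^sup>2" using that by simp
      ultimately show ?thesis by linarith
    qed
    have "\<bar>d\<bar> \<le> \<bar>D\<bar> + h * N" using a by (simp add: d_def)
    then have "\<bar>d\<bar> ^ 3 \<le> (\<bar>D\<bar> + h * N) ^ 3" by (intro power_mono) auto
    also have "\<dots> \<le> 4 * (\<bar>D\<bar> ^ 3 + (h * N) ^ 3)" using h0 N by (intro cube) auto
    also have "(h * N) ^ 3 \<le> N ^ 3 * R"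
    proof -
      have "(h * N) ^ 3 = N ^ 3 * h ^ 3" by (simp add: power_mult_distrib)
      also have "\<dots> \<le> N ^ 3 * R" using hw R N by (intro mult_left_mono) auto
      finally show ?thesis .
    qed
    finally have "\<bar>d\<bar> ^ 3 \<le> 4 * (\<bar>D\<bar> ^ 3 + N ^ 3 * R)" by simp
    moreover have "4 * (a + c) \<le> 4 * R + 4 * c" if "a \<le> R / 2" for a c
      using that R(1) by (simp add: algebra_simps)
    ultimately show ?thesis using D3 by (meson order_trans)
  qed
  have "lyap e z \<le> lyap e (x + d)"
    using z by (intro lyap_antimono) (simp add: d_def)
  also have "\<dots> \<le> lyap e x + lyap' e x * d + lyap'' e x / 2 * d\<^sup>2 + \<bar>d\<bar> ^ 3 / e ^ 3"
    using lyap_Taylor[of "x + d" x] by simp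
  finally have main: "lyap e z - lyap e x \<le> lyap' e x * d + lyap'' e x / 2 * d\<^sup>2 + \<bar>d\<bar> ^ 3 / e ^ 3" by simp
  have t1: "lyap' e x * d \<le> lyap' e x * D + h * (lyap' e x * m) + h * o' / e"
  proof -
    have "- lyap' e x * (h * o') \<le> 1 / e * (h * o')"
      using lyap'_bounds[of x] h0 o' by (intro mult_right_mono) auto
    then show ?thesis by (simp add: d_def algebra_simps)
  qed
  have t2: "lyap'' e x / 2 * d\<^sup>2 \<le> lyap'' e x / 2 * D\<^sup>2 + (N / e\<^sup>2 + N\<^sup>2 / e\<^sup>2) * R"
  proof -
    have "lyap'' e x / 2 * d\<^sup>2 \<le> lyap'' e x / 2 * (D\<^sup>2 + (N + N\<^sup>2) * R)"
      using d2 lyap''_bounds(1)[of x] by (intro mult_left_mono) (auto simp: algebra_simps)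
    also have "\<dots> = lyap'' e x / 2 * D\<^sup>2 + lyap'' e x / 2 * ((N + N\<^sup>2) * R)" by (simp add: algebra_simps)
    also have "lyap'' e x / 2 * ((N + N\<^sup>2) * R) \<le> 1 / e\<^sup>2 * ((N + N\<^sup>2) * R)"
      using lyap''_bounds[of x] N R by (intro mult_right_mono) auto
    finally show ?thesis by (simp add: algebra_simps add_divide_distrib)
  qed
  have t3: "\<bar>d\<bar> ^ 3 / e ^ 3 \<le> (4 / e ^ 3 + 4 * N ^ 3 / e ^ 3) * R"
  proof -
    have "\<bar>d\<bar> ^ 3 / e ^ 3 \<le> (4 * R + 4 * (N ^ 3 * R)) / e ^ 3"
      using d3 e by (intro divide_right_mono) auto
    then show ?thesis by (simp add: add_divide_distrib algebra_simps)
  qed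
  have "(N / e\<^sup>2 + N\<^sup>2 / e\<^sup>2 + 4 / e ^ 3 + 4 * N ^ 3 / e ^ 3) * R
    = (N / e\<^sup>2 + N\<^sup>2 / e\<^sup>2) * R + (4 / e ^ 3 + 4 * N ^ 3 / e ^ 3) * R"
    by (simp only: distrib_right[symmetric] add.assoc)
  then show ?thesis using main t1 t2 t3 unfolding R_def[symmetric] by linarith
qed

end

section \<open>The truncated square-root diffusion\<close>

text \<open>Approaching from the right keeps the rational times nonnegative when \<open>s\<close> is
  0; the price is a strict upper bound on the real times in \<open>stable_imp\<close>.\<close>

lemma rational_sequence_from_right:
  obtains q :: "nat \<Rightarrow> rat" where "\<And>n. s < real_of_rat (q n)" "(\<lambda>n. real_of_rat (q n)) \<longlonglongrightarrow> s"
proof -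
  have "\<exists>q. s < real_of_rat q \<and> real_of_rat q < s + inverse (real (Suc n))" for n
    by (rule of_rat_dense) simp
  then have "\<forall>n. \<exists>q. s < real_of_rat q \<and> real_of_rat q < s + inverse (real (Suc n))" by blast
  from choice[OF this] obtain q where q: "\<And>n. s < real_of_rat (q n)" "\<And>n. real_of_rat (q n) < s + inverse (real (Suc n))"
    by blast
  have "(\<lambda>n. s + inverse (real (Suc n))) \<longlonglongrightarrow> s + 0"
    by (intro tendsto_add tendsto_const LIMSEQ_inverse_real_of_nat)
  then have "(\<lambda>n. real_of_rat (q n)) \<longlonglongrightarrow> s"
    using q by (intro tendsto_sandwich[of "\<lambda>_. s" "\<lambda>n. real_of_rat (q n)" _ "\<lambda>n. s + inverse (real (Suc n))"])
      (auto intro!: always_eventually less_imp_le)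
  then show ?thesis using q(1) that by blast
qed

text \<open>The sum telescopes up to the first index with \<open>x j \<le> e\<close>. The step that
  crosses the level is included, because its condition involves only the left end; so the sum stops
  at a value that is at least \<open>lyap e e\<close> by monotonicity. Without a crossing it ends at
  \<open>lyap e (x N)\<close>, which is nonnegative.\<close>

lemma stopped_lyap_sum:
  assumes "0 < e"
  shows "(if \<exists>j\<le>N. x j \<le> e then lyap e e else 0)
    \<le> lyap e (x 0) + (\<Sum>j<N. if \<forall>i\<le>j. e < x i then lyap e (x (Suc j)) - lyap e (x j) else 0)"
    (is "_ \<le> ?S N")
proof -
  have "((\<forall>i\<le>N. e < x i) \<longrightarrow> ?S N = lyap e (x N)) \<and> (\<not> (\<forall>i\<le>N. e < x i) \<longrightarrow> lyap e e \<le> ?S N)"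
  proof (induction N)
    case 0
    then show ?case using lyap_antimono[OF assms, of "x 0" e] by auto
  next
    case (Suc N)
    show ?case
    proof (cases "\<forall>i\<le>N. e < x i")
      case True
      then have "?S (Suc N) = lyap e (x (Suc N))" using Suc by simp
      moreover have "x (Suc N) \<le> e" if "\<not> (\<forall>i\<le>Suc N. e < x i)"
        using that True by (metis le_Suc_eq not_less)
      ultimately show ?thesis using lyap_antimono[OF assms, of "x (Suc N)" e] by auto
    next
      case False
      then have "?S (Suc N) = ?S N" "lyap e e \<le> ?S N" using Suc by auto
      then have "lyap e e \<le> ?S (Suc N)" by (simp only:)
      moreover have "\<not> (\<forall>i\<le>Suc N. e < x i)" using False by (auto intro: le_SucI)
      ultimately show ?thesis by blast
    qed
  qed
  moreover have "(\<exists>j\<le>N. x j \<le> e) \<longleftrightarrow> \<not> (\<forall>i\<le>N. e < x i)" by (meson not_less)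
  ultimately show ?thesis using lyap_nonneg[OF assms, of "x N"] by presburger
qed

section \<open>Path oscillation and one grid step of the diffusion\<close>

locale truncated_cir = wiener_filtration +
  fixes X I :: "real \<Rightarrow> 'a \<Rightarrow> real" and b \<sigma> x0 C :: real
  assumes params: "0 < b" "0 < \<sigma>" "0 < x0" "\<sigma>\<^sup>2 \<le> 2 * b" "0 < C"
    and adapted_X: "adapted F X"
    and continuous_X: "AE \<omega> in M. continuous_on {0..} (\<lambda>t. X t \<omega>)"
    and X_0: "AE \<omega> in M. X 0 \<omega> = x0"
    and drift_integrable: "AE \<omega> in M. \<forall>t\<ge>0. set_integrable lborel {0..t} (\<lambda>s. b - min (X s \<omega>) C)"
    and ito: "ito_integral M F W (\<lambda>s \<omega>. \<sigma> * sqrt (min (max (X s \<omega>) 0) C)) I"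
    and X_eq: "AE \<omega> in M. \<forall>t\<ge>0. X t \<omega> =
      x0 + set_lebesgue_integral lborel {0..t} (\<lambda>s. b - min (X s \<omega>) C) + I t \<omega>"
begin

abbreviation "trunc x \<equiv> min (max x 0) C"

lemma measurable_X: "0 \<le> s \<Longrightarrow> s \<le> t \<Longrightarrow> X s \<in> borel_measurable (F t)"
  using adapted_X measurable_F_mono unfolding adapted_def by blast

lemma measurable_X_M: "0 \<le> t \<Longrightarrow> X t \<in> borel_measurable M"
  using measurable_X measurable_F_M by blast

text \<open>The drift involves \<open>min x C\<close>, which is unbounded below, but
  \<open>min x C \<le> trunc x\<close>; replacing it by the bounded truncation can only lower the
  drift. One null set serves all \<open>s\<close>, \<open>t\<close> and \<open>r\<close>, so
  \<open>r\<close> may later be random.\<close>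

lemma X_increment_ge:
  "AE \<omega> in M. \<forall>s t r. 0 \<le> s \<and> s \<le> t \<and> (\<forall>u\<in>{s..t}. trunc (X u \<omega>) - trunc (X s \<omega>) \<le> r) \<longrightarrow>
    X s \<omega> + (I t \<omega> - I s \<omega>) + (t - s) * (b - trunc (X s \<omega>) - r) \<le> X t \<omega>"
  using drift_integrable X_eq
proof eventually_elim
  case (elim \<omega>)
  let ?\<mu> = "\<lambda>u. b - min (X u \<omega>) C"
  show ?case
  proof (intro allI impI, elim conjE)
    fix s t r assume st: "0 \<le> s" "s \<le> t" and r: "\<forall>u\<in>{s..t}. trunc (X u \<omega>) - trunc (X s \<omega>) \<le> r"
    have int: "set_integrable lborel {0..s} ?\<mu>" "set_integrable lborel {0..t} ?\<mu>"
      using elim(1) st by auto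
    then have int': "set_integrable lborel {s<..t} ?\<mu>"
      using st by (elim set_integrable_subset) auto
    have "(LINT u:{0..t}|lborel. ?\<mu> u) = (LINT u:{0..s} \<union> {s<..t}|lborel. ?\<mu> u)"
      using st by (simp add: ivl_disj_un_two_touch ivl_disj_un_two)
    also have "\<dots> = (LINT u:{0..s}|lborel. ?\<mu> u) + (LINT u:{s<..t}|lborel. ?\<mu> u)"
      using int(1) int' by (intro set_integral_Un) auto
    finally have split: "(LINT u:{0..t}|lborel. ?\<mu> u) = (LINT u:{0..s}|lborel. ?\<mu> u) + (LINT u:{s<..t}|lborel. ?\<mu> u)" .
    have "(LINT u:{s<..t}|lborel. b - trunc (X s \<omega>) - r) \<le> (LINT u:{s<..t}|lborel. ?\<mu> u)"
    proof (rule set_integral_mono)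
      show "set_integrable lborel {s<..t} (\<lambda>u. b - trunc (X s \<omega>) - r)"
        using st by (auto simp: set_integrable_def intro!: integrable_mult_left integrable_real_indicator)
      fix u assume "u \<in> {s<..t}"
      then have "trunc (X u \<omega>) - trunc (X s \<omega>) \<le> r" using r by auto
      moreover have "min (X u \<omega>) C \<le> trunc (X u \<omega>)" by auto
      ultimately show "b - trunc (X s \<omega>) - r \<le> b - min (X u \<omega>) C" by linarith
    qed (rule int')
    moreover have "(LINT u:{s<..t}|lborel. b - trunc (X s \<omega>) - r) = (t - s) * (b - trunc (X s \<omega>) - r)"
      using st by (simp add: set_lebesgue_integral_def)
    moreover have "X t \<omega> = x0 + (LINT u:{0..t}|lborel. ?\<mu> u) + I t \<omega>" "X s \<omega> = x0 + (LINT u:{0..s}|lborel. ?\<mu> u) + I s \<omega>"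
      using elim(2) st by auto
    ultimately show "X s \<omega> + (I t \<omega> - I s \<omega>) + (t - s) * (b - trunc (X s \<omega>) - r) \<le> X t \<omega>"
      using split by linarith
  qed
qed

text \<open>Only rational times are tested, so that this is an event.\<close>

definition stable :: "real \<Rightarrow> real \<Rightarrow> real \<Rightarrow> 'a set" where
  "stable T h \<delta> = {\<omega> \<in> space M. \<forall>q r. 0 \<le> real_of_rat q \<and> real_of_rat q \<le> T \<and> 0 \<le> real_of_rat r \<and> real_of_rat r \<le> T \<and>
    \<bar>real_of_rat q - real_of_rat r\<bar> \<le> h \<longrightarrow> \<bar>X (real_of_rat q) \<omega> - X (real_of_rat r) \<omega>\<bar> \<le> \<delta>}"

lemma stable_event: "stable T h \<delta> \<in> events"
  unfolding stable_def
proof (intro sets.sets_Collect_countable_All)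
  fix q r :: rat
  let ?c = "0 \<le> real_of_rat q \<and> real_of_rat q \<le> T \<and> 0 \<le> real_of_rat r \<and> real_of_rat r \<le> T \<and>
    \<bar>real_of_rat q - real_of_rat r\<bar> \<le> h"
  show "{\<omega> \<in> space M. ?c \<longrightarrow> \<bar>X (real_of_rat q) \<omega> - X (real_of_rat r) \<omega>\<bar> \<le> \<delta>} \<in> events"
  proof (cases ?c)
    \<comment> \<open>Measurability of \<open>X\<close> is available only at nonnegative times, so
      the condition on the rationals is decided first.\<close>
    case True
    then have "(\<lambda>\<omega>. \<bar>X (real_of_rat q) \<omega> - X (real_of_rat r) \<omega>\<bar>) \<in> borel_measurable M"
      by (intro borel_measurable_abs borel_measurable_diff measurable_X_M) auto
    from borel_measurable_iff_le[THEN iffD1, OF this]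
    have "{\<omega> \<in> space M. \<bar>X (real_of_rat q) \<omega> - X (real_of_rat r) \<omega>\<bar> \<le> \<delta>} \<in> events"
      by blast
    moreover have "{\<omega> \<in> space M. ?c \<longrightarrow> \<bar>X (real_of_rat q) \<omega> - X (real_of_rat r) \<omega>\<bar> \<le> \<delta>}
      = {\<omega> \<in> space M. \<bar>X (real_of_rat q) \<omega> - X (real_of_rat r) \<omega>\<bar> \<le> \<delta>}"
      using True by blast
    ultimately show ?thesis by (simp only:)
  next
    case False
    then have "{\<omega> \<in> space M. ?c \<longrightarrow> \<bar>X (real_of_rat q) \<omega> - X (real_of_rat r) \<omega>\<bar> \<le> \<delta>} = space M"
      by blast
    then show ?thesis by (simp only: sets.top)
  qed
qed

lemma stable_imp:
  assumes "\<omega> \<in> stable T h \<delta>" "continuous_on {0..} (\<lambda>t. X t \<omega>)"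
    and "0 \<le> s" "s < T" "0 \<le> u" "u < T" "\<bar>u - s\<bar> < h"
  shows "\<bar>X u \<omega> - X s \<omega>\<bar> \<le> \<delta>"
proof -
  obtain q where q: "\<And>n. s < real_of_rat (q n)" "(\<lambda>n. real_of_rat (q n)) \<longlonglongrightarrow> s"
    by (rule rational_sequence_from_right[of s]) (rule that)
  obtain r where r: "\<And>n. u < real_of_rat (r n)" "(\<lambda>n. real_of_rat (r n)) \<longlonglongrightarrow> u"
    by (rule rational_sequence_from_right[of u]) (rule that)
  have q0: "0 \<le> real_of_rat (q n)" and r0: "0 \<le> real_of_rat (r n)" for n
    using q(1)[of n] r(1)[of n] assms(3,5) by linarith+
  have lim: "(\<lambda>n. \<bar>X (real_of_rat (r n)) \<omega> - X (real_of_rat (q n)) \<omega>\<bar>) \<longlonglongrightarrow> \<bar>X u \<omega> - X s \<omega>\<bar>"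
    using q0 r0 assms(3,5)
    by (intro tendsto_rabs tendsto_diff continuous_on_tendsto_compose[OF assms(2) r(2)]
        continuous_on_tendsto_compose[OF assms(2) q(2)]) auto
  have "(\<lambda>n. \<bar>real_of_rat (r n) - real_of_rat (q n)\<bar>) \<longlonglongrightarrow> \<bar>u - s\<bar>"
    by (intro tendsto_rabs tendsto_diff q r)
  then have "eventually (\<lambda>n. \<bar>real_of_rat (r n) - real_of_rat (q n)\<bar> < h) sequentially"
    using assms(7) by (rule order_tendstoD)
  moreover have "eventually (\<lambda>n. real_of_rat (q n) < T) sequentially" using q(2) assms(4) by (rule order_tendstoD)
  moreover have "eventually (\<lambda>n. real_of_rat (r n) < T) sequentially" using r(2) assms(6) by (rule order_tendstoD)
  ultimately have "eventually (\<lambda>n. \<bar>X (real_of_rat (r n)) \<omega> - X (real_of_rat (q n)) \<omega>\<bar> \<le> \<delta>) sequentially"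
    by eventually_elim (use assms(1) q0 r0 in \<open>auto simp: stable_def\<close>)
  then show ?thesis by (intro tendsto_upperbound[OF lim]) auto
qed

text \<open>Each continuous path is uniformly continuous on \<open>[0, T]\<close>, so the indicators
  of instability eventually vanish almost surely; dominated convergence does the rest.\<close>

lemma prob_unstable:
  assumes "0 < \<delta>" "h \<longlonglongrightarrow> 0"
  shows "(\<lambda>n. prob (space M - stable T (h n) \<delta>)) \<longlonglongrightarrow> 0"
proof -
  have "AE \<omega> in M. (\<lambda>n. indicator (space M - stable T (h n) \<delta>) \<omega> :: real) \<longlonglongrightarrow> 0"
    using continuous_X AE_space
  proof eventually_elim
    case (elim \<omega>)
    have "uniformly_continuous_on {0..T} (\<lambda>t. X t \<omega>)"
      by (intro compact_uniformly_continuous continuous_on_subset[OF elim(1)]) auto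
    then obtain d where d: "0 < d" "\<And>s u. s \<in> {0..T} \<Longrightarrow> u \<in> {0..T} \<Longrightarrow> \<bar>u - s\<bar> < d \<Longrightarrow> \<bar>X u \<omega> - X s \<omega>\<bar> < \<delta>"
      using assms(1) unfolding uniformly_continuous_on_def dist_real_def by meson
    have "eventually (\<lambda>n. h n < d) sequentially" using assms(2) d(1) by (rule order_tendstoD)
    then have "eventually (\<lambda>n. indicator (space M - stable T (h n) \<delta>) \<omega> = (0 :: real)) sequentially"
    proof eventually_elim
      case (elim n)
      then have "\<omega> \<in> stable T (h n) \<delta>"
        unfolding stable_def
      proof (intro CollectI conjI allI impI)
        fix q r :: rat
        assume *: "0 \<le> real_of_rat q \<and> real_of_rat q \<le> T \<and> 0 \<le> real_of_rat r \<and> real_of_rat r \<le> T \<and>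
          \<bar>real_of_rat q - real_of_rat r\<bar> \<le> h n"
        then have "\<bar>real_of_rat q - real_of_rat r\<bar> < d" using elim by linarith
        with * d(2)[of "real_of_rat r" "real_of_rat q"]
        show "\<bar>X (real_of_rat q) \<omega> - X (real_of_rat r) \<omega>\<bar> \<le> \<delta>" by simp
      qed (rule \<open>\<omega> \<in> space M\<close>)
      then show ?case by simp
    qed
    then show ?case by (rule tendsto_eventually)
  qed
  then have "(\<lambda>n. expectation (indicator (space M - stable T (h n) \<delta>))) \<longlonglongrightarrow> expectation (\<lambda>_. 0 :: real)"
    using stable_event by (intro integral_dominated_convergence[where w = "\<lambda>_. 1"]) (auto simp: indicator_def)
  then show ?thesis using stable_event by simp
qed

text \<open>\<open>A\<close> is the event that the level has not been reached at grid times up to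
  \<open>s\<close>. A majorant \<open>Q\<close> is provided so that expectations can be taken
  without establishing integrability of \<open>lyap e (X t)\<close>. Its main part is
  \<open>w\<^sup>2 * (1 + b)\<close> from the generator bound; the rest is the oscillation error and
  the Taylor remainder.\<close>

lemma grid_step:
  fixes N :: real
  assumes e: "0 < e" and w: "0 < w" "w \<le> 1" and s: "0 \<le> s" and t: "t = s + w\<^sup>2"
    and \<delta>: "0 \<le> \<delta>" "\<delta> \<le> 1" and S: "S \<in> events"
    and S_stable: "AE \<omega> in M. \<omega> \<in> S \<longrightarrow> (\<forall>u\<in>{s..t}. \<bar>X u \<omega> - X s \<omega>\<bar> \<le> \<delta>)"
    and A: "A \<in> sets (F s)"
  defines "N \<equiv> b + 2 * C + 1"
  defines "K \<equiv> N / e\<^sup>2 + N\<^sup>2 / e\<^sup>2 + 4 / e ^ 3 + 4 * N ^ 3 / e ^ 3"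
  defines "G \<equiv> \<sigma> * sqrt C"
  obtains Q where "integrable M Q"
    "AE \<omega> in M. indicator A \<omega> * (lyap e (X t \<omega>) - lyap e (X s \<omega>)) \<le> Q \<omega>"
    "expectation Q \<le> w\<^sup>2 * (1 + b + (1 / e + \<sigma>\<^sup>2 / (2 * e\<^sup>2)) * (\<delta> + C * prob (space M - S)) + K * w * (G\<^sup>2 + 3 * G ^ 4 + 1))"
proof -
  let ?H = "\<lambda>s \<omega>. \<sigma> * sqrt (trunc (X s \<omega>))"
  let ?h = "w\<^sup>2"
  have h: "0 < ?h" "s \<le> t" "t - s = ?h" "0 \<le> t" using w t s by auto
  have trunc: "0 \<le> trunc x" "trunc x \<le> C" for x using params by auto
  have H: "0 \<le> ?H u \<omega>" "?H u \<omega> \<le> G" "(?H u \<omega>)\<^sup>2 = \<sigma>\<^sup>2 * trunc (X u \<omega>)" for u \<omega>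
    using params trunc[of "X u \<omega>"] by (auto simp: G_def power_mult_distrib)
  have H2: "(?H u \<omega>)\<^sup>2 \<le> G\<^sup>2" for u \<omega> using H by (intro power_mono) auto
  have H_cont: "AE \<omega> in M. continuous_on {0..} (\<lambda>u. ?H u \<omega>)"
    using continuous_X by eventually_elim (intro continuous_intros)
  define D where "D \<omega> = I t \<omega> - I s \<omega>" for \<omega>
  \<comment> \<open>Off \<open>S\<close> nothing is known about the path, but the truncated state
    stays in \<open>[0, C]\<close> and cannot oscillate by more than \<open>C\<close>.\<close>
  define osc where "osc \<omega> = \<delta> + C * indicator (space M - S) \<omega>" for \<omega>
  define m where "m \<omega> = b - trunc (X s \<omega>)" for \<omega>
  define Y1 where "Y1 \<omega> = indicator A \<omega> * lyap' e (X s \<omega>)" for \<omega>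
  define Y2 where "Y2 \<omega> = indicator A \<omega> * (lyap'' e (X s \<omega>) / 2)" for \<omega>
  note ito_props = ito_increment_moments[OF ito H(1,2) s h(2), folded D_def, unfolded h(3)]
  have X_F [measurable]: "X s \<in> borel_measurable (F s)" using measurable_X[OF s order.refl] .
  have X_M [measurable]: "X s \<in> borel_measurable M" using measurable_X_M[OF s] .
  have [measurable]: "A \<in> sets (F s)" by (rule A)
  have A_M [measurable]: "A \<in> events" using A subalgebra_F[OF s] by (auto simp: subalgebra_def)
  have S_M [measurable]: "S \<in> events" by (rule S)
  have D_M [measurable]: "D \<in> borel_measurable M"
    unfolding D_def[abs_def] by (rule ito_increment_measurable[OF ito H(1,2) s h(2)])
  have Y1: "Y1 \<in> borel_measurable (F s)" "Y1 \<in> borel_measurable M" "\<bar>Y1 \<omega>\<bar> \<le> 1 / e" for \<omega>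
    unfolding Y1_def[abs_def] using lyap'_bounds[OF e, of "X s \<omega>"] e by (measurable, measurable, auto split: split_indicator)
  have Y2: "Y2 \<in> borel_measurable (F s)" "Y2 \<in> borel_measurable M" "0 \<le> Y2 \<omega> \<and> Y2 \<omega> \<le> 1 / (2 * e\<^sup>2)" for \<omega>
    unfolding Y2_def[abs_def] using lyap''_bounds[OF e, of "X s \<omega>"] e by (measurable, measurable, auto split: split_indicator)
  have osc: "0 \<le> osc \<omega>" "osc \<omega> \<le> 1 + C" for \<omega>
    unfolding osc_def using \<delta> params by (auto split: split_indicator)
  have osc_M [measurable]: "osc \<in> borel_measurable M" unfolding osc_def[abs_def] by measurable
  have osc_int: "integrable M osc"
    using osc by (intro integrable_const_bound[of _ "1 + C"]) auto
  have osc_E: "expectation osc = \<delta> + C * prob (space M - S)"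
  proof -
    have "integrable M (indicator (space M - S) :: 'a \<Rightarrow> real)"
      by (intro integrable_real_indicator) (auto simp: emeasure_eq_measure)
    then show ?thesis unfolding osc_def by (simp add: prob_space)
  qed
  have osc_AE: "AE \<omega> in M. \<forall>u\<in>{s..t}. \<bar>trunc (X u \<omega>) - trunc (X s \<omega>)\<bar> \<le> osc \<omega>"
    using S_stable AE_space
  proof eventually_elim
    case (elim \<omega>)
    show ?case
    proof
      fix u assume u: "u \<in> {s..t}"
      have lip: "\<bar>trunc x - trunc y\<bar> \<le> \<bar>x - y\<bar>" for x y
      proof -
        have "\<bar>trunc x - trunc y\<bar> \<le> \<bar>max x 0 - max y 0\<bar>" by (simp add: min_def)
        also have "\<dots> \<le> \<bar>x - y\<bar>" by (simp add: max_def)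
        finally show ?thesis .
      qed
      show "\<bar>trunc (X u \<omega>) - trunc (X s \<omega>)\<bar> \<le> osc \<omega>"
      proof (cases "\<omega> \<in> S")
        case True
        then have "osc \<omega> = \<delta>" "\<bar>X u \<omega> - X s \<omega>\<bar> \<le> \<delta>" using elim(1) u by (simp_all add: osc_def)
        then show ?thesis using lip[of "X u \<omega>" "X s \<omega>"] by (metis order_trans)
      next
        case False
        then have "osc \<omega> = \<delta> + C" using elim(2) by (simp add: osc_def)
        moreover have "\<bar>p - q\<bar> \<le> C" if "0 \<le> p" "p \<le> C" "0 \<le> q" "q \<le> C" for p q
          using that by linarith
        from this[OF trunc trunc] have "\<bar>trunc (X u \<omega>) - trunc (X s \<omega>)\<bar> \<le> C" .
        ultimately show ?thesis using \<delta> by simp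
      qed
    qed
  qed
  have m: "\<bar>m \<omega>\<bar> + osc \<omega> \<le> N" for \<omega>
    using trunc[of "X s \<omega>"] osc[of \<omega>] params unfolding m_def N_def by linarith
  have N: "0 \<le> N" unfolding N_def using params by linarith
  have K: "0 \<le> K" unfolding K_def using N e by auto
  have D_int: "integrable M (\<lambda>\<omega>. D \<omega> ^ k)" if "k \<le> 4" for k
    by (rule integrable_power_4[OF D_M _ that]) (rule ito_props(1))
  have D2: "expectation (\<lambda>\<omega>. (D \<omega>)\<^sup>2) \<le> ?h * G\<^sup>2"
    using ito_props(4)[of "\<lambda>_. 1" 1 "\<lambda>_. G\<^sup>2" "G\<^sup>2"] H2 H_cont by (simp add: prob_space)
  have D4: "expectation (\<lambda>\<omega>. D \<omega> ^ 4) \<le> 3 * G ^ 4 * ?h\<^sup>2"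
    by (rule ito_props(2))
  have Y1D: "expectation (\<lambda>\<omega>. Y1 \<omega> * D \<omega>) = 0"
    by (rule ito_props(3)[OF Y1(1,3)])
  \<comment> \<open>Almost surely dominates the squared diffusion coefficient over the whole
    cell.\<close>
  define Z where "Z \<omega> = \<sigma>\<^sup>2 * (trunc (X s \<omega>) + osc \<omega>)" for \<omega>
  have Z_M [measurable]: "Z \<in> borel_measurable M" unfolding Z_def[abs_def] by measurable
  have Z_bound: "\<bar>Z \<omega>\<bar> \<le> \<sigma>\<^sup>2 * (1 + 2 * C)" for \<omega>
    using trunc[of "X s \<omega>"] osc[of \<omega>] unfolding Z_def abs_mult by (intro mult_mono) auto
  have Y2D: "expectation (\<lambda>\<omega>. Y2 \<omega> * (D \<omega>)\<^sup>2) \<le> ?h * expectation (\<lambda>\<omega>. Y2 \<omega> * Z \<omega>)"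
  proof (rule ito_props(4)[OF Y2(1,3) Z_M Z_bound _ H_cont])
    show "AE \<omega> in M. \<forall>u\<in>{s..t}. (?H u \<omega>)\<^sup>2 \<le> Z \<omega>"
      using osc_AE
    proof eventually_elim
      case (elim \<omega>)
      show ?case
      proof
        fix u assume "u \<in> {s..t}"
        then have "trunc (X u \<omega>) \<le> trunc (X s \<omega>) + osc \<omega>" using elim by fastforce
        then show "(?H u \<omega>)\<^sup>2 \<le> Z \<omega>" unfolding H(3) Z_def by (intro mult_left_mono) auto
      qed
    qed
  qed
  define R where "R \<omega> = w * (D \<omega>)\<^sup>2 + D \<omega> ^ 4 / w + ?h * w" for \<omega>
  have R_int: "integrable M R"
    unfolding R_def[abs_def] using D_int[of 2] D_int[of 4] by simp
  have R0: "0 \<le> R \<omega>" for \<omega> unfolding R_def using w by simp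
  have R_E: "expectation R \<le> ?h * (w * (G\<^sup>2 + 3 * G ^ 4 + 1))"
  proof -
    have "expectation R = w * expectation (\<lambda>\<omega>. (D \<omega>)\<^sup>2) + expectation (\<lambda>\<omega>. D \<omega> ^ 4) / w + ?h * w"
      unfolding R_def[abs_def] using D_int[of 2] D_int[of 4] by (simp add: prob_space)
    also have "\<dots> \<le> w * (?h * G\<^sup>2) + 3 * G ^ 4 * ?h\<^sup>2 / w + ?h * w"
      using D2 D4 w by (intro add_mono mult_left_mono divide_right_mono) auto
    also have "\<dots> = ?h * (w * (G\<^sup>2 + 3 * G ^ 4 + 1))"
      using w by (simp add: power2_eq_square field_simps)
    finally show ?thesis .
  qed
  \<comment> \<open>The right-hand side of \<open>lyap_step\<close>, with \<open>indicator A\<close>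
    attached to the terms of indefinite sign and to the diffusion term; the error terms are
    nonnegative and are kept off \<open>A\<close> as well.\<close>
  define Q where "Q \<omega> = Y1 \<omega> * D \<omega> + Y2 \<omega> * (D \<omega>)\<^sup>2 + ?h * (Y1 \<omega> * m \<omega>) + ?h / e * osc \<omega> + K * R \<omega>" for \<omega>
  have m_M [measurable]: "m \<in> borel_measurable M" unfolding m_def[abs_def] by measurable
  have m_int: "integrable M m"
  proof (rule integrable_const_bound[of _ N])
    show "AE \<omega> in M. norm (m \<omega>) \<le> N" using m osc(1) by (intro AE_I2) (smt (verit) real_norm_def)
  qed measurable
  have ints: "integrable M (\<lambda>\<omega>. Y1 \<omega> * D \<omega>)" "integrable M (\<lambda>\<omega>. Y2 \<omega> * (D \<omega>)\<^sup>2)" "integrable M (\<lambda>\<omega>. Y1 \<omega> * m \<omega>)"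
    "integrable M (\<lambda>\<omega>. Y2 \<omega> * Z \<omega>)"
  proof -
    have Y2': "\<bar>Y2 \<omega>\<bar> \<le> 1 / (2 * e\<^sup>2)" for \<omega> using Y2(3)[of \<omega>] by simp
    show "integrable M (\<lambda>\<omega>. Y1 \<omega> * D \<omega>)" using D_int[of 1] by (intro integrable_bounded_mult[OF _ Y1(2,3)]) auto
    show "integrable M (\<lambda>\<omega>. Y2 \<omega> * (D \<omega>)\<^sup>2)" using D_int[of 2] by (intro integrable_bounded_mult[OF _ Y2(2) Y2']) auto
    show "integrable M (\<lambda>\<omega>. Y1 \<omega> * m \<omega>)" by (rule integrable_bounded_mult[OF m_int Y1(2,3)])
    have "integrable M Z" by (rule integrable_const_bound[of _ "\<sigma>\<^sup>2 * (1 + 2 * C)"]) (use Z_bound in auto)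
    then show "integrable M (\<lambda>\<omega>. Y2 \<omega> * Z \<omega>)" by (rule integrable_bounded_mult[OF _ Y2(2) Y2'])
  qed
  show ?thesis
  proof (rule that)
    show "integrable M Q"
      unfolding Q_def[abs_def] using ints osc_int R_int by simp
    show "AE \<omega> in M. indicator A \<omega> * (lyap e (X t \<omega>) - lyap e (X s \<omega>)) \<le> Q \<omega>"
      using X_increment_ge osc_AE
    proof eventually_elim
      case (elim \<omega>)
      have "\<forall>u\<in>{s..t}. trunc (X u \<omega>) - trunc (X s \<omega>) \<le> osc \<omega>" using elim(2) by fastforce
      then have "X s \<omega> + (I t \<omega> - I s \<omega>) + (t - s) * (b - trunc (X s \<omega>) - osc \<omega>) \<le> X t \<omega>"
        using elim(1) s h(2) by blast
      then have "X s \<omega> + D \<omega> + ?h * (m \<omega> - osc \<omega>) \<le> X t \<omega>"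
        unfolding h(3) by (simp add: D_def m_def)
      from lyap_step[OF e w refl this m osc(1), folded K_def]
      have step: "lyap e (X t \<omega>) - lyap e (X s \<omega>) \<le> lyap' e (X s \<omega>) * D \<omega> + lyap'' e (X s \<omega>) / 2 * (D \<omega>)\<^sup>2
        + ?h * (lyap' e (X s \<omega>) * m \<omega>) + ?h * osc \<omega> / e + K * R \<omega>"
        by (simp add: R_def)
      show ?case
      proof (cases "\<omega> \<in> A")
        case True
        then show ?thesis using step by (simp add: Q_def Y1_def Y2_def)
      next
        case False
        then show ?thesis using osc(1)[of \<omega>] K R0[of \<omega>] e h by (simp add: Q_def Y1_def Y2_def)
      qed
    qed
    have "expectation Q = expectation (\<lambda>\<omega>. Y2 \<omega> * (D \<omega>)\<^sup>2) + ?h * expectation (\<lambda>\<omega>. Y1 \<omega> * m \<omega>)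
      + ?h / e * expectation osc + K * expectation R"
      unfolding Q_def[abs_def] using ints osc_int R_int Y1D by simp
    also have "\<dots> \<le> ?h * expectation (\<lambda>\<omega>. Y2 \<omega> * Z \<omega>) + ?h * expectation (\<lambda>\<omega>. Y1 \<omega> * m \<omega>)
      + ?h / e * expectation osc + K * (?h * (w * (G\<^sup>2 + 3 * G ^ 4 + 1)))"
      using Y2D mult_left_mono[OF R_E K] by linarith
    also have "\<dots> = ?h * (expectation (\<lambda>\<omega>. Y2 \<omega> * Z \<omega> + Y1 \<omega> * m \<omega>)
      + 1 / e * expectation osc + K * w * (G\<^sup>2 + 3 * G ^ 4 + 1))"
      using ints by (simp add: algebra_simps)
    finally have Q_le: "expectation Q \<le> ?h * (expectation (\<lambda>\<omega>. Y2 \<omega> * Z \<omega> + Y1 \<omega> * m \<omega>)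
      + 1 / e * expectation osc + K * w * (G\<^sup>2 + 3 * G ^ 4 + 1))" .
    have "expectation (\<lambda>\<omega>. Y2 \<omega> * Z \<omega> + Y1 \<omega> * m \<omega>)
      \<le> expectation (\<lambda>\<omega>. 1 + b + \<sigma>\<^sup>2 / (2 * e\<^sup>2) * osc \<omega>)"
    proof (rule integral_mono)
      fix \<omega>
      let ?x = "X s \<omega>"
      have gen: "lyap' e ?x * (b - trunc ?x) + lyap'' e ?x / 2 * (\<sigma>\<^sup>2 * trunc ?x) \<le> 1 + b"
        by (rule lyap_generator_le[OF e params(4,1,5)])
      have "Y2 \<omega> * (\<sigma>\<^sup>2 * osc \<omega>) \<le> 1 / (2 * e\<^sup>2) * (\<sigma>\<^sup>2 * osc \<omega>)"
        using Y2(3)[of \<omega>] osc(1)[of \<omega>] by (intro mult_right_mono) auto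
      moreover have "Y2 \<omega> * (\<sigma>\<^sup>2 * trunc ?x) + Y1 \<omega> * m \<omega> \<le> 1 + b"
        using gen params by (cases "\<omega> \<in> A") (auto simp: Y1_def Y2_def m_def)
      ultimately show "Y2 \<omega> * Z \<omega> + Y1 \<omega> * m \<omega> \<le> 1 + b + \<sigma>\<^sup>2 / (2 * e\<^sup>2) * osc \<omega>"
        by (simp add: Z_def algebra_simps)
    qed (use ints osc_int in auto)
    also have "\<dots> = 1 + b + \<sigma>\<^sup>2 / (2 * e\<^sup>2) * expectation osc"
      using osc_int by (simp add: prob_space)
    finally have "expectation (\<lambda>\<omega>. Y2 \<omega> * Z \<omega> + Y1 \<omega> * m \<omega>) + 1 / e * expectation osc
      \<le> 1 + b + (1 / e + \<sigma>\<^sup>2 / (2 * e\<^sup>2)) * (\<delta> + C * prob (space M - S))"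
      unfolding osc_E distrib_right by linarith
    then have "?h * (expectation (\<lambda>\<omega>. Y2 \<omega> * Z \<omega> + Y1 \<omega> * m \<omega>) + 1 / e * expectation osc + K * w * (G\<^sup>2 + 3 * G ^ 4 + 1))
      \<le> ?h * (1 + b + (1 / e + \<sigma>\<^sup>2 / (2 * e\<^sup>2)) * (\<delta> + C * prob (space M - S)) + K * w * (G\<^sup>2 + 3 * G ^ 4 + 1))"
      by (intro mult_left_mono add_right_mono) auto
    with Q_le show "expectation Q \<le> ?h * (1 + b + (1 / e + \<sigma>\<^sup>2 / (2 * e\<^sup>2)) * (\<delta> + C * prob (space M - S)) + K * w * (G\<^sup>2 + 3 * G ^ 4 + 1))"
      by (rule order_trans)
  qed
qed

section \<open>Reaching a low level at grid times\<close>

definition hit :: "real \<Rightarrow> real \<Rightarrow> nat \<Rightarrow> 'a set" where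
  "hit e T N = {\<omega> \<in> space M. \<exists>j\<le>N. X (real j * T / real N) \<omega> \<le> e}"

lemma level_event:
  assumes "0 \<le> s" "s \<le> t"
  shows "{\<omega> \<in> space M. X s \<omega> \<le> e} \<in> sets (F t)" "{\<omega> \<in> space M. e < X s \<omega>} \<in> sets (F t)"
proof -
  have t: "space (F t) = space M" using assms by (intro space_F) simp
  from borel_measurable_iff_le[THEN iffD1, OF measurable_X[OF assms]]
  show "{\<omega> \<in> space M. X s \<omega> \<le> e} \<in> sets (F t)" unfolding t by blast
  from borel_measurable_iff_greater[THEN iffD1, OF measurable_X[OF assms]]
  show "{\<omega> \<in> space M. e < X s \<omega>} \<in> sets (F t)" unfolding t by blast
qed

lemma sets_F_events: "0 \<le> t \<Longrightarrow> A \<in> sets (F t) \<Longrightarrow> A \<in> events"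
  using subalgebra_F[of t] by (auto simp: subalgebra_def)

lemma hit_event: "0 \<le> T \<Longrightarrow> hit e T N \<in> events"
proof -
  assume T: "0 \<le> T"
  have "hit e T N = (\<Union>j\<in>{..N}. {\<omega> \<in> space M. X (real j * T / real N) \<omega> \<le> e})"
    by (auto simp: hit_def)
  then show ?thesis
    using sets_F_events[OF _ level_event(1)[OF _ order.refl]] T by (auto intro!: sets.finite_UN)
qed

text \<open>Each of the \<open>N\<close> cells costs at most \<open>(T / N) * (2 + b)\<close>:
  \<open>1 + b\<close> from the generator and less than 1 for all errors. How large \<open>N\<close>
  has to be depends on \<open>e\<close>, but apart from \<open>lyap e x0\<close> the bound does
  not.\<close>

lemma eventually_prob_hit_le:
  assumes e: "0 < e" and T: "0 < T"
  shows "eventually (\<lambda>N. lyap e e * prob (hit e T N) \<le> lyap e x0 + T * (2 + b)) sequentially"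
proof -
  define \<kappa> where "\<kappa> = 1 / e + \<sigma>\<^sup>2 / (2 * e\<^sup>2)"
  have \<kappa>: "0 < \<kappa>" unfolding \<kappa>_def using e params by (intro add_pos_nonneg) auto
  \<comment> \<open>Chosen so that \<open>\<kappa> * \<delta> < 1\<close>: this is the part of the
    error that does not vanish as \<open>N\<close> grows.\<close>
  define \<delta> where "\<delta> = 1 / (2 * (\<kappa> + 1))"
  have \<delta>: "0 < \<delta>" "\<delta> \<le> 1" "\<kappa> * \<delta> < 1" using \<kappa> by (auto simp: \<delta>_def field_simps)
  \<comment> \<open>The horizon \<open>T + 1\<close> and the doubled mesh leave room for the strict
    inequalities of \<open>stable_imp\<close>, since cells have width exactly \<open>T / N\<close>
    and the last one ends at \<open>T\<close>.\<close>
  define S where "S N = stable (T + 1) (2 * T / real N) \<delta>" for N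
  define w where "w N = sqrt (T / real N)" for N
  define K where "K = (b + 2 * C + 1) / e\<^sup>2 + (b + 2 * C + 1)\<^sup>2 / e\<^sup>2 + 4 / e ^ 3 + 4 * (b + 2 * C + 1) ^ 3 / e ^ 3"
  define L where "L = (\<sigma> * sqrt C)\<^sup>2 + 3 * (\<sigma> * sqrt C) ^ 4 + 1"
  define err where "err N = \<kappa> * (\<delta> + C * prob (space M - S N)) + K * w N * L" for N
  have lim_div: "(\<lambda>N. c / real N) \<longlonglongrightarrow> 0" for c :: real
    by (rule lim_const_over_n)
  have w_lim: "w \<longlonglongrightarrow> 0"
    unfolding w_def[abs_def] using tendsto_real_sqrt[OF lim_div[of T]] by simp
  have "(\<lambda>N. prob (space M - S N)) \<longlonglongrightarrow> 0"
    unfolding S_def by (intro prob_unstable \<delta> lim_div)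
  then have "err \<longlonglongrightarrow> \<kappa> * (\<delta> + C * 0) + K * 0 * L"
    unfolding err_def[abs_def] by (intro tendsto_intros w_lim)
  then have "err \<longlonglongrightarrow> \<kappa> * \<delta>" by simp
  then have "eventually (\<lambda>N. err N < 1) sequentially" using \<delta>(3) by (rule order_tendstoD)
  moreover have "eventually (\<lambda>N. w N < 1) sequentially" using w_lim zero_less_one by (rule order_tendstoD)
  moreover have "eventually (\<lambda>N. 0 < N) sequentially" by (rule eventually_gt_at_top)
  ultimately show ?thesis
  proof eventually_elim
    case (elim N)
    define t where "t j = real j * T / real N" for j :: nat
    have N: "0 < real N" using elim by simp
    have w: "0 < w N" "w N \<le> 1" "(w N)\<^sup>2 = T / real N" using elim T N by (auto simp: w_def)
    have t: "0 \<le> t j" "t (Suc j) = t j + (w N)\<^sup>2" for j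
      using T N by (auto simp: t_def w add_divide_distrib distrib_right)
    have t_le: "t i \<le> t j" if "i \<le> j" for i j
      using that T N by (auto simp: t_def intro!: divide_right_mono mult_right_mono)
    have t_T: "t j \<le> T" if "j \<le> N" for j
      using that T N by (simp add: t_def field_simps)
    define A where "A j = {\<omega> \<in> space M. \<forall>i\<le>j. e < X (t i) \<omega>}" for j
    have A: "A j \<in> sets (F (t j))" for j
    proof -
      have "A j = (\<Inter>i\<in>{..j}. {\<omega> \<in> space M. e < X (t i) \<omega>})" by (auto simp: A_def)
      then show ?thesis using level_event(2)[OF t(1) t_le] by (auto intro!: sets.finite_INT)
    qed
    have S_stable: "AE \<omega> in M. \<omega> \<in> S N \<longrightarrow> (\<forall>u\<in>{t j..t (Suc j)}. \<bar>X u \<omega> - X (t j) \<omega>\<bar> \<le> \<delta>)" if "j < N" for j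
      using continuous_X
    proof eventually_elim
      case cont: (elim \<omega>)
      show ?case
      proof (intro impI ballI)
        fix u assume \<omega>: "\<omega> \<in> S N" and u: "u \<in> {t j..t (Suc j)}"
        have h: "(w N)\<^sup>2 < 2 * T / real N" using T N w(3) by (simp add: field_simps)
        have "t (Suc j) \<le> T" "t j \<le> T" using t_T[of j] t_T[of "Suc j"] that by auto
        then have "t j < T + 1" "0 \<le> u" "u < T + 1" "\<bar>u - t j\<bar> < 2 * T / real N"
          using u t(1)[of j] t(2)[of j] h by auto
        then show "\<bar>X u \<omega> - X (t j) \<omega>\<bar> \<le> \<delta>"
          by (intro stable_imp[OF \<omega>[unfolded S_def] cont t(1)])
      qed
    qed
    have "\<forall>j\<in>{..<N}. \<exists>Q. integrable M Q \<and>
      (AE \<omega> in M. indicator (A j) \<omega> * (lyap e (X (t (Suc j)) \<omega>) - lyap e (X (t j) \<omega>)) \<le> Q \<omega>) \<and>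
      expectation Q \<le> T / real N * (2 + b)"
    proof
      fix j assume j: "j \<in> {..<N}"
      have S_event: "S N \<in> events" unfolding S_def by (rule stable_event)
      obtain Q where Q: "integrable M Q"
        "AE \<omega> in M. indicator (A j) \<omega> * (lyap e (X (t (Suc j)) \<omega>) - lyap e (X (t j) \<omega>)) \<le> Q \<omega>"
        "expectation Q \<le> (w N)\<^sup>2 * (1 + b + \<kappa> * (\<delta> + C * prob (space M - S N)) + K * w N * L)"
        using grid_step[OF e w(1,2) t less_imp_le[OF \<delta>(1)] \<delta>(2) S_event S_stable A, of j] j
        unfolding \<kappa>_def K_def L_def by blast
      have "(w N)\<^sup>2 * (1 + b + \<kappa> * (\<delta> + C * prob (space M - S N)) + K * w N * L) \<le> (w N)\<^sup>2 * (2 + b)"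
        using elim(1) by (intro mult_left_mono) (auto simp: err_def)
      with Q show "\<exists>Q. integrable M Q \<and>
        (AE \<omega> in M. indicator (A j) \<omega> * (lyap e (X (t (Suc j)) \<omega>) - lyap e (X (t j) \<omega>)) \<le> Q \<omega>) \<and>
        expectation Q \<le> T / real N * (2 + b)"
        unfolding w(3) by (intro exI[of _ Q]) auto
    qed
    from bchoice[OF this] obtain Q where Q: "\<And>j. j < N \<Longrightarrow> integrable M (Q j)"
      "\<And>j. j < N \<Longrightarrow> AE \<omega> in M. indicator (A j) \<omega> * (lyap e (X (t (Suc j)) \<omega>) - lyap e (X (t j) \<omega>)) \<le> Q j \<omega>"
      "\<And>j. j < N \<Longrightarrow> expectation (Q j) \<le> T / real N * (2 + b)"
      by auto
    have Q_AE: "AE \<omega> in M. \<forall>j\<in>{..<N}. indicator (A j) \<omega> * (lyap e (X (t (Suc j)) \<omega>) - lyap e (X (t j) \<omega>)) \<le> Q j \<omega>"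
      using Q(2) by (intro AE_finite_allI) auto
    have hit: "hit e T N \<in> events" using T by (intro hit_event) simp
    then have hit_int: "integrable M (indicator (hit e T N) :: 'a \<Rightarrow> real)"
      by (intro integrable_real_indicator) (auto simp: emeasure_eq_measure)
    have "lyap e e * prob (hit e T N) = expectation (\<lambda>\<omega>. lyap e e * indicator (hit e T N) \<omega>)"
      using hit by simp
    also have "\<dots> \<le> expectation (\<lambda>\<omega>. lyap e x0 + (\<Sum>j<N. Q j \<omega>))"
    proof (rule integral_mono_AE)
      show "integrable M (\<lambda>\<omega>. lyap e e * indicator (hit e T N) \<omega>)" using hit_int by simp
      show "integrable M (\<lambda>\<omega>. lyap e x0 + (\<Sum>j<N. Q j \<omega>))"
        using Q(1) by (intro Bochner_Integration.integrable_add integrable_const Bochner_Integration.integrable_sum) auto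
      show "AE \<omega> in M. lyap e e * indicator (hit e T N) \<omega> \<le> lyap e x0 + (\<Sum>j<N. Q j \<omega>)"
        using Q_AE X_0 AE_space
      proof eventually_elim
        case \<omega>: (elim \<omega>)
        let ?x = "\<lambda>j. X (t j) \<omega>"
        have "lyap e e * indicator (hit e T N) \<omega> = (if \<exists>j\<le>N. ?x j \<le> e then lyap e e else 0)"
          using \<omega>(3) by (simp add: hit_def t_def)
        also have "\<dots> \<le> lyap e (?x 0) + (\<Sum>j<N. if \<forall>i\<le>j. e < ?x i then lyap e (?x (Suc j)) - lyap e (?x j) else 0)"
          by (rule stopped_lyap_sum[OF e])
        also have "(\<Sum>j<N. if \<forall>i\<le>j. e < ?x i then lyap e (?x (Suc j)) - lyap e (?x j) else 0) \<le> (\<Sum>j<N. Q j \<omega>)"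
        proof (rule sum_mono)
          fix j assume "j \<in> {..<N}"
          then have "indicator (A j) \<omega> * (lyap e (?x (Suc j)) - lyap e (?x j)) \<le> Q j \<omega>" using \<omega>(1) by blast
          moreover have "indicator (A j) \<omega> * (lyap e (?x (Suc j)) - lyap e (?x j))
            = (if \<forall>i\<le>j. e < ?x i then lyap e (?x (Suc j)) - lyap e (?x j) else 0)"
            using \<omega>(3) by (auto simp: A_def indicator_def)
          ultimately show "(if \<forall>i\<le>j. e < ?x i then lyap e (?x (Suc j)) - lyap e (?x j) else 0) \<le> Q j \<omega>"
            by (simp only:)
        qed
        finally show ?case using \<omega>(2) by (simp add: t_def)
      qed
    qed
    also have "\<dots> = lyap e x0 + (\<Sum>j<N. expectation (Q j))"
    proof -
      have "integrable M (\<lambda>\<omega>. \<Sum>j<N. Q j \<omega>)" "expectation (\<lambda>\<omega>. \<Sum>j<N. Q j \<omega>) = (\<Sum>j<N. expectation (Q j))"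
        using Q(1) by (auto intro!: Bochner_Integration.integrable_sum Bochner_Integration.integral_sum)
      then show ?thesis by (simp add: prob_space)
    qed
    also have "\<dots> \<le> lyap e x0 + (\<Sum>j<N. T / real N * (2 + b))"
      using Q(3) by (intro add_left_mono sum_mono) auto
    also have "\<dots> = lyap e x0 + T * (2 + b)" using N by simp
    finally show ?case .
  qed
qed

section \<open>From the grid to continuous time\<close>

definition hits_eventually :: "real \<Rightarrow> real \<Rightarrow> 'a set" where
  "hits_eventually e T = (\<Union>k. \<Inter>N\<in>{k..}. hit e T N)"

lemma hits_eventually_event: "0 \<le> T \<Longrightarrow> hits_eventually e T \<in> events"
  unfolding hits_eventually_def using hit_event by (intro sets.countable_UN sets.countable_INT) auto

text \<open>The event is the limit inferior of the grid events. Its probability is the increasing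
  limit of those of the intersections, each contained in \<open>hit e T N\<close> for arbitrarily
  large \<open>N\<close>.\<close>

lemma prob_hits_eventually_le:
  assumes "0 < e" "0 < T"
  shows "lyap e e * prob (hits_eventually e T) \<le> lyap e x0 + T * (2 + b)"
proof -
  have events: "(\<Inter>N\<in>{k..}. hit e T N) \<in> events" for k
    using hit_event assms by (intro sets.countable_INT) auto
  have "incseq (\<lambda>k. \<Inter>N\<in>{k..}. hit e T N)"
    by (rule incseq_SucI) auto
  then have "(\<lambda>k. prob (\<Inter>N\<in>{k..}. hit e T N)) \<longlonglongrightarrow> prob (hits_eventually e T)"
    unfolding hits_eventually_def using events by (intro finite_Lim_measure_incseq) auto
  then have lim: "(\<lambda>k. lyap e e * prob (\<Inter>N\<in>{k..}. hit e T N)) \<longlonglongrightarrow> lyap e e * prob (hits_eventually e T)"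
    by (rule tendsto_mult_left)
  have "lyap e e * prob (\<Inter>N\<in>{k..}. hit e T N) \<le> lyap e x0 + T * (2 + b)" for k
  proof -
    obtain n where n: "\<And>N. n \<le> N \<Longrightarrow> lyap e e * prob (hit e T N) \<le> lyap e x0 + T * (2 + b)"
      using eventually_prob_hit_le[OF assms] unfolding eventually_sequentially by blast
    have "prob (\<Inter>N\<in>{k..}. hit e T N) \<le> prob (hit e T (max k n))"
      using hit_event assms by (intro finite_measure_mono) auto
    then have "lyap e e * prob (\<Inter>N\<in>{k..}. hit e T N) \<le> lyap e e * prob (hit e T (max k n))"
      using lyap_nonneg[OF assms(1)] by (intro mult_left_mono) auto
    then show ?thesis using n[of "max k n"] by simp
  qed
  then show ?thesis by (intro LIMSEQ_le_const2[OF lim]) auto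
qed

text \<open>The last grid point not after \<open>t\<close> tends to \<open>t\<close> as the mesh
  shrinks, so by continuity the strict inequality holds there for all large
  \<open>N\<close>.\<close>

lemma below_imp_hits_eventually:
  assumes \<omega>: "\<omega> \<in> space M" "continuous_on {0..} (\<lambda>t. X t \<omega>)" and t: "0 \<le> t" "t \<le> T" "0 < T" and X: "X t \<omega> < e"
  shows "\<omega> \<in> hits_eventually e T"
proof -
  define j where "j N = nat \<lfloor>t * real N / T\<rfloor>" for N :: nat
  have j: "real (j N) \<le> t * real N / T" "t * real N / T - 1 \<le> real (j N)" "j N \<le> N" for N
  proof -
    have "0 \<le> t * real N / T" using t by simp
    then show *: "real (j N) \<le> t * real N / T" "t * real N / T - 1 \<le> real (j N)"
      unfolding j_def by linarith+
    have "t * real N / T \<le> real N" using t by (simp add: field_simps mult_right_mono)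
    with * show "j N \<le> N" by linarith
  qed
  have "(\<lambda>N. real (j N) * T / real N) \<longlonglongrightarrow> t"
  proof (rule tendsto_sandwich)
    have "(\<lambda>N. t - T / real N) \<longlonglongrightarrow> t - 0" by (intro tendsto_diff tendsto_const lim_const_over_n)
    then show "(\<lambda>N. t - T / real N) \<longlonglongrightarrow> t" by simp
    show "eventually (\<lambda>N. t - T / real N \<le> real (j N) * T / real N) sequentially"
      using eventually_gt_at_top[of "0 :: nat"]
    proof eventually_elim
      case (elim N)
      have "(t * real N / T - 1) * (T / real N) \<le> real (j N) * (T / real N)"
        using j(2)[of N] t by (intro mult_right_mono) auto
      moreover have "(t * real N / T - 1) * (T / real N) = t - T / real N"
        using elim t by (simp add: field_simps)
      ultimately show ?case by simp
    qed
    show "eventually (\<lambda>N. real (j N) * T / real N \<le> t) sequentially"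
      using eventually_gt_at_top[of "0 :: nat"]
    proof eventually_elim
      case (elim N)
      have "real (j N) * (T / real N) \<le> t * real N / T * (T / real N)"
        using j(1)[of N] t by (intro mult_right_mono) auto
      then show ?case using elim t by simp
    qed
  qed simp
  then have "(\<lambda>N. X (real (j N) * T / real N) \<omega>) \<longlonglongrightarrow> X t \<omega>"
    using t by (intro continuous_on_tendsto_compose[OF \<omega>(2)]) auto
  then have "eventually (\<lambda>N. X (real (j N) * T / real N) \<omega> < e) sequentially"
    using X by (rule order_tendstoD)
  then obtain k where "\<And>N. k \<le> N \<Longrightarrow> X (real (j N) * T / real N) \<omega> < e"
    unfolding eventually_sequentially by blast
  then have "\<omega> \<in> hit e T N" if "k \<le> N" for N
    using that \<omega>(1) j(3)[of N] unfolding hit_def by (auto intro!: exI[of _ "j N"] less_imp_le)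
  then show ?thesis unfolding hits_eventually_def by blast
qed

lemma AE_X_positive: "AE \<omega> in M. \<forall>t\<ge>0. 0 < X t \<omega>"
proof -
  \<comment> \<open>With this level, \<open>lyap (e m) (e m)\<close> is
    \<open>ln (exp (- real m) + 1) + real m\<close>, which is at least \<open>m\<close>, while
    \<open>lyap (e m) x0\<close> stays below \<open>ln (1 + 1 / x0)\<close>.\<close>
  define e where "e m = exp (- real m) / 2" for m :: nat
  \<comment> \<open>A continuous path that is nonpositive at some time up to \<open>Suc n\<close>
    lies below every \<open>e m\<close> there, hence in \<open>U n\<close>; the successor keeps the
    horizon positive.\<close>
  define U where "U n = (\<Inter>m. hits_eventually (e m) (real (Suc n)))" for n
  have e: "0 < e m" for m by (simp add: e_def)
  have lyap_e: "real m \<le> lyap (e m) (e m)" for m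
  proof -
    have "lyap (e m) (e m) = ln (exp (- real m) + 1) - ln (exp (- real m))"
      using e[of m] by (simp add: lyap_def e_def)
    moreover have "0 \<le> ln (exp (- real m) + 1)" by simp
    ultimately show ?thesis by simp
  qed
  have lyap_x0: "lyap (e m) x0 \<le> ln (1 + 1 / x0)" for m
  proof -
    have "lyap (e m) x0 = ln ((x0 + e m + 1) / (x0 + e m))"
      using params(3) e[of m] by (simp add: lyap_def ln_div)
    also have "\<dots> \<le> ln (1 + 1 / x0)"
    proof (rule ln_mono)
      have "1 / (x0 + e m) \<le> 1 / x0" using params(3) e[of m] by (intro divide_left_mono) auto
      then show "(x0 + e m + 1) / (x0 + e m) \<le> 1 + 1 / x0"
        using params(3) e[of m] by (simp add: add_divide_distrib)
    qed (use params(3) e[of m] in auto)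
    finally show ?thesis .
  qed
  have U_null: "U n \<in> null_sets M" for n
  proof -
    let ?T = "real (Suc n)" and ?c = "ln (1 + 1 / x0) + real (Suc n) * (2 + b)"
    have U: "U n \<in> events" unfolding U_def using hits_eventually_event by (intro sets.countable_INT) auto
    have "prob (U n) \<le> ?c / real m" if m: "0 < m" for m
    proof -
      have "prob (U n) \<le> prob (hits_eventually (e m) ?T)"
        unfolding U_def using hits_eventually_event by (intro finite_measure_mono) auto
      then have "real m * prob (U n) \<le> lyap (e m) (e m) * prob (hits_eventually (e m) ?T)"
        using lyap_e lyap_nonneg[OF e] by (intro mult_mono) auto
      also have "\<dots> \<le> lyap (e m) x0 + ?T * (2 + b)" by (rule prob_hits_eventually_le[OF e]) simp
      also have "\<dots> \<le> ?c" using lyap_x0[of m] by simp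
      finally show ?thesis using m by (simp add: field_simps)
    qed
    then have "eventually (\<lambda>m. prob (U n) \<le> ?c / real m) sequentially"
      by (intro eventually_mono[OF eventually_gt_at_top[of 0]])
    then have "prob (U n) \<le> 0"
      using lim_const_over_n[of ?c] by (intro tendsto_lowerbound) auto
    then show ?thesis using U measure_nonneg[of M "U n"] by (simp add: null_sets_def emeasure_eq_measure)
  qed
  then have "AE \<omega> in M. \<forall>n. \<omega> \<notin> U n"
    by (auto simp: AE_all_countable intro: AE_not_in)
  then show ?thesis
    using continuous_X AE_space
  proof eventually_elim
    case (elim \<omega>)
    show ?case
    proof (intro allI impI, rule ccontr)
      fix t :: real assume t: "0 \<le> t" and "\<not> 0 < X t \<omega>"
      then have "X t \<omega> < e m" for m using e[of m] by simp
      moreover obtain n where "t \<le> real n" using real_arch_simple by blast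
      ultimately have "\<omega> \<in> hits_eventually (e m) (real (Suc n))" for m
        using elim t by (intro below_imp_hits_eventually) auto
      then show False using elim(1) by (auto simp: U_def)
    qed
  qed
qed

end

section \<open>Application to strong solutions\<close>

lemma (in complete_filtered_prob_space) adapted_augmented_imp_adapted:
  assumes "wiener_process M F W" "adapted (augmented_natural_filtration M W) X"
  shows "adapted F X"
  unfolding adapted_def
proof (intro allI impI)
  fix t :: real assume t: "0 \<le> t"
  interpret wiener_filtration M F W by unfold_locales (rule assms(1))
  let ?G = "{W s -` B \<inter> space M | s B. 0 \<le> s \<and> s \<le> t \<and> B \<in> sets borel} \<union> null_sets M"
  have "?G \<subseteq> sets (F t)"
  proof (intro Un_least subsetI)
    fix A assume "A \<in> {W s -` B \<inter> space M | s B. 0 \<le> s \<and> s \<le> t \<and> B \<in> sets borel}"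
    then obtain s B where "A = W s -` B \<inter> space (F t)" "0 \<le> s" "s \<le> t" "B \<in> sets borel"
      unfolding space_F[OF t] by blast
    then show "A \<in> sets (F t)" using measurable_sets[OF measurable_W] by blast
  next
    fix A assume "A \<in> null_sets M"
    then show "A \<in> sets (F t)" using null_sets_F mono_F[OF order.refl t] by blast
  qed
  moreover have "?G \<subseteq> Pow (space M)" using sets.sets_into_space by auto
  ultimately have "subalgebra (F t) (augmented_natural_filtration M W t)"
    using sets.sigma_sets_subset[of ?G "F t"] space_F[OF t]
    by (simp add: subalgebra_def augmented_natural_filtration_def)
  then show "X t \<in> borel_measurable (F t)"
    using assms(2) t measurable_from_subalg unfolding adapted_def by blast
qed

theorem lemma2p2:
  fixes M :: "'a measure"
    and F :: "real \<Rightarrow> 'a measure"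
    and W X :: "real \<Rightarrow> 'a \<Rightarrow> real"
    and b \<sigma> x0 C :: real
  assumes "complete_filtered_prob_space M F"
    and "wiener_process M F W"
    and "b > 0" and "\<sigma> > 0" and "x0 > 0" and "2 * b \<ge> \<sigma>\<^sup>2"
    and "C > max b 1"
    and "strong_solution M F W (\<lambda>x. b - min x C) (\<lambda>x. \<sigma> * sqrt (min (max x 0) C)) x0 X"
  shows "measure M {\<omega> \<in> space M. \<forall>t\<ge>0. X t \<omega> > 0} = 1"
proof -
  interpret complete_filtered_prob_space M F by (rule assms(1))
  from assms(8) obtain I where I: "ito_integral M F W (\<lambda>s \<omega>. \<sigma> * sqrt (min (max (X s \<omega>) 0) C)) I"
    "AE \<omega> in M. \<forall>t\<ge>0. X t \<omega> = x0 + set_lebesgue_integral lborel {0..t} (\<lambda>s. b - min (X s \<omega>) C) + I t \<omega>"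
    unfolding strong_solution_def by blast
  interpret truncated_cir M F W X I b \<sigma> x0 C
  proof unfold_locales
    show "adapted F X"
      using assms(2,8) adapted_augmented_imp_adapted unfolding strong_solution_def by blast
  qed (use assms I in \<open>auto simp: strong_solution_def continuous_paths_def\<close>)
  \<comment> \<open>The event involves uncountably many times; its measurability comes from
    completeness, as its complement lies in a null set.\<close>
  obtain N where N: "N \<in> null_sets M" "{\<omega> \<in> space M. \<not> (\<forall>t\<ge>0. 0 < X t \<omega>)} \<subseteq> N"
    using AE_X_positive by (auto elim!: AE_E simp: null_sets_def)
  have "{\<omega> \<in> space M. \<not> (\<forall>t\<ge>0. 0 < X t \<omega>)} \<in> events"
    using complete2[OF N(2,1)] by (simp add: null_sets_def)
  then have "space M - {\<omega> \<in> space M. \<not> (\<forall>t\<ge>0. 0 < X t \<omega>)} \<in> events" by (rule sets.compl_sets)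
  also have "space M - {\<omega> \<in> space M. \<not> (\<forall>t\<ge>0. 0 < X t \<omega>)} = {\<omega> \<in> space M. \<forall>t\<ge>0. 0 < X t \<omega>}" by auto
  finally show ?thesis using AE_X_positive by (simp add: prob_Collect_eq_1)
qed

end
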